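(* Let $F$, $\omega$, $U$, $\gamma_0$ be as in the context, let $K_{F,\omega}$ be the field associated to the deformation $dF+\epsilon\omega=0$, and let $\eta_\epsilon=dF+\epsilon\omega$ be such that there exists a Françoise sequence of finite length $\ell$ associated to this deformation. (i) Then the deformation $dF+\epsilon\omega=0$ admits a univalued first integral which is Darboux with respect to the field $K_{F,\omega}$. (ii) Then there exists a meromorphic one-form $\tilde\theta_\epsilon$ verifying the Godbillon-Vey sequence of length $2$: $$d\eta_\epsilon=\eta_\epsilon\wedge\tilde\theta_\epsilon,\qquad d\tilde\theta_\epsilon=0,$$ such that there exists a (possibly multivalued) first integral $\tilde F_\epsilon$ of $dF+\epsilon\omega=0$ verifying $$d\tilde F_\epsilon=f\,\eta_\epsilon,$$ where $f$, satisfying $$df=f\,\tilde\theta_\epsilon,$$ is a (possibly multivalued) function in a tubular neighborhood $U$ of the cycle $\gamma_0$. In particular, the function $f$ belongs to a Liouville extension of $K_{F,\omega}$, and $\tilde F_\epsilon$ belongs to a Darboux extension of this Liouville extension.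
   Context: Setting. Let $\gamma_0\subset\mathbb{C}^2$ be a regular closed curve (cycle), $\Sigma$ a transversal to $\gamma_0$, and $F$ a holomorphic function defined on a tubular neighborhood $U\subset\mathbb{C}^2$ of $\gamma_0$ formed by regular cycles $\gamma(t)\subset F^{-1}(t)$, $t\in F(\Sigma)$, with $\gamma_0=\gamma(t_0)$. Let $\omega$ be a holomorphic one-form on $U$. Consider the deformation $dF+\epsilon\omega=0$ of the integrable foliation $dF=0$. Here $d$ is the differential with respect to the variables $(x,y)\in U$, and $\epsilon$ is a parameter. Françoise sequence. Put $g_0=1$. A Françoise sequence associated to the deformation is a sequence of pairs $(g_i,r_i)$, $i=1,2,\ldots$, of univalued holomorphic functions on $U$ (i.e. in a neighborhood of the cycles $\gamma(t)$) satisfying $g_{i-1}\omega=g_i\,dF+dr_i$. Its length is $\ell$ if $\ell$ is the smallest index such that $g_{\ell+1}=0$; if no such index exists, the length is infinite. Extensions. Let $K$ be a differential field, $G$ a function, and $K_G$ the extension of $K$ by $G$. The extension $K_G$ is called Darboux, Liouville or Riccati, respectively, if it belongs to a finite sequence of field extensions starting from $K$, in which each step is either algebraic or given, respectively, by solutions of the equations $$dG=\eta_0,\qquad dG=G\eta_1+\eta_0,\qquad dG=G^2\eta_2+G\eta_1+\eta_0,$$ with $\eta_i$ one-forms with coefficients in the corresponding field extension. In that case $G$ is called Darboux, Liouville or Riccati with respect to $K$. Field of the deformation. $K_{F,\omega}$ is the smallest differential field in a tubular neighborhood $U$ of $\gamma_0$ containing the functions given by the coefficients of $dF$ and $\omega$.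 A first integral $F_\epsilon=\sum_{i=0}^m\epsilon^iF_i$, $m<\infty$, of $dF+\epsilon\omega=0$ is called Darboux, Liouville or Riccati, respectively (with respect to $K_{F,\omega}$), if all $F_i$ are in the corresponding extension of the field $K_{F,\omega}$. *)

theory Defs
  imports "HOL-Analysis.Analysis"
begin

section \<open>Holomorphic functions and forms in two complex variables\<close>

type_synonym C2 = "complex \<times> complex"

definition holo :: "C2 set \<Rightarrow> (C2 \<Rightarrow> complex) \<Rightarrow> bool" where
  "holo U f \<longleftrightarrow> open U \<and>
     (\<forall>z\<in>U. \<exists>a b. (f has_derivative (\<lambda>v. a * fst v + b * snd v)) (at z))"

text \<open>A one-form \<open>a dx + b dy\<close> is the map \<open>z \<mapsto> (a z, b z)\<close>; a two-form is represented by its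
  coefficient with respect to \<open>dx \<and> dy\<close>.\<close>

definition cscale :: "complex \<Rightarrow> C2 \<Rightarrow> C2" where
  "cscale c v = (c * fst v, c * snd v)"

definition wedge :: "C2 \<Rightarrow> C2 \<Rightarrow> complex" where
  "wedge v w = fst v * snd w - snd v * fst w"

definition pdx :: "(C2 \<Rightarrow> complex) \<Rightarrow> C2 \<Rightarrow> complex" where
  "pdx f z = deriv (\<lambda>x. f (x, snd z)) (fst z)"

definition pdy :: "(C2 \<Rightarrow> complex) \<Rightarrow> C2 \<Rightarrow> complex" where
  "pdy f z = deriv (\<lambda>y. f (fst z, y)) (snd z)"

definition d0 :: "(C2 \<Rightarrow> complex) \<Rightarrow> C2 \<Rightarrow> C2" where
  "d0 f z = (pdx f z, pdy f z)"

definition d1 :: "(C2 \<Rightarrow> C2) \<Rightarrow> C2 \<Rightarrow> complex" where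
  "d1 \<theta> z = pdx (\<lambda>w. snd (\<theta> w)) z - pdy (\<lambda>w. fst (\<theta> w)) z"

definition holo_form :: "C2 set \<Rightarrow> (C2 \<Rightarrow> C2) \<Rightarrow> bool" where
  "holo_form U \<theta> \<longleftrightarrow> holo U (\<lambda>z. fst (\<theta> z)) \<and> holo U (\<lambda>z. snd (\<theta> z))"

definition deform :: "(C2 \<Rightarrow> complex) \<Rightarrow> (C2 \<Rightarrow> C2) \<Rightarrow> complex \<Rightarrow> C2 \<Rightarrow> C2" where
  "deform F \<omega> \<epsilon> z = d0 F z + cscale \<epsilon> (\<omega> z)"

section \<open>Meromorphic functions\<close>

text \<open>A meromorphic function is represented by a total function whose values on a nowhere dense
  set (where a local denominator vanishes) are irrelevant. Identities between meromorphic objects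
  are therefore required on an open dense subset only.\<close>

definition generically :: "C2 set \<Rightarrow> (C2 \<Rightarrow> bool) \<Rightarrow> bool" where
  "generically V P \<longleftrightarrow> (\<exists>W. open W \<and> W \<subseteq> V \<and> V \<subseteq> closure W \<and> (\<forall>z\<in>W. P z))"

definition merom :: "C2 set \<Rightarrow> (C2 \<Rightarrow> complex) \<Rightarrow> bool" where
  "merom V f \<longleftrightarrow> (\<forall>p\<in>V. \<exists>W a b. p \<in> W \<and> W \<subseteq> V \<and> holo W a \<and> holo W b \<and>
     generically W (\<lambda>z. b z \<noteq> 0) \<and> (\<forall>z\<in>W. b z \<noteq> 0 \<longrightarrow> f z = a z / b z))"

definition merom_form :: "C2 set \<Rightarrow> (C2 \<Rightarrow> C2) \<Rightarrow> bool" where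
  "merom_form V \<theta> \<longleftrightarrow> merom V (\<lambda>z. fst (\<theta> z)) \<and> merom V (\<lambda>z. snd (\<theta> z))"

section \<open>Differential fields and their extensions\<close>

text \<open>Differential subfields, over the constants \<open>\<complex>\<close>, of the field of meromorphic functions on a
  connected open set \<open>V\<close>. They are saturated with respect to generic equality on \<open>V\<close>, so that they
  correspond to sets of genuine meromorphic functions. Since \<open>inverse 0 = 0\<close>, closure under
  pointwise inverse is closure under inverses of the nonzero elements.\<close>

definition diff_field :: "C2 set \<Rightarrow> (C2 \<Rightarrow> complex) set \<Rightarrow> bool" where
  "diff_field V K \<longleftrightarrow>
     (\<forall>f\<in>K. merom V f) \<and>
     (\<forall>f\<in>K. \<forall>g. merom V g \<and> generically V (\<lambda>z. g z = f z) \<longrightarrow> g \<in> K) \<and>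
     (\<forall>c. (\<lambda>z. c) \<in> K) \<and>
     (\<forall>f\<in>K. \<forall>g\<in>K. (\<lambda>z. f z + g z) \<in> K \<and> (\<lambda>z. f z - g z) \<in> K \<and> (\<lambda>z. f z * g z) \<in> K) \<and>
     (\<forall>f\<in>K. (\<lambda>z. inverse (f z)) \<in> K) \<and>
     (\<forall>f\<in>K. pdx f \<in> K \<and> pdy f \<in> K)"

definition diff_field_gen :: "C2 set \<Rightarrow> (C2 \<Rightarrow> complex) set \<Rightarrow> (C2 \<Rightarrow> complex) set" where
  "diff_field_gen V S = \<Inter>{L. diff_field V L \<and> S \<subseteq> L}"

definition deform_field :: "C2 set \<Rightarrow> (C2 \<Rightarrow> complex) \<Rightarrow> (C2 \<Rightarrow> C2) \<Rightarrow> (C2 \<Rightarrow> complex) set" where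
  "deform_field U F \<omega> =
     diff_field_gen U {pdx F, pdy F, (\<lambda>z. fst (\<omega> z)), (\<lambda>z. snd (\<omega> z))}"

definition restrict_field :: "C2 set \<Rightarrow> (C2 \<Rightarrow> complex) set \<Rightarrow> (C2 \<Rightarrow> complex) set" where
  "restrict_field V K = {g. merom V g \<and> (\<exists>f\<in>K. generically V (\<lambda>z. g z = f z))}"

definition form_over :: "(C2 \<Rightarrow> complex) set \<Rightarrow> (C2 \<Rightarrow> C2) \<Rightarrow> bool" where
  "form_over L \<theta> \<longleftrightarrow> (\<lambda>z. fst (\<theta> z)) \<in> L \<and> (\<lambda>z. snd (\<theta> z)) \<in> L"

definition algebraic_over :: "C2 set \<Rightarrow> (C2 \<Rightarrow> complex) set \<Rightarrow> (C2 \<Rightarrow> complex) \<Rightarrow> bool" where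
  "algebraic_over V L G \<longleftrightarrow> (\<exists>n::nat. \<exists>c. n \<ge> 1 \<and> (\<forall>i\<le>n. c i \<in> L) \<and>
     \<not> generically V (\<lambda>z. c n z = 0) \<and> generically V (\<lambda>z. (\<Sum>i\<le>n. c i z * G z ^ i) = 0))"

definition darboux_eq :: "C2 set \<Rightarrow> (C2 \<Rightarrow> complex) set \<Rightarrow> (C2 \<Rightarrow> complex) \<Rightarrow> bool" where
  "darboux_eq V L G \<longleftrightarrow> (\<exists>\<eta>0. form_over L \<eta>0 \<and> generically V (\<lambda>z. d0 G z = \<eta>0 z))"

definition liouville_eq :: "C2 set \<Rightarrow> (C2 \<Rightarrow> complex) set \<Rightarrow> (C2 \<Rightarrow> complex) \<Rightarrow> bool" where
  "liouville_eq V L G \<longleftrightarrow> (\<exists>\<eta>0 \<eta>1. form_over L \<eta>0 \<and> form_over L \<eta>1 \<and>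
     generically V (\<lambda>z. d0 G z = cscale (G z) (\<eta>1 z) + \<eta>0 z))"

inductive ext_tower ::
  "((C2 \<Rightarrow> complex) set \<Rightarrow> (C2 \<Rightarrow> complex) \<Rightarrow> bool) \<Rightarrow> C2 set \<Rightarrow>
   (C2 \<Rightarrow> complex) set \<Rightarrow> (C2 \<Rightarrow> complex) set \<Rightarrow> bool"
  for E V K where
  base: "ext_tower E V K K"
| step: "ext_tower E V K L \<Longrightarrow> merom V G \<Longrightarrow> algebraic_over V L G \<or> E L G \<Longrightarrow>
         ext_tower E V K (diff_field_gen V (insert G L))"

definition darboux_ext where "darboux_ext V = ext_tower (darboux_eq V) V"

definition liouville_ext where "liouville_ext V = ext_tower (liouville_eq V) V"

text \<open>Elements of extensions of a field on \<open>U\<close> are in general multivalued on \<open>U\<close>. An extension is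
  therefore formed on a small ball in \<open>U\<close>, where branches are univalued; by the identity theorem,
  restriction to the ball loses no information.\<close>

definition darboux_family ::
  "C2 set \<Rightarrow> (C2 \<Rightarrow> complex) set \<Rightarrow> nat \<Rightarrow> (nat \<Rightarrow> C2 \<Rightarrow> complex) \<Rightarrow> bool" where
  "darboux_family U K m Fs \<longleftrightarrow> (\<exists>p \<rho> D. 0 < \<rho> \<and> ball p \<rho> \<subseteq> U \<and>
     darboux_ext (ball p \<rho>) (restrict_field (ball p \<rho>) K) D \<and> (\<forall>i\<le>m. Fs i \<in> D))"

section \<open>First integrals, univalued and multivalued\<close>

definition first_integral :: "C2 set \<Rightarrow> (C2 \<Rightarrow> C2) \<Rightarrow> (C2 \<Rightarrow> complex) \<Rightarrow> bool" where
  "first_integral U \<eta> G \<longleftrightarrow> holo U G \<and> (\<forall>z\<in>U. wedge (d0 G z) (\<eta> z) = 0) \<and>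
     \<not> G constant_on U"

text \<open>A multivalued holomorphic function on \<open>U\<close> is a holomorphic function on the universal cover
  of \<open>U\<close>, that is, a function of paths in \<open>U\<close> with a given starting point \<open>p\<close> which depends only on
  their homotopy class relative to the endpoints.\<close>

definition paths_from :: "C2 set \<Rightarrow> C2 \<Rightarrow> (real \<Rightarrow> C2) set" where
  "paths_from U p = {c. path c \<and> path_image c \<subseteq> U \<and> pathstart c = p}"

definition branch :: "((real \<Rightarrow> C2) \<Rightarrow> complex) \<Rightarrow> (real \<Rightarrow> C2) \<Rightarrow> C2 \<Rightarrow> complex" where
  "branch f c z = f (c +++ linepath (pathfinish c) z)"

definition mv_holo :: "C2 set \<Rightarrow> C2 \<Rightarrow> ((real \<Rightarrow> C2) \<Rightarrow> complex) \<Rightarrow> bool" where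
  "mv_holo U p f \<longleftrightarrow>
     (\<forall>c c'. pathstart c = p \<and> homotopic_paths U c c' \<longrightarrow> f c = f c') \<and>
     (\<forall>c\<in>paths_from U p. \<exists>\<rho>>0. ball (pathfinish c) \<rho> \<subseteq> U \<and>
        holo (ball (pathfinish c) \<rho>) (branch f c))"

definition mv_d :: "((real \<Rightarrow> C2) \<Rightarrow> complex) \<Rightarrow> (real \<Rightarrow> C2) \<Rightarrow> C2" where
  "mv_d f c = d0 (branch f c) (pathfinish c)"

definition mv_first_integral ::
  "C2 set \<Rightarrow> C2 \<Rightarrow> (C2 \<Rightarrow> C2) \<Rightarrow> ((real \<Rightarrow> C2) \<Rightarrow> complex) \<Rightarrow> bool" where
  "mv_first_integral U p \<eta> G \<longleftrightarrow> mv_holo U p G \<and>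
     (\<forall>c\<in>paths_from U p. wedge (mv_d G c) (\<eta> (pathfinish c)) = 0) \<and>
     \<not> G constant_on paths_from U p"

definition godbillon_vey2 :: "C2 set \<Rightarrow> (C2 \<Rightarrow> C2) \<Rightarrow> (C2 \<Rightarrow> C2) \<Rightarrow> bool" where
  "godbillon_vey2 U \<eta> \<theta> \<longleftrightarrow>
     generically U (\<lambda>z. d1 \<eta> z = wedge (\<eta> z) (\<theta> z)) \<and> generically U (\<lambda>z. d1 \<theta> z = 0)"

section \<open>Families of cycles\<close>

definition regular_cycle :: "(real \<Rightarrow> C2) \<Rightarrow> bool" where
  "regular_cycle c \<longleftrightarrow> (\<forall>s. c (s + 1) = c s) \<and> inj_on c {0..<1} \<and>
     c C1_differentiable_on UNIV \<and> (\<forall>s. vector_derivative c (at s) \<noteq> 0)"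

definition transversal :: "(C2 \<Rightarrow> complex) \<Rightarrow> C2 set \<Rightarrow> (real \<Rightarrow> C2) \<Rightarrow> C2 set \<Rightarrow> bool" where
  "transversal F U c S \<longleftrightarrow> S \<subseteq> U \<and> (\<exists>\<sigma>::complex \<Rightarrow> C2.
     (\<lambda>w. fst (\<sigma> w)) holomorphic_on ball 0 1 \<and> (\<lambda>w. snd (\<sigma> w)) holomorphic_on ball 0 1 \<and>
     inj_on \<sigma> (ball 0 1) \<and> \<sigma> ` ball 0 1 = S \<and> \<sigma> 0 \<in> range c \<and>
     (\<forall>w\<in>ball 0 1. deriv (\<lambda>w. F (\<sigma> w)) w \<noteq> 0))"

text \<open>\<open>U\<close> is a tubular neighbourhood formed by the cycles \<open>\<gamma> t\<close>, \<open>t \<in> T\<close>: the fibration by level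
  curves of \<open>F\<close> is trivial on \<open>U\<close>, each fibre \<open>U \<inter> F\<^sup>-\<^sup>1(t)\<close> being an annulus with core \<open>\<gamma> t\<close>.\<close>

definition cycle_tube ::
  "(C2 \<Rightarrow> complex) \<Rightarrow> (complex \<Rightarrow> real \<Rightarrow> C2) \<Rightarrow> complex set \<Rightarrow> C2 set \<Rightarrow> bool" where
  "cycle_tube F \<gamma> T U \<longleftrightarrow> open U \<and>
     (\<exists>(h :: complex \<times> real \<times> complex \<Rightarrow> C2) k.
        homeomorphism (sphere 0 1 \<times> {-1<..<1} \<times> T) U h k \<and>
        (\<forall>e\<in>sphere 0 1. \<forall>u\<in>{-1<..<1}. \<forall>t\<in>T. F (h (e, u, t)) = t) \<and>
        (\<forall>t\<in>T. \<forall>s. \<gamma> t s = h (cis (2 * pi * s), 0, t)))"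

definition cycle_family ::
  "(C2 \<Rightarrow> complex) \<Rightarrow> C2 set \<Rightarrow> C2 set \<Rightarrow> (complex \<Rightarrow> real \<Rightarrow> C2) \<Rightarrow> complex \<Rightarrow> bool" where
  "cycle_family F U S \<gamma> t0 \<longleftrightarrow> holo U F \<and> (\<forall>z\<in>U. d0 F z \<noteq> 0) \<and>
     transversal F U (\<gamma> t0) S \<and> t0 \<in> F ` S \<and>
     cycle_tube F \<gamma> (F ` S) U \<and> (\<forall>t\<in>F ` S. regular_cycle (\<gamma> t))"

section \<open>Francoise sequences\<close>

definition francoise_seq ::
  "C2 set \<Rightarrow> (C2 \<Rightarrow> complex) \<Rightarrow> (C2 \<Rightarrow> C2) \<Rightarrow> (nat \<Rightarrow> C2 \<Rightarrow> complex) \<Rightarrow> (nat \<Rightarrow> C2 \<Rightarrow> complex) \<Rightarrow> bool"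
  where
  "francoise_seq U F \<omega> g r \<longleftrightarrow> (\<forall>z\<in>U. g 0 z = 1) \<and>
     (\<forall>i\<ge>1. holo U (g i) \<and> holo U (r i) \<and>
        (\<forall>z\<in>U. cscale (g (i - 1) z) (\<omega> z) = cscale (g i z) (d0 F z) + d0 (r i) z))"

definition francoise_length :: "C2 set \<Rightarrow> (nat \<Rightarrow> C2 \<Rightarrow> complex) \<Rightarrow> nat \<Rightarrow> bool" where
  "francoise_length U g l \<longleftrightarrow> (\<forall>z\<in>U. g (l + 1) z = 0) \<and> (\<forall>j<l. \<exists>z\<in>U. g (j + 1) z \<noteq> 0)"

end

theory Submission
  imports Defs "HOL-Complex_Analysis.Complex_Analysis"
begin

text \<open>Let \<open>g\<close>, \<open>r\<close> be a Francoise sequence of length \<open>l\<close>. Multiplying the relation with index \<open>i\<close> by a power of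
\<open>- \<epsilon>\<close> and adding up, all terms but two telescope: with
\<open>M\<^sub>\<epsilon> = \<Sum>i\<le>l. (- \<epsilon>)\<^sup>i g\<^sub>i\<close> and \<open>F\<^sub>\<epsilon> = F - \<Sum>i=1..l+1. (- \<epsilon>)\<^sup>i r\<^sub>i\<close> one has
\<open>dF\<^sub>\<epsilon> = M\<^sub>\<epsilon> (dF + \<epsilon> \<omega>)\<close>. So \<open>F\<^sub>\<epsilon>\<close> is a univalued first integral with integrating factor \<open>M\<^sub>\<epsilon>\<close>, and
\<open>\<theta>\<^sub>\<epsilon> = dM\<^sub>\<epsilon> / M\<^sub>\<epsilon>\<close> is closed and satisfies the first Godbillon-Vey equation, because \<open>d(dF\<^sub>\<epsilon>) = 0\<close>
(\<open>integrating_factor_godbillon_vey\<close>). The substance of the theorem is that the functions \<open>r\<^sub>i\<close> and \<open>g\<^sub>i\<close> are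
obtained from the coefficients of \<open>dF\<close> and \<open>\<omega>\<close> by quadratures and algebraic equations.

Suppose first that \<open>dF \<and> \<omega>\<close> does not vanish identically. Near a point where it is nonzero, let \<open>X\<close>, \<open>Y\<close>
be the frame dual to \<open>dF\<close>, \<open>\<omega>\<close>. For \<open>F\<^sub>\<epsilon> = \<Sum>k. \<epsilon>\<^sup>k F\<^sub>k\<close> the relations say \<open>Y F\<^sub>0 = 0\<close>, \<open>Y F\<^sub>k\<^sub>+\<^sub>1 = X F\<^sub>k\<close> and
\<open>X F\<^sub>l\<^sub>+\<^sub>1 = 0\<close>: the polynomial \<open>F\<^sub>\<epsilon>\<close> in \<open>\<epsilon>\<close> is annihilated by \<open>Y - \<epsilon> X\<close>. Three ideas give its coefficients.

\<^item> Finiteness. The jets \<open>X\<^sup>j F\<^sub>k\<close> with \<open>j + k\<close> at most the degree span a module stable under differentiation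
  (\<open>jet_closed_pd\<close>), so polynomial first integrals of given degree are determined by finitely many numbers, at
  most quadratically many in the degree. There are more products \<open>\<epsilon>\<^sup>a P\<^sup>b h\<^sup>c\<close> than that, so any polynomial first
  integral \<open>h\<close> is algebraically dependent on \<open>F\<^sub>\<epsilon>\<close>, and its constant coefficient is algebraic over the polynomials in \<open>F\<close>
  (\<open>leading_algebraic\<close>).

\<^item> Conjugation. Suppose \<open>F\<^sub>k\<close> is known for \<open>k < i\<close>. Choose a basis of the module spanned by \<open>1\<close> and the jets over
  the known functions (\<open>minimal_span\<close>); its independence makes the Pfaffian system it satisfies integrable, so
  that there are further solutions, with prescribed initial values (\<open>frobenius_linear\<close>). Replacing the basis by
  such a solution in the expressions of the \<open>F\<^sub>k\<close> gives another polynomial first integral. If the entry at \<open>1\<close>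
  is replaced by \<open>0\<close>, its coefficients below \<open>i\<close> vanish, and after division by \<open>\<epsilon>\<^sup>i\<close> the coefficient of index
  \<open>i\<close> is a constant coefficient, hence algebraic. Thus all conjugates of \<open>F\<^sub>i\<close>, in the sense of differential Galois
  theory, differ from it by algebraic functions.

\<^item> Reduction of order. Each quadrature makes one of these algebraic functions vanish, and once all are zero the
  function in question is already known; so finitely many quadratures give \<open>F\<^sub>i\<close> (\<open>reduction_of_order\<close>).

Induction on \<open>i\<close> gives \<open>polynomial_first_integral_darboux\<close>, and \<open>g\<^sub>k = (-1)\<^sup>k X F\<^sub>k\<close> is then known as well.

If \<open>dF \<and> \<omega>\<close> vanishes identically, then \<open>\<omega> = h dF\<close>, and the relations express \<open>g\<^sub>l\<^sub>+\<^sub>1 = 0\<close> as a monic algebraic equation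
for \<open>h\<close> whose coefficients are constant along the level curves of \<open>F\<close>. Hence \<open>h\<close> is constant along them
(\<open>degenerate_transverse_factor\<close>), \<open>dF + \<epsilon> \<omega>\<close> is closed, \<open>F\<close> itself is a first integral, and
over a disc of values \<open>h\<close> is a function \<open>H(F)\<close> (\<open>factor_through\<close>); with \<open>J' = H\<close> the function \<open>F + \<epsilon> J(F)\<close> is
a primitive of \<open>dF + \<epsilon> \<omega>\<close>.\<close>

section \<open>Calculus in two complex variables\<close>

definition hasd :: "(C2 \<Rightarrow> complex) \<Rightarrow> complex \<Rightarrow> complex \<Rightarrow> C2 \<Rightarrow> bool" where
  "hasd f a b z \<longleftrightarrow> (f has_derivative (\<lambda>v. a * fst v + b * snd v)) (at z)"

lemma hasd_slice_x:
  assumes "hasd f a b z"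
  shows "((\<lambda>x. f (x, snd z)) has_field_derivative a) (at (fst z))"
proof -
  have f: "(f has_derivative (\<lambda>v. a * fst v + b * snd v)) (at ((\<lambda>x. (x, snd z)) (fst z)))"
    using assms unfolding hasd_def by simp
  have "((\<lambda>x. (x, snd z)) has_derivative (\<lambda>x. (x, 0))) (at (fst z))"
    by (auto intro!: derivative_eq_intros)
  from diff_chain_at[OF this f] show ?thesis
    by (simp add: has_field_derivative_def o_def)
qed

lemma hasd_slice_y:
  assumes "hasd f a b z"
  shows "((\<lambda>y. f (fst z, y)) has_field_derivative b) (at (snd z))"
proof -
  have f: "(f has_derivative (\<lambda>v. a * fst v + b * snd v)) (at ((\<lambda>y. (fst z, y)) (snd z)))"
    using assms unfolding hasd_def by simp
  have "((\<lambda>y. (fst z, y)) has_derivative (\<lambda>x. (0, x))) (at (snd z))"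
    by (auto intro!: derivative_eq_intros)
  from diff_chain_at[OF this f] show ?thesis
    by (simp add: has_field_derivative_def o_def)
qed

lemma hasd_pd: "hasd f a b z \<Longrightarrow> pdx f z = a \<and> pdy f z = b"
  using hasd_slice_x hasd_slice_y unfolding pdx_def pdy_def by (metis DERIV_imp_deriv)

lemma hasd_pdx: "hasd f a b z \<Longrightarrow> pdx f z = a" and hasd_pdy: "hasd f a b z \<Longrightarrow> pdy f z = b"
  using hasd_pd by blast+

lemma hasd_const: "hasd (\<lambda>z. c) 0 0 z"
  unfolding hasd_def by (auto intro!: derivative_eq_intros)

lemma hasd_add: "hasd f a b z \<Longrightarrow> hasd g c d z \<Longrightarrow> hasd (\<lambda>z. f z + g z) (a + c) (b + d) z"
  unfolding hasd_def by (auto intro!: derivative_eq_intros simp: algebra_simps)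

lemma hasd_diff: "hasd f a b z \<Longrightarrow> hasd g c d z \<Longrightarrow> hasd (\<lambda>z. f z - g z) (a - c) (b - d) z"
  unfolding hasd_def by (auto intro!: derivative_eq_intros simp: algebra_simps)

lemma hasd_mult: "hasd f a b z \<Longrightarrow> hasd g c d z \<Longrightarrow>
    hasd (\<lambda>z. f z * g z) (a * g z + f z * c) (b * g z + f z * d) z"
  unfolding hasd_def by (auto intro!: derivative_eq_intros simp: algebra_simps)

lemma hasd_inverse: "hasd f a b z \<Longrightarrow> f z \<noteq> 0 \<Longrightarrow>
    hasd (\<lambda>z. inverse (f z)) (- a / (f z)\<^sup>2) (- b / (f z)\<^sup>2) z"
  unfolding hasd_def
  by (auto intro!: derivative_eq_intros simp: field_simps power2_eq_square fun_eq_iff)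

lemma hasd_comp: "hasd f a b z \<Longrightarrow> (g has_field_derivative d) (at (f z)) \<Longrightarrow>
    hasd (\<lambda>z. g (f z)) (d * a) (d * b) z"
  unfolding hasd_def has_field_derivative_def
  using diff_chain_at[of f "\<lambda>v. a * fst v + b * snd v" z g "(*) d"]
  by (simp add: o_def algebra_simps)

lemma hasd_cong: "open W \<Longrightarrow> z \<in> W \<Longrightarrow> (\<And>w. w \<in> W \<Longrightarrow> f w = g w) \<Longrightarrow> hasd f a b z \<Longrightarrow> hasd g a b z"
  unfolding hasd_def by (rule has_derivative_transform_within_open)

lemma hasd_holo: "open U \<Longrightarrow> (\<And>z. z \<in> U \<Longrightarrow> \<exists>a b. hasd f a b z) \<Longrightarrow> holo U f"
  unfolding holo_def hasd_def by blast

lemma holo_open: "holo U f \<Longrightarrow> open U"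
  by (simp add: holo_def)

lemma holo_hasd: "holo U f \<Longrightarrow> z \<in> U \<Longrightarrow> hasd f (pdx f z) (pdy f z) z"
  unfolding holo_def using hasd_def hasd_pd by metis

lemma holo_subset: "holo U f \<Longrightarrow> open W \<Longrightarrow> W \<subseteq> U \<Longrightarrow> holo W f"
  unfolding holo_def by blast

lemma holo_continuous_on: "holo U f \<Longrightarrow> continuous_on U f"
  by (rule continuous_at_imp_continuous_on) (auto dest!: holo_hasd simp: hasd_def intro: has_derivative_continuous)

lemma holo_const: "open U \<Longrightarrow> holo U (\<lambda>z. c)"
  by (rule hasd_holo) (auto intro: hasd_const)

lemma holo_add: "holo U f \<Longrightarrow> holo U g \<Longrightarrow> holo U (\<lambda>z. f z + g z)"
  by (rule hasd_holo, erule holo_open, intro exI, rule hasd_add; erule (1) holo_hasd)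

lemma holo_diff: "holo U f \<Longrightarrow> holo U g \<Longrightarrow> holo U (\<lambda>z. f z - g z)"
  by (rule hasd_holo, erule holo_open, intro exI, rule hasd_diff; erule (1) holo_hasd)

lemma holo_mult: "holo U f \<Longrightarrow> holo U g \<Longrightarrow> holo U (\<lambda>z. f z * g z)"
  by (rule hasd_holo, erule holo_open, intro exI, rule hasd_mult; erule (1) holo_hasd)

lemma holo_inverse: "holo U f \<Longrightarrow> (\<And>z. z \<in> U \<Longrightarrow> f z \<noteq> 0) \<Longrightarrow> holo U (\<lambda>z. inverse (f z))"
  by (rule hasd_holo, erule holo_open, intro exI, rule hasd_inverse, erule (1) holo_hasd) blast

lemma holo_divide: "holo U f \<Longrightarrow> holo U g \<Longrightarrow> (\<And>z. z \<in> U \<Longrightarrow> g z \<noteq> 0) \<Longrightarrow> holo U (\<lambda>z. f z / g z)"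
  unfolding divide_inverse by (intro holo_mult holo_inverse)

lemma holo_sum: "open U \<Longrightarrow> (\<And>i. i \<in> I \<Longrightarrow> holo U (f i)) \<Longrightarrow> holo U (\<lambda>z. \<Sum>i\<in>I. f i z)"
  by (induction I rule: infinite_finite_induct) (auto intro!: holo_add holo_const)

lemma holo_power: "holo U f \<Longrightarrow> holo U (\<lambda>z. f z ^ n)"
  by (induction n) (auto intro: holo_mult holo_const holo_open)

lemma holo_cong: "holo U f \<Longrightarrow> (\<And>z. z \<in> U \<Longrightarrow> g z = f z) \<Longrightarrow> holo U g"
proof (rule hasd_holo)
  fix z assume f: "holo U f" and eq: "\<And>z. z \<in> U \<Longrightarrow> g z = f z" and z: "z \<in> U"
  have "hasd g (pdx f z) (pdy f z) z"
    by (rule hasd_cong[OF holo_open[OF f] z _ holo_hasd[OF f z]]) (simp add: eq)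
  then show "\<exists>a b. hasd g a b z" by blast
qed (rule holo_open)

lemma holo_local: "open U \<Longrightarrow> (\<And>z. z \<in> U \<Longrightarrow> \<exists>W. z \<in> W \<and> holo W f) \<Longrightarrow> holo U f"
  by (rule hasd_holo, assumption) (blast dest: holo_hasd)

lemma pd_const [simp]: "pdx (\<lambda>z. c) z = 0" "pdy (\<lambda>z. c) z = 0"
  using hasd_pd[OF hasd_const] by blast+

lemma pd_cong:
  assumes "open W" "z \<in> W" "\<And>w. w \<in> W \<Longrightarrow> f w = g w"
  shows "pdx f z = pdx g z" "pdy f z = pdy g z"
proof -
  obtain A B where AB: "open A" "open B" "z \<in> A \<times> B" "A \<times> B \<subseteq> W"
    by (rule open_prod_elim[OF assms(1,2)]) blast
  then have z: "fst z \<in> A" "snd z \<in> B" by auto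
  have x: "f (x, snd z) = g (x, snd z)" if "x \<in> A" for x
    using AB(4) that z by (intro assms(3)) blast
  have y: "f (fst z, x) = g (fst z, x)" if "x \<in> B" for x
    using AB(4) that z by (intro assms(3)) blast
  show "pdx f z = pdx g z" unfolding pdx_def
    by (rule deriv_cong_ev[OF eventually_mono[OF eventually_nhds_in_open[OF AB(1) z(1)]] refl]) (rule x)
  show "pdy f z = pdy g z" unfolding pdy_def
    by (rule deriv_cong_ev[OF eventually_mono[OF eventually_nhds_in_open[OF AB(2) z(2)]] refl]) (rule y)
qed

lemma pd_add:
  assumes "holo U f" "holo U g" "z \<in> U"
  shows "pdx (\<lambda>z. f z + g z) z = pdx f z + pdx g z" "pdy (\<lambda>z. f z + g z) z = pdy f z + pdy g z"
  using hasd_pd[OF hasd_add[OF assms(1,2)[THEN holo_hasd, OF assms(3)]]] by auto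

lemma pd_diff:
  assumes "holo U f" "holo U g" "z \<in> U"
  shows "pdx (\<lambda>z. f z - g z) z = pdx f z - pdx g z" "pdy (\<lambda>z. f z - g z) z = pdy f z - pdy g z"
  using hasd_pd[OF hasd_diff[OF assms(1,2)[THEN holo_hasd, OF assms(3)]]] by auto

lemma pd_mult:
  assumes "holo U f" "holo U g" "z \<in> U"
  shows "pdx (\<lambda>z. f z * g z) z = pdx f z * g z + f z * pdx g z"
        "pdy (\<lambda>z. f z * g z) z = pdy f z * g z + f z * pdy g z"
  using hasd_pd[OF hasd_mult[OF assms(1,2)[THEN holo_hasd, OF assms(3)]]] by auto

lemma pd_sum:
  assumes "\<And>i. i \<in> I \<Longrightarrow> holo U (f i)" "z \<in> U"
  shows "pdx (\<lambda>z. \<Sum>i\<in>I. f i z) z = (\<Sum>i\<in>I. pdx (f i) z)"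
        "pdy (\<lambda>z. \<Sum>i\<in>I. f i z) z = (\<Sum>i\<in>I. pdy (f i) z)"
proof -
  have "hasd (\<lambda>z. \<Sum>i\<in>I. f i z) (\<Sum>i\<in>I. pdx (f i) z) (\<Sum>i\<in>I. pdy (f i) z) z"
    using assms(1)
  proof (induction I rule: infinite_finite_induct)
    case (insert i I)
    have "hasd (f i) (pdx (f i) z) (pdy (f i) z) z"
      using insert.prems assms(2) by (intro holo_hasd[of U]) auto
    from hasd_add[OF this insert.IH] show ?case using insert by simp
  qed (simp_all add: hasd_const)
  then show "pdx (\<lambda>z. \<Sum>i\<in>I. f i z) z = (\<Sum>i\<in>I. pdx (f i) z)"
        "pdy (\<lambda>z. \<Sum>i\<in>I. f i z) z = (\<Sum>i\<in>I. pdy (f i) z)"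
    by (simp_all add: hasd_pdx hasd_pdy)
qed

lemma curve_derivative:
  assumes f: "holo V f" and t: "(u t, v t) \<in> V"
    and d: "(u has_field_derivative c1) (at t)" "(v has_field_derivative c2) (at t)"
  shows "((\<lambda>t. f (u t, v t)) has_field_derivative (pdx f (u t, v t) * c1 + pdy f (u t, v t) * c2)) (at t)"
proof -
  let ?w = "(u t, v t)"
  have "(f has_derivative (\<lambda>k. pdx f ?w * fst k + pdy f ?w * snd k)) (at ((\<lambda>t. (u t, v t)) t))"
    using holo_hasd[OF f t] by (simp add: hasd_def)
  moreover have "((\<lambda>t. (u t, v t)) has_derivative (\<lambda>k. (c1 * k, c2 * k))) (at t)"
    by (rule has_derivative_Pair) (use d in \<open>simp_all add: has_field_derivative_def\<close>)
  ultimately have "((\<lambda>t. f (u t, v t)) has_derivative (\<lambda>k. pdx f ?w * (c1 * k) + pdy f ?w * (c2 * k))) (at t)"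
    by (auto dest: diff_chain_at simp: o_def)
  then show ?thesis
    unfolding has_field_derivative_def by (rule has_derivative_eq_rhs) (simp add: fun_eq_iff algebra_simps)
qed

lemma holo_curve:
  assumes f: "holo V f" and T: "open T" "\<And>t. t \<in> T \<Longrightarrow> (u t, v t) \<in> V"
    and uv: "u holomorphic_on T" "v holomorphic_on T"
  shows "(\<lambda>t. f (u t, v t)) holomorphic_on T"
  unfolding holomorphic_on_open[OF T(1)]
proof
  fix t assume t: "t \<in> T"
  show "\<exists>f'. ((\<lambda>t. f (u t, v t)) has_field_derivative f') (at t)"
    by (rule exI, rule curve_derivative[of V f u t v,
          OF f T(2)[OF t] holomorphic_derivI[OF uv(1) T(1) t] holomorphic_derivI[OF uv(2) T(1) t]])
qed

section \<open>Holomorphy of partial derivatives\<close>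

lemma polydisc_in_open:
  fixes U :: "C2 set"
  assumes "open U" "z \<in> U"
  obtains r where "r > 0" "cball (fst z) r \<times> cball (snd z) r \<subseteq> U"
proof -
  obtain A B where AB: "open A" "open B" "z \<in> A \<times> B" "A \<times> B \<subseteq> U"
    by (rule open_prod_elim[OF assms]) blast
  obtain r1 where r1: "r1 > 0" "cball (fst z) r1 \<subseteq> A" using AB by (metis mem_Times_iff open_contains_cball)
  obtain r2 where r2: "r2 > 0" "cball (snd z) r2 \<subseteq> B" using AB by (metis mem_Times_iff open_contains_cball)
  have "cball (fst z) (min r1 r2) \<times> cball (snd z) (min r1 r2) \<subseteq> A \<times> B"
    by (rule Sigma_mono) (use r1(2) r2(2) in auto)
  then show ?thesis using that[of "min r1 r2"] r1 r2 AB(4) by auto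
qed

definition sep_holo :: "C2 set \<Rightarrow> (C2 \<Rightarrow> complex) \<Rightarrow> bool" where
  "sep_holo U f \<longleftrightarrow> open U \<and> continuous_on U f \<and>
     (\<forall>z\<in>U. (\<lambda>x. f (x, snd z)) field_differentiable at (fst z) \<and>
            (\<lambda>y. f (fst z, y)) field_differentiable at (snd z))"

lemma holo_sep_holo: "holo U f \<Longrightarrow> sep_holo U f"
  unfolding sep_holo_def field_differentiable_def
  using holo_open holo_continuous_on hasd_slice_x hasd_slice_y holo_hasd by metis

lemma holo_slice_x: "sep_holo U f \<Longrightarrow> A \<times> {y} \<subseteq> U \<Longrightarrow> (\<lambda>x. f (x, y)) holomorphic_on A"
  unfolding holomorphic_on_def
proof
  fix x assume s: "sep_holo U f" "A \<times> {y} \<subseteq> U" "x \<in> A"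
  then have "(x, y) \<in> U" by blast
  then have "(\<lambda>x. f (x, y)) field_differentiable at x" using s(1) unfolding sep_holo_def by force
  then show "(\<lambda>x. f (x, y)) field_differentiable at x within A"
    by (rule field_differentiable_at_within)
qed

text \<open>The integrand of Cauchy's formula for the first derivative, on the circle of radius \<open>r\<close> about \<open>x0\<close> in the
variable \<open>x\<close>, parametrised by \<open>[0, 1]\<close>. It exhibits \<open>pdx f\<close> as an integral with a parameter, so that continuity and
differentiability in \<open>y\<close> pass from \<open>f\<close> to \<open>pdx f\<close>.\<close>

definition cauchy_kernel :: "(C2 \<Rightarrow> complex) \<Rightarrow> complex \<Rightarrow> real \<Rightarrow> C2 \<Rightarrow> real \<Rightarrow> complex" where
  "cauchy_kernel f x0 r z t = f (circlepath x0 r t, snd z) / (circlepath x0 r t - fst z)^2 *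
     (r * exp (2 * of_real pi * \<i> * t))"

lemma pdx_cauchy:
  assumes "sep_holo U f" "cball x0 r \<times> {snd z} \<subseteq> U" "fst z \<in> ball x0 r"
  shows "pdx f z = integral (cbox 0 1) (cauchy_kernel f x0 r z)"
    and "((\<lambda>x. f (x, snd z)) has_field_derivative integral (cbox 0 1) (cauchy_kernel f x0 r z)) (at (fst z))"
proof -
  have h: "(\<lambda>x. f (x, snd z)) holomorphic_on cball x0 r"
    using holo_slice_x assms by blast
  have "((\<lambda>x. f (x, snd z)) has_field_derivative
     (1 / (2 * of_real pi * \<i>) * contour_integral(circlepath x0 r) (\<lambda>u. f (u, snd z) / (u-fst z)^2))) (at (fst z))"
    by (rule Cauchy_derivative_integral_circlepath)
       (use h assms holomorphic_on_imp_continuous_on holomorphic_on_subset ball_subset_cball in blast)+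
  moreover have "(1 / (2 * of_real pi * \<i>) * contour_integral(circlepath x0 r) (\<lambda>u. f (u, snd z) / (u-fst z)^2))
     = integral (cbox 0 1) (cauchy_kernel f x0 r z)"
    unfolding contour_integral_integral integral_mult_right[symmetric] vector_derivative_circlepath box_real
    by (intro integral_cong) (simp add: cauchy_kernel_def vector_derivative_circlepath algebra_simps)
  ultimately show *: "((\<lambda>x. f (x, snd z)) has_field_derivative integral (cbox 0 1) (cauchy_kernel f x0 r z)) (at (fst z))"
    by simp
  then show "pdx f z = integral (cbox 0 1) (cauchy_kernel f x0 r z)"
    unfolding pdx_def by (rule DERIV_imp_deriv)
qed

lemma circlepath_in: "r > 0 \<Longrightarrow> circlepath x0 r t \<in> cball x0 r"
  by (simp add: circlepath dist_norm norm_mult)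
lemma circlepath_ne: "r > 0 \<Longrightarrow> x \<in> ball x0 r \<Longrightarrow> circlepath x0 r t \<noteq> x"
  by (auto simp: circlepath dist_norm norm_mult)

lemma cauchy_kernel_continuous:
  assumes "continuous_on U f" "r > 0" "cball x0 r \<times> B \<subseteq> U"
  shows "continuous_on ((ball x0 r \<times> B) \<times> cbox 0 1) (\<lambda>(z, t). cauchy_kernel f x0 r z t)"
proof -
  have c: "continuous_on S (\<lambda>p. circlepath x0 r (snd p))" for S :: "(C2 \<times> real) set"
    unfolding circlepath by (intro continuous_intros)
  have "continuous_on ((ball x0 r \<times> B) \<times> cbox 0 1) (\<lambda>p. f (circlepath x0 r (snd p), snd (fst p)))"
    by (rule continuous_on_compose2[OF assms(1)])
       (use assms circlepath_in in \<open>auto intro!: continuous_intros c\<close>)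
  then show ?thesis
    unfolding cauchy_kernel_def case_prod_beta
    by (intro continuous_intros c) (use assms circlepath_ne in auto)
qed

lemma pdx_continuous:
  assumes "sep_holo U f"
  shows "continuous_on U (pdx f)"
proof -
  have U: "open U" using assms sep_holo_def by blast
  have "continuous (at z) (pdx f)" if z: "z \<in> U" for z
  proof -
    obtain r where r: "r > 0" "cball (fst z) r \<times> cball (snd z) r \<subseteq> U"
      using polydisc_in_open[OF U z] by blast
    let ?V = "ball (fst z) r \<times> ball (snd z) r"
    have sub: "cball (fst z) r \<times> ball (snd z) r \<subseteq> U" using r by auto
    have "continuous_on ?V (\<lambda>w. integral (cbox 0 1) (cauchy_kernel f (fst z) r w))"
      by (rule integral_continuous_on_param[OF cauchy_kernel_continuous[OF _ r(1) sub]])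
         (use assms sep_holo_def in blast)
    moreover have "pdx f w = integral (cbox 0 1) (cauchy_kernel f (fst z) r w)" if "w \<in> ?V" for w
      by (rule pdx_cauchy[OF assms]) (use that sub in auto)
    ultimately have "continuous_on ?V (pdx f)"
      by (simp cong: continuous_on_cong)
    moreover have "open ?V" "z \<in> ?V" using r by (auto simp: open_Times mem_Times_iff)
    ultimately show ?thesis using continuous_on_eq_continuous_at by blast
  qed
  then show ?thesis by (simp add: continuous_at_imp_continuous_on)
qed

text \<open>Exchanging the variables transfers statements on \<open>pdx\<close> to \<open>pdy\<close>.\<close>

definition swapf :: "(C2 \<Rightarrow> complex) \<Rightarrow> C2 \<Rightarrow> complex" where "swapf f z = f (snd z, fst z)"

lemma swapf_swapf [simp]: "swapf (swapf f) = f" by (simp add: swapf_def fun_eq_iff)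
lemma pdx_swapf: "pdx (swapf f) = swapf (pdy f)"
  by (simp add: swapf_def pdx_def pdy_def fun_eq_iff)

lemma open_swap: "open U \<Longrightarrow> open (prod.swap ` (U :: C2 set))"
proof -
  assume "open U"
  have "prod.swap ` U = prod.swap -` U" by force
  moreover have "continuous_on UNIV (prod.swap :: C2 \<Rightarrow> C2)"
    unfolding prod.swap_def by (intro continuous_intros)
  ultimately show ?thesis using \<open>open U\<close> open_vimage by metis
qed

lemma continuous_on_swapf: "continuous_on U f \<Longrightarrow> continuous_on (prod.swap ` U) (swapf f)"
  unfolding swapf_def
  by (rule continuous_on_compose2[where s = "prod.swap ` U" and g = f and t = U])
     (auto intro!: continuous_intros)

lemma sep_holo_swap: "sep_holo U f \<Longrightarrow> sep_holo (prod.swap ` U) (swapf f)"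
  using continuous_on_swapf open_swap unfolding sep_holo_def by (auto simp: swapf_def)

lemma pdy_continuous:
  assumes "sep_holo U f"
  shows "continuous_on U (pdy f)"
  using continuous_on_swapf[OF pdx_continuous[OF sep_holo_swap[OF assms]]]
  by (simp add: pdx_swapf image_image)

text \<open>Osgood's lemma: the partial derivatives are continuous by Cauchy's formula, hence \<open>f\<close> is differentiable in both
variables jointly.\<close>

lemma osgood:
  assumes "sep_holo U f"
  shows "holo U f"
proof (rule hasd_holo)
  show U: "open U" using assms sep_holo_def by blast
  fix z assume z: "z \<in> U"
  obtain r where r: "r > 0" "cball (fst z) r \<times> cball (snd z) r \<subseteq> U"
    using polydisc_in_open[OF U z] by blast
  let ?A = "ball (fst z) r" and ?B = "ball (snd z) r"
  have "?A \<times> ?B \<subseteq> cball (fst z) r \<times> cball (snd z) r" by (intro Sigma_mono ball_subset_cball order_refl)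
  then have sub: "?A \<times> ?B \<subseteq> U" using r(2) by (rule subset_trans)
  have dx: "((\<lambda>x. f (x, snd w)) has_field_derivative pdx f w) (at (fst w))"
   and dy: "((\<lambda>y. f (fst w, y)) has_field_derivative pdy f w) (at (snd w))" if "w \<in> U" for w
  proof -
    have "(\<lambda>x. f (x, snd w)) field_differentiable at (fst w)"
      and "(\<lambda>y. f (fst w, y)) field_differentiable at (snd w)"
      using assms that unfolding sep_holo_def by blast+
    then show "((\<lambda>x. f (x, snd w)) has_field_derivative pdx f w) (at (fst w))"
      and "((\<lambda>y. f (fst w, y)) has_field_derivative pdy f w) (at (snd w))"
      by (simp_all add: pdx_def pdy_def DERIV_deriv_iff_field_differentiable)
  qed
  have "((\<lambda>(x,y). f (x,y)) has_derivative (\<lambda>(tx, ty). pdx f z * tx + blinfun_apply (blinfun_mult_right (pdy f z)) ty))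
         (at z within ?A \<times> ?B)"
  proof (rule has_derivative_partialsI[where fx = "(*) (pdx f z)" and fy = "\<lambda>x y. blinfun_mult_right (pdy f (x,y))"
      and f = "\<lambda>x y. f (x, y)" and x = "fst z" and y = "snd z", unfolded prod.collapse])
    show "((\<lambda>x. f (x, snd z)) has_derivative (*) (pdx f z)) (at (fst z) within ?A)"
      using dx[OF z] by (simp add: has_field_derivative_def has_derivative_at_withinI)
    show "((\<lambda>y. f (x, y)) has_derivative blinfun_apply (blinfun_mult_right (pdy f (x, y)))) (at y within ?B)"
      if "x \<in> ?A" "y \<in> ?B" for x y
    proof -
      have "(x, y) \<in> U" using that sub by blast
      from dy[OF this] show ?thesis by (simp add: has_field_derivative_def has_derivative_at_withinI)
    qed
    have "continuous_on (?A \<times> ?B) (\<lambda>w. blinfun_mult_right (pdy f w))"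
      by (intro continuous_intros continuous_on_subset[OF pdy_continuous[OF assms] sub])
    moreover have "z \<in> ?A \<times> ?B" using r by (simp add: mem_Times_iff)
    ultimately have "continuous (at z within ?A \<times> ?B) (\<lambda>w. blinfun_mult_right (pdy f w))"
      unfolding continuous_on_eq_continuous_within by blast
    then show "continuous (at z within ?A \<times> ?B) (\<lambda>(x, y). blinfun_mult_right (pdy f (x, y)))"
      by (simp add: split_def)
  qed (use r in \<open>simp_all add: convex_ball\<close>)
  moreover have "at z within ?A \<times> ?B = at z"
    by (rule at_within_open) (use r in \<open>simp_all add: open_Times mem_Times_iff\<close>)
  ultimately have "hasd f (pdx f z) (pdy f z) z"
    unfolding hasd_def by (simp add: split_def)
  then show "\<exists>a b. hasd f a b z" by blast
qed

lemma holo_swap: "holo U f \<Longrightarrow> holo (prod.swap ` U) (swapf f)"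
  using osgood sep_holo_swap holo_sep_holo by blast

text \<open>Differentiation under Cauchy's integral. The derivative found is also \<open>pdx (pdy f)\<close> by Cauchy's formula for \<open>pdy f\<close>,
which is how \<open>pd_commute\<close> follows.\<close>

lemma pdx_dy:
  assumes "holo U f" "z \<in> U"
  shows "\<exists>r>0. cball (fst z) r \<times> cball (snd z) r \<subseteq> U \<and>
    ((\<lambda>y. pdx f (fst z, y)) has_field_derivative integral (cbox 0 1) (cauchy_kernel (pdy f) (fst z) r z)) (at (snd z))"
proof -
  have s: "sep_holo U f" using holo_sep_holo assms by blast
  obtain r where r: "r > 0" "cball (fst z) r \<times> cball (snd z) r \<subseteq> U"
    using polydisc_in_open[OF holo_open[OF assms(1)] assms(2)] by blast
  let ?B = "ball (snd z) r"
  have "cball (fst z) r \<times> ?B \<subseteq> cball (fst z) r \<times> cball (snd z) r" by (intro Sigma_mono ball_subset_cball order_refl)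
  then have sub: "cball (fst z) r \<times> ?B \<subseteq> U" using r(2) by (rule subset_trans)
  let ?k = "\<lambda>g y. cauchy_kernel g (fst z) r (fst z, y)"
  have cont: "continuous_on (?B \<times> cbox 0 1) (\<lambda>(y, t). ?k g y t)" if "continuous_on U g" for g
  proof -
    have "continuous_on (?B \<times> cbox 0 1) (\<lambda>p. ((fst z, fst p), snd p))"
      by (intro continuous_intros)
    from continuous_on_compose2[OF cauchy_kernel_continuous[OF that r(1) sub, unfolded split_def] this]
    show ?thesis using r(1) by (simp add: split_def image_subset_iff)
  qed
  have w: "at (snd z) within ?B = at (snd z)" by (rule at_within_open) (use r(1) in simp_all)
  have "((\<lambda>y. integral (cbox 0 1) (?k f y)) has_field_derivative integral (cbox 0 1) (?k (pdy f) (snd z))) (at (snd z) within ?B)"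
  proof (rule leibniz_rule_field_derivative)
    show "continuous_on (?B \<times> cbox 0 1) (\<lambda>(y, t). ?k (pdy f) y t)"
      by (rule cont[OF pdy_continuous[OF s]])
    show "?k f y integrable_on cbox 0 1" if "y \<in> ?B" for y
    proof (rule integrable_continuous)
      have "continuous_on (cbox (0::real) 1) (\<lambda>t. (y, t))" by (intro continuous_intros)
      from continuous_on_compose2[OF cont[OF holo_continuous_on[OF assms(1)], unfolded split_def] this]
      show "continuous_on (cbox 0 1) (?k f y)" using that by (simp add: image_subset_iff)
    qed
    show "((\<lambda>y. ?k f y t) has_field_derivative ?k (pdy f) y t) (at y within ?B)"
      if "y \<in> ?B" for y t
    proof -
      have "(circlepath (fst z) r t, y) \<in> U"
        using that(1) circlepath_in[OF r(1), of "fst z" t] by (intro subsetD[OF sub] SigmaI)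
      from hasd_slice_y[OF holo_hasd[OF assms(1) this]]
      have "((\<lambda>y. f (circlepath (fst z) r t, y)) has_field_derivative pdy f (circlepath (fst z) r t, y)) (at y)"
        by simp
      from DERIV_cmult[OF this, of "1 / (circlepath (fst z) r t - fst z)^2 * (r * exp (2 * of_real pi * \<i> * t))"]
      have "((\<lambda>y. ?k f y t) has_field_derivative ?k (pdy f) y t) (at y)"
        by (simp add: cauchy_kernel_def mult.commute mult.left_commute)
      then show ?thesis by (rule has_field_derivative_at_within)
    qed
  qed (use r(1) in auto)
  then have "((\<lambda>y. integral (cbox 0 1) (?k f y)) has_field_derivative integral (cbox 0 1) (?k (pdy f) (snd z))) (at (snd z))"
    unfolding w .
  then have "((\<lambda>y. pdx f (fst z, y)) has_field_derivative integral (cbox 0 1) (?k (pdy f) (snd z))) (at (snd z))"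
  proof (rule has_field_derivative_transform_within_open[where S = ?B])
    show "integral (cbox 0 1) (?k f y) = pdx f (fst z, y)" if y: "y \<in> ?B" for y
    proof -
      have "cball (fst z) r \<times> {snd (fst z, y)} \<subseteq> cball (fst z) r \<times> ?B"
        by (rule Sigma_mono[OF order_refl]) (use y in simp)
      from pdx_cauchy(1)[OF s order_trans[OF this sub]] show ?thesis using r(1) by simp
    qed
  qed (use r(1) in auto)
  then show ?thesis using r by (intro exI[of _ r]) simp
qed

lemma holo_pdx:
  assumes "holo U f"
  shows "holo U (pdx f)"
proof (rule osgood, unfold sep_holo_def, intro conjI ballI)
  show "open U" using holo_open assms by blast
  show "continuous_on U (pdx f)" using pdx_continuous holo_sep_holo assms by blast
  fix z assume z: "z \<in> U"
  show "(\<lambda>y. pdx f (fst z, y)) field_differentiable at (snd z)"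
    using pdx_dy[OF assms z] unfolding field_differentiable_def by blast
  obtain r where r: "r > 0" "cball (fst z) r \<times> cball (snd z) r \<subseteq> U"
    using polydisc_in_open[OF holo_open[OF assms] z] by blast
  have "(\<lambda>x. f (x, snd z)) holomorphic_on ball (fst z) r"
    by (rule holo_slice_x[OF holo_sep_holo[OF assms]]) (use r in auto)
  then have "deriv (\<lambda>x. f (x, snd z)) holomorphic_on ball (fst z) r"
    by (simp add: holomorphic_deriv)
  then show "(\<lambda>x. pdx f (x, snd z)) field_differentiable at (fst z)"
    using r by (simp add: pdx_def holomorphic_on_imp_differentiable_at[where s = "ball (fst z) r"])
qed

lemma holo_pdy: "holo U f \<Longrightarrow> holo U (pdy f)"
  using holo_swap[OF holo_pdx[OF holo_swap]] by (fastforce simp: pdx_swapf image_image)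

lemma pd_commute:
  assumes "holo U f" "z \<in> U"
  shows "pdy (pdx f) z = pdx (pdy f) z"
proof -
  obtain r where r: "r > 0" "cball (fst z) r \<times> cball (snd z) r \<subseteq> U"
    "((\<lambda>y. pdx f (fst z, y)) has_field_derivative integral (cbox 0 1) (cauchy_kernel (pdy f) (fst z) r z)) (at (snd z))"
    using pdx_dy assms by blast
  have "pdx (pdy f) z = integral (cbox 0 1) (cauchy_kernel (pdy f) (fst z) r z)"
    by (rule pdx_cauchy[OF holo_sep_holo[OF holo_pdy[OF assms(1)]]]) (use r in auto)
  moreover have "pdy (pdx f) z = integral (cbox 0 1) (cauchy_kernel (pdy f) (fst z) r z)"
    unfolding pdy_def[of "pdx f"] by (rule DERIV_imp_deriv) (rule r(3))
  ultimately show ?thesis by simp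
qed

section \<open>The identity theorem and generic identities\<close>

lemma holo_line:
  assumes "holo U f" "\<And>s. s \<in> A \<Longrightarrow> (a + s * u, b + s * v) \<in> U"
  shows "(\<lambda>s. f (a + s * u, b + s * v)) holomorphic_on A"
  unfolding holomorphic_on_def
proof
  fix s assume "s \<in> A"
  have "((\<lambda>s. a + s * u) has_field_derivative u) (at s)" "((\<lambda>s. b + s * v) has_field_derivative v) (at s)"
    by (auto intro!: derivative_eq_intros)
  from curve_derivative[where u = "\<lambda>s. a + s * u" and v = "\<lambda>s. b + s * v", OF assms(1) assms(2)[OF \<open>s \<in> A\<close>] this]
  show "(\<lambda>s. f (a + s * u, b + s * v)) field_differentiable at s within A"
    using field_differentiable_at_within field_differentiable_def by blast
qed

text \<open>The complex line through a point of \<open>W\<close> and the given point meets the ball in a convex set, on which the identity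
theorem in one variable applies.\<close>

lemma holo_zero_ball:
  fixes z :: C2
  assumes "holo (ball z r) f" "open W" "W \<noteq> {}" "W \<subseteq> ball z r" "\<And>w. w \<in> W \<Longrightarrow> f w = 0" "q \<in> ball z r"
  shows "f q = 0"
proof -
  obtain p where p: "p \<in> W" using assms(3) by blast
  obtain a b where ab: "p = (a, b)" by fastforce
  obtain c d where cd: "q = (c, d)" by fastforce
  let ?g = "\<lambda>s. (a + s * (c - a), b + s * (d - b))"
  define A where "A = {s. ?g s \<in> ball z r}"
  have cont: "continuous_on UNIV ?g" by (intro continuous_intros)
  have A: "open A" unfolding A_def using open_vimage[OF open_ball cont] by (simp add: vimage_def)
  have conv: "convex A"
  proof (rule convexI)
    fix x y :: complex and u v :: real assume h: "x \<in> A" "y \<in> A" "0 \<le> u" "0 \<le> v" "u + v = 1"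
    then have u: "u = 1 - v" by simp
    have "u *\<^sub>R ?g x + v *\<^sub>R ?g y \<in> ball z r" using h convex_ball unfolding A_def convex_def by blast
    moreover have "u *\<^sub>R ?g x + v *\<^sub>R ?g y = ?g (u *\<^sub>R x + v *\<^sub>R y)"
      unfolding u by (simp add: scaleR_conv_of_real algebra_simps)
    ultimately show "u *\<^sub>R x + v *\<^sub>R y \<in> A" unfolding A_def by simp
  qed
  have hol: "(\<lambda>s. f (?g s)) holomorphic_on A" by (rule holo_line[OF assms(1)]) (simp add: A_def)
  have W: "open (?g -` W)" using open_vimage[OF assms(2) cont] .
  have 0: "0 \<in> ?g -` W" using p ab by simp
  have sub: "?g -` W \<subseteq> A" using assms(4) unfolding A_def by blast
  have lim: "0 islimpt (?g -` W)"
    using W 0 interior_limit_point interior_open by blast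
  have 1: "1 \<in> A" using assms(6) cd unfolding A_def by simp
  have "f (?g 1) = 0"
    by (rule analytic_continuation[OF hol A convex_connected[OF conv] sub subsetD[OF sub 0] lim _ 1])
       (use assms(5) in auto)
  then show ?thesis using cd by simp
qed

text \<open>The interior of the zero set is closed in \<open>U\<close>: a ball that meets it consists of zeros by \<open>holo_zero_ball\<close>.\<close>

lemma holo_zero_connected:
  assumes h: "holo U f" and con: "connected U" and W: "open W" "W \<noteq> {}" "W \<subseteq> U" "\<And>w. w \<in> W \<Longrightarrow> f w = 0"
    and z: "z \<in> U"
  shows "f z = 0"
proof -
  define Z where "Z = interior {w \<in> U. f w = 0}"
  have U: "open U" using holo_open h by blast
  have "openin (top_of_set U) Z"
    using interior_subset[of "{w \<in> U. f w = 0}"] by (simp add: openin_open_eq[OF U] Z_def subset_iff)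
  moreover have "closedin (top_of_set U) Z"
  proof -
    have "open (U - Z)" unfolding open_contains_ball
    proof
      fix w assume w: "w \<in> U - Z"
      then obtain r where r: "r > 0" "ball w r \<subseteq> U" using U open_contains_ball by blast
      have "ball w r \<inter> Z = {}"
      proof (rule ccontr)
        assume ne: "ball w r \<inter> Z \<noteq> {}"
        have "f q = 0" if "q \<in> ball w r" for q
          by (rule holo_zero_ball[OF holo_subset[OF h open_ball r(2)] _ ne _ _ that])
             (use interior_subset in \<open>auto simp: Z_def\<close>)
        then have "ball w r \<subseteq> Z" unfolding Z_def using r by (intro interior_maximal) auto
        then show False using w r(1) centre_in_ball by blast
      qed
      then show "\<exists>e>0. ball w e \<subseteq> U - Z" using r by blast
    qed
    moreover have "Z \<subseteq> U" using interior_subset[of "{w \<in> U. f w = 0}"] unfolding Z_def by blast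
    ultimately show ?thesis by (simp add: closedin_def openin_open_eq[OF U])
  qed
  moreover have "Z \<noteq> {}"
  proof -
    have "W \<subseteq> Z" unfolding Z_def by (rule interior_maximal) (use W in auto)
    then show ?thesis using W by blast
  qed
  ultimately have "Z = U"
    using con unfolding connected_clopen by blast
  then show ?thesis using z interior_subset unfolding Z_def by blast
qed

lemma holo_nonzero_dense:
  assumes "holo U f" "connected U" "z0 \<in> U" "f z0 \<noteq> 0" "open W" "W \<noteq> {}" "W \<subseteq> U"
  obtains z where "z \<in> W" "f z \<noteq> 0"
  using holo_zero_connected[OF assms(1,2,5,6,7) _ assms(3)] assms(4) by blast

lemma open_nonzero: "holo U f \<Longrightarrow> open {z \<in> U. f z \<noteq> 0}"
proof -
  assume h: "holo U f"
  have "open (U \<inter> f -` (- {0}))"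
    by (rule continuous_open_preimage[OF holo_continuous_on[OF h] holo_open[OF h]]) auto
  moreover have "U \<inter> f -` (- {0}) = {z \<in> U. f z \<noteq> 0}" by auto
  ultimately show ?thesis by simp
qed

text \<open>The zeros of a nontrivial holomorphic function on a connected set have empty interior. Every generic identity
that involves a division comes from this.\<close>

lemma generically_nonzero:
  assumes "holo U f" "connected U" "z0 \<in> U" "f z0 \<noteq> 0" "open V" "V \<subseteq> U" "\<And>z. z \<in> V \<Longrightarrow> f z \<noteq> 0 \<Longrightarrow> Q z"
  shows "generically V Q"
  unfolding generically_def
proof (intro exI conjI ballI)
  show "open {z \<in> V. f z \<noteq> 0}" by (rule open_nonzero) (rule holo_subset[OF assms(1,5,6)])
  show "V \<subseteq> closure {z \<in> V. f z \<noteq> 0}"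
  proof
    fix z assume z: "z \<in> V"
    show "z \<in> closure {z \<in> V. f z \<noteq> 0}"
      unfolding closure_iff_nhds_not_empty
    proof (intro allI impI)
      fix A T assume T: "T \<subseteq> A" "open T" "z \<in> T"
      obtain w where "w \<in> T \<inter> V" "f w \<noteq> 0"
        by (rule holo_nonzero_dense[OF assms(1,2,3,4), of "T \<inter> V"]) (use T z assms(5,6) in auto)
      then show "{z \<in> V. f z \<noteq> 0} \<inter> A \<noteq> {}" using T by blast
    qed
  qed
qed (use assms(7) in auto)

lemma generically_all: "open V \<Longrightarrow> (\<And>z. z \<in> V \<Longrightarrow> Q z) \<Longrightarrow> generically V Q"
  unfolding generically_def by (intro exI[of _ V]) (auto intro: closure_subset[THEN subsetD])

lemma generically_nonempty: "generically V Q \<Longrightarrow> V \<noteq> {} \<Longrightarrow> \<exists>z\<in>V. Q z"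
  unfolding generically_def by (metis closure_empty ex_in_conv subset_empty subsetD)

lemma holo_merom: "holo V f \<Longrightarrow> merom V f"
  unfolding merom_def
proof
  fix p assume h: "holo V f" "p \<in> V"
  then show "\<exists>W a b. p \<in> W \<and> W \<subseteq> V \<and> holo W a \<and> holo W b \<and>
     generically W (\<lambda>z. b z \<noteq> 0) \<and> (\<forall>z\<in>W. b z \<noteq> 0 \<longrightarrow> f z = a z / b z)"
    by (intro exI[of _ V] exI[of _ f] exI[of _ "\<lambda>z. 1"]) (auto intro: holo_const holo_open generically_all)
qed

section \<open>Differential rings of holomorphic functions\<close>

text \<open>A substitute for differential fields in which every element is holomorphic: only functions without zeros on \<open>B\<close>
are inverted, and a division elsewhere is paid for by shrinking \<open>B\<close>. The rule \<open>cong\<close> is there because functions are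
total while only their values on \<open>B\<close> matter.\<close>

inductive_set dring :: "C2 set \<Rightarrow> (C2 \<Rightarrow> complex) set \<Rightarrow> (C2 \<Rightarrow> complex) set" for B S where
  gen: "s \<in> S \<Longrightarrow> s \<in> dring B S"
| const: "(\<lambda>z. c) \<in> dring B S"
| add: "f \<in> dring B S \<Longrightarrow> g \<in> dring B S \<Longrightarrow> (\<lambda>z. f z + g z) \<in> dring B S"
| diff: "f \<in> dring B S \<Longrightarrow> g \<in> dring B S \<Longrightarrow> (\<lambda>z. f z - g z) \<in> dring B S"
| mult: "f \<in> dring B S \<Longrightarrow> g \<in> dring B S \<Longrightarrow> (\<lambda>z. f z * g z) \<in> dring B S"
| inverse: "f \<in> dring B S \<Longrightarrow> (\<And>z. z \<in> B \<Longrightarrow> f z \<noteq> 0) \<Longrightarrow> (\<lambda>z. inverse (f z)) \<in> dring B S"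
| pdx: "f \<in> dring B S \<Longrightarrow> pdx f \<in> dring B S"
| pdy: "f \<in> dring B S \<Longrightarrow> pdy f \<in> dring B S"
| cong: "f \<in> dring B S \<Longrightarrow> (\<And>z. z \<in> B \<Longrightarrow> g z = f z) \<Longrightarrow> g \<in> dring B S"

lemma dring_mono: "f \<in> dring B S \<Longrightarrow> B' \<subseteq> B \<Longrightarrow> S \<subseteq> S' \<Longrightarrow> f \<in> dring B' S'"
proof (induction rule: dring.induct)
  case (cong f g) show ?case by (rule dring.cong[of f]) (use cong in auto)
next
  case (inverse f) show ?case by (rule dring.inverse) (use inverse in auto)
qed (auto intro: dring.intros)

lemma dring_trans: "f \<in> dring B S \<Longrightarrow> S \<subseteq> dring B S' \<Longrightarrow> f \<in> dring B S'"
proof (induction rule: dring.induct)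
  case (cong f g) show ?case by (rule dring.cong[of f]) (use cong in auto)
qed (auto intro: dring.intros)

lemma dring_holo: "f \<in> dring B S \<Longrightarrow> open B \<Longrightarrow> (\<And>s. s \<in> S \<Longrightarrow> holo B s) \<Longrightarrow> holo B f"
proof (induction rule: dring.induct)
  case (cong f g) show ?case by (rule holo_cong[of _ f]) (use cong in auto)
qed (auto intro: holo_const holo_add holo_diff holo_mult holo_inverse holo_pdx holo_pdy)

lemma dring_divide: "f \<in> dring B S \<Longrightarrow> g \<in> dring B S \<Longrightarrow> (\<And>z. z \<in> B \<Longrightarrow> g z \<noteq> 0) \<Longrightarrow> (\<lambda>z. f z / g z) \<in> dring B S"
  unfolding divide_inverse by (intro dring.mult dring.inverse) auto

lemma dring_uminus: "f \<in> dring B S \<Longrightarrow> (\<lambda>z. - f z) \<in> dring B S"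
  using dring.diff[OF dring.const[of 0]] by simp

lemma dring_sum: "(\<And>i. i \<in> I \<Longrightarrow> f i \<in> dring B S) \<Longrightarrow> (\<lambda>z. \<Sum>i\<in>I. f i z) \<in> dring B S"
  by (induction I rule: infinite_finite_induct) (auto intro: dring.intros)

lemma dring_power: "f \<in> dring B S \<Longrightarrow> (\<lambda>z. f z ^ n) \<in> dring B S"
  by (induction n) (auto intro: dring.intros)

lemma diff_fieldD:
  assumes "diff_field V D"
  shows "\<And>f g. f \<in> D \<Longrightarrow> merom V g \<Longrightarrow> generically V (\<lambda>z. g z = f z) \<Longrightarrow> g \<in> D"
    and "\<And>c. (\<lambda>z. c) \<in> D"
    and "\<And>f g. f \<in> D \<Longrightarrow> g \<in> D \<Longrightarrow> (\<lambda>z. f z + g z) \<in> D"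
    and "\<And>f g. f \<in> D \<Longrightarrow> g \<in> D \<Longrightarrow> (\<lambda>z. f z - g z) \<in> D"
    and "\<And>f g. f \<in> D \<Longrightarrow> g \<in> D \<Longrightarrow> (\<lambda>z. f z * g z) \<in> D"
    and "\<And>f. f \<in> D \<Longrightarrow> (\<lambda>z. inverse (f z)) \<in> D"
    and "\<And>f. f \<in> D \<Longrightarrow> pdx f \<in> D" and "\<And>f. f \<in> D \<Longrightarrow> pdy f \<in> D"
  using assms unfolding diff_field_def by blast+

lemma dring_diff_field:
  assumes "diff_field V D" "f \<in> dring V S" "open V" "S \<subseteq> D" "\<And>s. s \<in> S \<Longrightarrow> holo V s"
  shows "f \<in> D"
  using assms(2)
proof (induction rule: dring.induct)
  case (cong f g)
  have "holo V g" by (rule dring_holo[OF dring.cong[OF cong(1,2)] assms(3,5)])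
  then have "merom V g" by (rule holo_merom)
  moreover have "generically V (\<lambda>z. g z = f z)" by (rule generically_all[OF assms(3) cong(2)])
  ultimately show ?case by (rule diff_fieldD(1)[OF assms(1) cong.IH])
next
  case (gen s) then show ?case using assms(4) by blast
next
  case (const c) show ?case by (rule diff_fieldD(2)[OF assms(1)])
next
  case (add f g) then show ?case by (blast intro: diff_fieldD(3)[OF assms(1)])
next
  case (diff f g) then show ?case by (blast intro: diff_fieldD(4)[OF assms(1)])
next
  case (mult f g) then show ?case by (blast intro: diff_fieldD(5)[OF assms(1)])
next
  case (inverse f) then show ?case by (blast intro: diff_fieldD(6)[OF assms(1)])
next
  case (pdx f) then show ?case by (blast intro: diff_fieldD(7)[OF assms(1)])
next
  case (pdy f) then show ?case by (blast intro: diff_fieldD(8)[OF assms(1)])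
qed

lemma dring_diff_field_gen:
  assumes "f \<in> dring V S" "open V" "S \<subseteq> diff_field_gen V T" "\<And>s. s \<in> S \<Longrightarrow> holo V s"
  shows "f \<in> diff_field_gen V T"
  using assms unfolding diff_field_gen_def by (auto intro: dring_diff_field)

section \<open>Vector fields\<close>

definition vderiv :: "(C2 \<Rightarrow> complex) \<Rightarrow> (C2 \<Rightarrow> complex) \<Rightarrow> (C2 \<Rightarrow> complex) \<Rightarrow> C2 \<Rightarrow> complex" where
  "vderiv \<alpha> \<beta> f z = \<alpha> z * pdx f z + \<beta> z * pdy f z"

lemma vderiv_pdx: "vderiv (\<lambda>z. 1) (\<lambda>z. 0) f = pdx f" and vderiv_pdy: "vderiv (\<lambda>z. 0) (\<lambda>z. 1) f = pdy f"
  by (auto simp: vderiv_def fun_eq_iff)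

lemma vderiv_const [simp]: "vderiv \<alpha> \<beta> (\<lambda>z. c) z = 0"
  by (simp add: vderiv_def)

lemma vderiv_add: "holo U f \<Longrightarrow> holo U g \<Longrightarrow> z \<in> U \<Longrightarrow> vderiv \<alpha> \<beta> (\<lambda>z. f z + g z) z = vderiv \<alpha> \<beta> f z + vderiv \<alpha> \<beta> g z"
  by (simp add: vderiv_def pd_add[of U] algebra_simps)

lemma vderiv_diff: "holo U f \<Longrightarrow> holo U g \<Longrightarrow> z \<in> U \<Longrightarrow> vderiv \<alpha> \<beta> (\<lambda>z. f z - g z) z = vderiv \<alpha> \<beta> f z - vderiv \<alpha> \<beta> g z"
  by (simp add: vderiv_def pd_diff[of U] algebra_simps)

lemma vderiv_mult: "holo U f \<Longrightarrow> holo U g \<Longrightarrow> z \<in> U \<Longrightarrow>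
    vderiv \<alpha> \<beta> (\<lambda>z. f z * g z) z = vderiv \<alpha> \<beta> f z * g z + f z * vderiv \<alpha> \<beta> g z"
  by (simp add: vderiv_def pd_mult[of U] algebra_simps)

lemma vderiv_cmult: "holo U g \<Longrightarrow> z \<in> U \<Longrightarrow> vderiv \<alpha> \<beta> (\<lambda>z. c * g z) z = c * vderiv \<alpha> \<beta> g z"
  using vderiv_mult[of U "\<lambda>z. c" g z \<alpha> \<beta>] by (simp add: holo_const holo_open)

lemma vderiv_sum: "(\<And>i. i \<in> I \<Longrightarrow> holo U (f i)) \<Longrightarrow> z \<in> U \<Longrightarrow>
    vderiv \<alpha> \<beta> (\<lambda>z. \<Sum>i\<in>I. f i z) z = (\<Sum>i\<in>I. vderiv \<alpha> \<beta> (f i) z)"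
  by (simp add: vderiv_def pd_sum[of I U] sum_distrib_left sum.distrib)

lemma vderiv_cong: "open W \<Longrightarrow> z \<in> W \<Longrightarrow> (\<And>w. w \<in> W \<Longrightarrow> f w = g w) \<Longrightarrow> vderiv \<alpha> \<beta> f z = vderiv \<alpha> \<beta> g z"
  using pd_cong[of W z f g] by (simp add: vderiv_def)

lemma vderiv_zero: "open W \<Longrightarrow> z \<in> W \<Longrightarrow> (\<And>w. w \<in> W \<Longrightarrow> f w = 0) \<Longrightarrow> vderiv \<alpha> \<beta> f z = 0"
  using vderiv_cong[of W z f "\<lambda>z. 0" \<alpha> \<beta>] by simp

lemma vderiv_holo: "holo U \<alpha> \<Longrightarrow> holo U \<beta> \<Longrightarrow> holo U f \<Longrightarrow> holo U (vderiv \<alpha> \<beta> f)"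
  unfolding vderiv_def[abs_def] by (intro holo_add holo_mult holo_pdx holo_pdy)

lemma vderiv_dring: "\<alpha> \<in> dring B S \<Longrightarrow> \<beta> \<in> dring B S \<Longrightarrow> f \<in> dring B S \<Longrightarrow> vderiv \<alpha> \<beta> f \<in> dring B S"
  unfolding vderiv_def[abs_def] by (intro dring.add dring.mult dring.pdx dring.pdy)

section \<open>The frame dual to two forms\<close>

text \<open>Where \<open>dF\<close> and \<open>w = w1 dx + w2 dy\<close> are linearly independent, that is where the coefficient \<open>Delta\<close> of \<open>dF \<and> w\<close> has
no zeros, they have a dual frame \<open>X\<close>, \<open>Y\<close>, so \<open>df = (X f) dF + (Y f) w\<close> (\<open>pd_XY\<close>). The function \<open>cc\<close> is
defined by \<open>dw = cc dF \<and> w\<close>.\<close>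

locale pencil =
  fixes U :: "C2 set" and F w1 w2 :: "C2 \<Rightarrow> complex"
  assumes hF: "holo U F" and hw1: "holo U w1" and hw2: "holo U w2"
    and nondeg: "\<And>z. z \<in> U \<Longrightarrow> pdx F z * w2 z - pdy F z * w1 z \<noteq> 0"
begin

definition "Delta z = pdx F z * w2 z - pdy F z * w1 z"
definition "aX z = w2 z / Delta z"
definition "bX z = - (w1 z / Delta z)"
definition "aY z = - (pdy F z / Delta z)"
definition "bY z = pdx F z / Delta z"
definition X where "X = vderiv aX bX"
definition Y where "Y = vderiv aY bY"
definition "cc z = (pdx w2 z - pdy w1 z) / Delta z"
definition "S0 = {pdx F, pdy F, w1, w2}"

lemma Delta0: "z \<in> U \<Longrightarrow> Delta z \<noteq> 0" using nondeg by (simp add: Delta_def)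

lemma S0_holo: "s \<in> S0 \<Longrightarrow> B \<subseteq> U \<Longrightarrow> open B \<Longrightarrow> holo B s"
  unfolding S0_def using hF hw1 hw2 by (auto intro: holo_subset holo_pdx holo_pdy)

lemma coeffs_dring:
  assumes "B \<subseteq> U" "S0 \<subseteq> S"
  shows "Delta \<in> dring B S" "aX \<in> dring B S" "bX \<in> dring B S" "aY \<in> dring B S" "bY \<in> dring B S" "cc \<in> dring B S"
proof -
  have g: "pdx F \<in> dring B S" "pdy F \<in> dring B S" "w1 \<in> dring B S" "w2 \<in> dring B S"
    using assms(2) unfolding S0_def by (auto intro: dring.gen)
  show D: "Delta \<in> dring B S" unfolding Delta_def[abs_def] by (intro dring.diff dring.mult g)
  have D0: "Delta z \<noteq> 0" if "z \<in> B" for z using that assms(1) Delta0 by blast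
  show "aX \<in> dring B S" "bX \<in> dring B S" "aY \<in> dring B S" "bY \<in> dring B S" "cc \<in> dring B S"
    unfolding aX_def[abs_def] bX_def[abs_def] aY_def[abs_def] bY_def[abs_def] cc_def[abs_def]
    by (intro dring_uminus dring_divide dring.diff dring.pdx dring.pdy g D D0; assumption)+
qed

lemma coeffs_holo:
  assumes "B \<subseteq> U" "open B"
  shows "holo B aX" "holo B bX" "holo B aY" "holo B bY" "holo B cc"
  using coeffs_dring[OF assms(1) order_refl] dring_holo[OF _ assms(2)] S0_holo[OF _ assms] by blast+

lemma XY_dring: "B \<subseteq> U \<Longrightarrow> S0 \<subseteq> S \<Longrightarrow> f \<in> dring B S \<Longrightarrow> X f \<in> dring B S"
   "B \<subseteq> U \<Longrightarrow> S0 \<subseteq> S \<Longrightarrow> f \<in> dring B S \<Longrightarrow> Y f \<in> dring B S"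
  unfolding X_def Y_def by (intro vderiv_dring coeffs_dring; assumption)+

lemma XY_holo: "B \<subseteq> U \<Longrightarrow> holo B f \<Longrightarrow> holo B (X f)" "B \<subseteq> U \<Longrightarrow> holo B f \<Longrightarrow> holo B (Y f)"
  unfolding X_def Y_def by (intro vderiv_holo coeffs_holo; (assumption | erule holo_open))+

lemma pd_XY:
  assumes "z \<in> U"
  shows "pdx f z = pdx F z * X f z + w1 z * Y f z" "pdy f z = pdy F z * X f z + w2 z * Y f z"
proof -
  have D: "Delta z \<noteq> 0" using Delta0 assms by blast
  have "Delta z * pdx f z = Delta z * (pdx F z * X f z + w1 z * Y f z)"
    unfolding X_def Y_def vderiv_def aX_def bX_def aY_def bY_def using D
    by (simp add: field_simps) (simp add: Delta_def algebra_simps)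
  then show "pdx f z = pdx F z * X f z + w1 z * Y f z" using D by simp
  have "Delta z * pdy f z = Delta z * (pdy F z * X f z + w2 z * Y f z)"
    unfolding X_def Y_def vderiv_def aX_def bX_def aY_def bY_def using D
    by (simp add: field_simps) (simp add: Delta_def algebra_simps)
  then show "pdy f z = pdy F z * X f z + w2 z * Y f z" using D by simp
qed

text \<open>The identity \<open>d(df) = 0\<close> in the coframe \<open>dF\<close>, \<open>w\<close>; since \<open>dF\<close> is closed, the only first-order term comes
from \<open>dw\<close>.\<close>

lemma commutator:
  assumes B: "B \<subseteq> U" and f: "holo B f" and z: "z \<in> B"
  shows "Y (X f) z = X (Y f) z + cc z * Y f z"
proof -
  have oB: "open B" using holo_open f by blast
  have zU: "z \<in> U" using B z by blast
  have D: "Delta z \<noteq> 0" using Delta0 zU by blast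
  have hX: "holo B (X f)" and hY: "holo B (Y f)" using XY_holo B f by blast+
  have h: "holo B (pdx F)" "holo B (pdy F)" "holo B w1" "holo B w2"
    using S0_holo[OF _ B oB] unfolding S0_def by auto
  have hFB: "holo B F" using holo_subset[OF hF oB B] .
  have m: "holo B (\<lambda>z. pdx F z * X f z)" "holo B (\<lambda>z. w1 z * Y f z)"
      "holo B (\<lambda>z. pdy F z * X f z)" "holo B (\<lambda>z. w2 z * Y f z)"
    using h hX hY by (auto intro: holo_mult)
  have "pdy (pdx f) z = pdy (\<lambda>z. pdx F z * X f z + w1 z * Y f z) z"
    by (rule pd_cong(2)[OF oB z]) (use pd_XY(1) B in blast)
  also have "\<dots> = pdy (pdx F) z * X f z + pdx F z * pdy (X f) z + (pdy w1 z * Y f z + w1 z * pdy (Y f) z)"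
    by (simp only: pd_add[OF m(1,2) z] pd_mult[OF h(1) hX z] pd_mult[OF h(3) hY z])
  finally have 1: "pdy (pdx f) z = \<dots>" .
  have "pdx (pdy f) z = pdx (\<lambda>z. pdy F z * X f z + w2 z * Y f z) z"
    by (rule pd_cong(1)[OF oB z]) (use pd_XY(2) B in blast)
  also have "\<dots> = pdx (pdy F) z * X f z + pdy F z * pdx (X f) z + (pdx w2 z * Y f z + w2 z * pdx (Y f) z)"
    by (simp only: pd_add[OF m(3,4) z] pd_mult[OF h(2) hX z] pd_mult[OF h(4) hY z])
  finally have 2: "pdx (pdy f) z = \<dots>" .
  have 3: "pdy (pdx f) z = pdx (pdy f) z" "pdy (pdx F) z = pdx (pdy F) z"
    using pd_commute f hFB z by blast+
  have Y: "Delta z * Y g z = pdx F z * pdy g z - pdy F z * pdx g z" for g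
    unfolding Y_def vderiv_def aY_def bY_def using D by (simp add: field_simps)
  have X: "Delta z * X g z = w2 z * pdx g z - w1 z * pdy g z" for g
    unfolding X_def vderiv_def aX_def bX_def using D by (simp add: field_simps)
  have c: "Delta z * cc z = pdx w2 z - pdy w1 z" unfolding cc_def using D by simp
  have "Delta z * Y (X f) z = Delta z * X (Y f) z + (Delta z * cc z) * Y f z"
    unfolding Y[of "X f"] X[of "Y f"] c using 1 2 3 by (simp add: algebra_simps)
  then have "Delta z * Y (X f) z = Delta z * (X (Y f) z + cc z * Y f z)" by (simp add: algebra_simps)
  then show ?thesis using D by simp
qed

lemma XF: "z \<in> U \<Longrightarrow> X F z = 1" and YF: "z \<in> U \<Longrightarrow> Y F z = 0"
proof -
  assume "z \<in> U"
  then have D: "Delta z \<noteq> 0" by (rule Delta0)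
  have "X F z = (pdx F z * w2 z - pdy F z * w1 z) / Delta z"
    unfolding X_def vderiv_def aX_def bX_def by (simp add: diff_divide_distrib mult.commute)
  then show "X F z = 1" using D by (simp add: Delta_def)
  show "Y F z = 0" unfolding Y_def vderiv_def aY_def bY_def by simp
qed

end

section \<open>Chains of Darboux extensions by holomorphic functions\<close>

text \<open>Darboux towers presented by generators that are holomorphic on one set \<open>B\<close> and satisfy their equations everywhere
on \<open>B\<close>. Such a chain can be restricted to a smaller set (\<open>darboux_chain_mono\<close>), which is needed after each division.\<close>

inductive darboux_chain :: "C2 set \<Rightarrow> (C2 \<Rightarrow> complex) set \<Rightarrow> (C2 \<Rightarrow> complex) set \<Rightarrow> bool" for B S0 where
  base: "darboux_chain B S0 S0"
| primitive: "darboux_chain B S0 S \<Longrightarrow> holo B G \<Longrightarrow> a \<in> dring B S \<Longrightarrow> b \<in> dring B S \<Longrightarrow>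
     (\<And>z. z \<in> B \<Longrightarrow> pdx G z = a z) \<Longrightarrow> (\<And>z. z \<in> B \<Longrightarrow> pdy G z = b z) \<Longrightarrow> darboux_chain B S0 (insert G S)"
| algebraic: "darboux_chain B S0 S \<Longrightarrow> holo B G \<Longrightarrow> n \<ge> (1::nat) \<Longrightarrow> (\<And>i. i \<le> n \<Longrightarrow> c i \<in> dring B S) \<Longrightarrow>
     (\<And>z. z \<in> B \<Longrightarrow> c n z \<noteq> 0) \<Longrightarrow> (\<And>z. z \<in> B \<Longrightarrow> (\<Sum>i\<le>n. c i z * G z ^ i) = 0) \<Longrightarrow> darboux_chain B S0 (insert G S)"

lemma darboux_chain_sub: "darboux_chain B S0 S \<Longrightarrow> S0 \<subseteq> S"
  by (induction rule: darboux_chain.induct) auto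

lemma darboux_chain_holo: "darboux_chain B S0 S \<Longrightarrow> (\<And>s. s \<in> S0 \<Longrightarrow> holo B s) \<Longrightarrow> s \<in> S \<Longrightarrow> holo B s"
  by (induction rule: darboux_chain.induct) auto

lemma darboux_chain_mono: "darboux_chain B S0 S \<Longrightarrow> B' \<subseteq> B \<Longrightarrow> open B' \<Longrightarrow> darboux_chain B' S0 S"
proof (induction rule: darboux_chain.induct)
  case base show ?case by (rule darboux_chain.base)
next
  case (primitive S G a b)
  show ?case
    by (rule darboux_chain.primitive[where a = a and b = b])
       (use primitive in \<open>auto intro: holo_subset dring_mono\<close>)
next
  case (algebraic S G n c)
  show ?case
    by (rule darboux_chain.algebraic[where n = n and c = c])
       (use algebraic in \<open>auto intro: holo_subset dring_mono\<close>)
qed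

text \<open>Each link is a step of a Darboux tower, since the differential ring of the earlier generators lies in the
differential field that they generate.\<close>

lemma darboux_chain_tower:
  assumes "darboux_chain B S0 S" "open B" "B \<noteq> {}" "\<And>s. s \<in> S0 \<Longrightarrow> holo B s" "S0 \<subseteq> K" "\<And>c. (\<lambda>z. c) \<in> K"
  shows "\<exists>T. darboux_ext B K (diff_field_gen B T) \<and> S \<subseteq> diff_field_gen B T"
  using assms(1)
proof (induction rule: darboux_chain.induct)
  case base
  \<comment> \<open>Adjoining the algebraic function \<open>0\<close> gives the field the form \<open>diff_field_gen B T\<close>, which \<open>K\<close> need not have.\<close>
  have "algebraic_over B K (\<lambda>z. 0)"
    unfolding algebraic_over_def
  proof (intro exI conjI)
    show "(1::nat) \<ge> 1" by simp
    show "\<forall>i\<le>1. (\<lambda>i::nat. \<lambda>z::C2. if i = 0 then (0::complex) else 1) i \<in> K" using assms(6) by auto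
    show "\<not> generically B (\<lambda>z. (\<lambda>i::nat. \<lambda>z::C2. if i = 0 then (0::complex) else 1) 1 z = 0)"
      using generically_nonempty[OF _ assms(3)] by fastforce
    show "generically B (\<lambda>z. (\<Sum>i\<le>1. (\<lambda>i::nat. \<lambda>z::C2. if i = 0 then (0::complex) else 1) i z * 0 ^ i) = 0)"
      using assms(2) by (auto intro!: generically_all)
  qed
  then have "ext_tower (darboux_eq B) B K (diff_field_gen B (insert (\<lambda>z. 0) K))"
    by (intro ext_tower.step ext_tower.base holo_merom holo_const assms(2)) simp
  moreover have "S0 \<subseteq> diff_field_gen B (insert (\<lambda>z. 0) K)"
    unfolding diff_field_gen_def using assms(5) by auto
  ultimately show ?case unfolding darboux_ext_def by blast
next
  case (primitive S G a b)
  then obtain T where T: "darboux_ext B K (diff_field_gen B T)" "S \<subseteq> diff_field_gen B T" by blast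
  let ?L = "diff_field_gen B T"
  have hS: "\<And>s. s \<in> S \<Longrightarrow> holo B s" using darboux_chain_holo[OF primitive(1) assms(4)] by blast
  have ab: "a \<in> ?L" "b \<in> ?L"
    using dring_diff_field_gen[OF _ assms(2) T(2) hS] primitive by blast+
  have "darboux_eq B ?L G"
    unfolding darboux_eq_def form_over_def
    by (rule exI[of _ "\<lambda>z. (a z, b z)"]) (use ab primitive assms(2) in \<open>auto intro!: generically_all simp: d0_def\<close>)
  then have "ext_tower (darboux_eq B) B K (diff_field_gen B (insert G ?L))"
    using T(1) holo_merom[OF primitive(2)] unfolding darboux_ext_def by (blast intro: ext_tower.step)
  moreover have "insert G S \<subseteq> diff_field_gen B (insert G ?L)"
    using T(2) unfolding diff_field_gen_def[of B "insert G _"] by blast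
  ultimately show ?case unfolding darboux_ext_def by blast
next
  case (algebraic S G n c)
  then obtain T where T: "darboux_ext B K (diff_field_gen B T)" "S \<subseteq> diff_field_gen B T" by blast
  let ?L = "diff_field_gen B T"
  have hS: "\<And>s. s \<in> S \<Longrightarrow> holo B s" using darboux_chain_holo[OF algebraic(1) assms(4)] by blast
  have c: "c i \<in> ?L" if "i \<le> n" for i
    using dring_diff_field_gen[OF _ assms(2) T(2) hS] algebraic that by blast
  have "algebraic_over B ?L G"
    unfolding algebraic_over_def
    by (rule exI[of _ n], rule exI[of _ c])
       (use c algebraic generically_nonempty[OF _ assms(3)] assms(2) in \<open>blast intro: generically_all\<close>)
  then have "ext_tower (darboux_eq B) B K (diff_field_gen B (insert G ?L))"
    using T(1) holo_merom[OF algebraic(2)] unfolding darboux_ext_def by (blast intro: ext_tower.step)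
  moreover have "insert G S \<subseteq> diff_field_gen B (insert G ?L)"
    using T(2) unfolding diff_field_gen_def[of B "insert G _"] by blast
  ultimately show ?case unfolding darboux_ext_def by blast
qed

text \<open>A Darboux equation is a Liouville equation whose linear term is zero.\<close>

lemma darboux_liouville:
  assumes "darboux_ext V K L" "\<And>c. (\<lambda>z. c) \<in> K"
  shows "liouville_ext V K L"
proof -
  have "ext_tower (darboux_eq V) V K L" using assms(1) by (simp add: darboux_ext_def)
  then have "ext_tower (liouville_eq V) V K L \<and> (\<lambda>z. 0) \<in> L"
  proof (induction rule: ext_tower.induct)
    case base show ?case using assms(2) ext_tower.base by blast
  next
    case (step L G)
    have "liouville_eq V L G" if "darboux_eq V L G"
    proof -
      obtain \<eta> where e: "form_over L \<eta>" "generically V (\<lambda>z. d0 G z = \<eta> z)"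
        using \<open>darboux_eq V L G\<close> unfolding darboux_eq_def by blast
      have "form_over L (\<lambda>z. (0, 0))" using step.IH by (simp add: form_over_def)
      moreover have "generically V (\<lambda>z. d0 G z = cscale (G z) (0, 0) + \<eta> z)"
        using e(2) by (simp add: cscale_def flip: zero_prod_def)
      ultimately show ?thesis using e(1) unfolding liouville_eq_def
        by (intro exI[of _ \<eta>] exI[of _ "\<lambda>z. (0, 0)"]) simp
    qed
    then have "ext_tower (liouville_eq V) V K (diff_field_gen V (insert G L))"
      using step by (blast intro: ext_tower.step)
    moreover have "(\<lambda>z. 0) \<in> diff_field_gen V (insert G L)"
      unfolding diff_field_gen_def by (auto intro: diff_fieldD(2))
    ultimately show ?case by blast
  qed
  then show ?thesis by (simp add: liouville_ext_def)
qed

section \<open>Linear spans over differential rings\<close>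

definition lspan :: "C2 set \<Rightarrow> (C2 \<Rightarrow> complex) set \<Rightarrow> ('j \<Rightarrow> C2 \<Rightarrow> complex) \<Rightarrow> 'j set \<Rightarrow> (C2 \<Rightarrow> complex) set" where
  "lspan B S v J = {f. \<exists>a. (\<forall>j\<in>J. a j \<in> dring B S) \<and> (\<forall>z\<in>B. f z = (\<Sum>j\<in>J. a j z * v j z))}"

lemma lspanI: "(\<And>j. j \<in> J \<Longrightarrow> a j \<in> dring B S) \<Longrightarrow> (\<And>z. z \<in> B \<Longrightarrow> f z = (\<Sum>j\<in>J. a j z * v j z)) \<Longrightarrow> f \<in> lspan B S v J"
  unfolding lspan_def by blast

lemma lspanE: "f \<in> lspan B S v J \<Longrightarrow>
   (\<And>a. (\<And>j. j \<in> J \<Longrightarrow> a j \<in> dring B S) \<Longrightarrow> (\<And>z. z \<in> B \<Longrightarrow> f z = (\<Sum>j\<in>J. a j z * v j z)) \<Longrightarrow> thesis) \<Longrightarrow> thesis"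
  unfolding lspan_def by blast

lemma lspan_cong: "f \<in> lspan B S v J \<Longrightarrow> (\<And>z. z \<in> B \<Longrightarrow> g z = f z) \<Longrightarrow> g \<in> lspan B S v J"
  unfolding lspan_def by auto

lemma lspan_zero: "(\<And>z. z \<in> B \<Longrightarrow> f z = 0) \<Longrightarrow> f \<in> lspan B S v J"
  by (rule lspanI[of _ "\<lambda>j z. 0"]) (auto intro: dring.const)

lemma lspan_gen: "finite J \<Longrightarrow> j \<in> J \<Longrightarrow> v j \<in> lspan B S v J"
proof (rule lspanI[of _ "\<lambda>i z. if i = j then 1 else 0"])
  show "(\<lambda>z. if i = j then 1 else 0) \<in> dring B S" for i by (cases "i = j") (auto intro: dring.const)
next
  fix z assume J: "finite J" "j \<in> J"
  have "(\<Sum>i\<in>J. (if i = j then 1 else 0) * v i z) = (\<Sum>i\<in>J. if i = j then v i z else 0)"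
    by (intro sum.cong) auto
  then show "v j z = (\<Sum>i\<in>J. (if i = j then 1 else 0) * v i z)" using J by simp
qed

lemma lspan_add: "f \<in> lspan B S v J \<Longrightarrow> g \<in> lspan B S v J \<Longrightarrow> (\<lambda>z. f z + g z) \<in> lspan B S v J"
  by (elim lspanE, rule_tac a = "\<lambda>j z. a j z + aa j z" in lspanI)
     (auto intro: dring.add simp: distrib_right sum.distrib)

lemma lspan_mult: "f \<in> lspan B S v J \<Longrightarrow> g \<in> dring B S \<Longrightarrow> (\<lambda>z. g z * f z) \<in> lspan B S v J"
  by (elim lspanE, rule_tac a = "\<lambda>j z. g z * a j z" in lspanI)
     (auto intro: dring.mult simp: sum_distrib_left mult.assoc)

lemma lspan_diff: "f \<in> lspan B S v J \<Longrightarrow> g \<in> lspan B S v J \<Longrightarrow> (\<lambda>z. f z - g z) \<in> lspan B S v J"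
  using lspan_add[OF _ lspan_mult[OF _ dring.const[of "- 1"]]] by fastforce

lemma lspan_sum: "(\<And>i. i \<in> I \<Longrightarrow> f i \<in> lspan B S v J) \<Longrightarrow> (\<lambda>z. \<Sum>i\<in>I. f i z) \<in> lspan B S v J"
  by (induction I rule: infinite_finite_induct) (auto intro: lspan_add lspan_zero)

lemma lspan_trans:
  assumes "f \<in> lspan B S v J" "\<And>j. j \<in> J \<Longrightarrow> v j \<in> lspan B S w I"
  shows "f \<in> lspan B S w I"
proof -
  obtain a where a: "\<And>j. j \<in> J \<Longrightarrow> a j \<in> dring B S" "\<And>z. z \<in> B \<Longrightarrow> f z = (\<Sum>j\<in>J. a j z * v j z)"
    using lspanE[OF assms(1)] by blast
  show ?thesis
    by (rule lspan_cong[OF lspan_sum[of J "\<lambda>j z. a j z * v j z"]])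
       (use a assms(2) in \<open>auto intro: lspan_mult\<close>)
qed

lemma lspan_mono: "f \<in> lspan B S v J \<Longrightarrow> B' \<subseteq> B \<Longrightarrow> S \<subseteq> S' \<Longrightarrow> f \<in> lspan B' S' v J"
  by (elim lspanE, rule_tac a = a in lspanI) (auto intro: dring_mono)

text \<open>The product rule, applied to a combination of the \<open>v j\<close>.\<close>

lemma lspan_vderiv:
  assumes f: "f \<in> lspan B S v J" and ab: "\<alpha> \<in> dring B S" "\<beta> \<in> dring B S"
    and D: "\<And>j. j \<in> J \<Longrightarrow> vderiv \<alpha> \<beta> (v j) \<in> lspan B S w I"
    and v: "\<And>j. j \<in> J \<Longrightarrow> v j \<in> lspan B S w I"
    and h: "\<And>j. j \<in> J \<Longrightarrow> holo B (v j)" and B: "open B" and S: "\<And>s. s \<in> S \<Longrightarrow> holo B s"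
  shows "vderiv \<alpha> \<beta> f \<in> lspan B S w I"
proof -
  obtain a where a: "\<And>j. j \<in> J \<Longrightarrow> a j \<in> dring B S" "\<And>z. z \<in> B \<Longrightarrow> f z = (\<Sum>j\<in>J. a j z * v j z)"
    using lspanE[OF f] by blast
  have ha: "holo B (a j)" if "j \<in> J" for j using dring_holo[OF a(1)[OF that] B S] .
  have eq: "vderiv \<alpha> \<beta> f z = (\<Sum>j\<in>J. vderiv \<alpha> \<beta> (a j) z * v j z + a j z * vderiv \<alpha> \<beta> (v j) z)" if z: "z \<in> B" for z
  proof -
    have "vderiv \<alpha> \<beta> f z = vderiv \<alpha> \<beta> (\<lambda>z. \<Sum>j\<in>J. a j z * v j z) z"
      by (rule vderiv_cong[OF B z a(2)])
    also have "\<dots> = (\<Sum>j\<in>J. vderiv \<alpha> \<beta> (\<lambda>z. a j z * v j z) z)"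
      by (rule vderiv_sum[OF _ z]) (use ha h in \<open>auto intro: holo_mult\<close>)
    also have "\<dots> = (\<Sum>j\<in>J. vderiv \<alpha> \<beta> (a j) z * v j z + a j z * vderiv \<alpha> \<beta> (v j) z)"
      by (rule sum.cong[OF refl]) (use ha h z in \<open>auto intro: vderiv_mult\<close>)
    finally show ?thesis .
  qed
  show ?thesis
  proof (rule lspan_cong[OF lspan_sum[of J "\<lambda>j z. vderiv \<alpha> \<beta> (a j) z * v j z + a j z * vderiv \<alpha> \<beta> (v j) z"]])
    show "(\<lambda>z. vderiv \<alpha> \<beta> (a j) z * v j z + a j z * vderiv \<alpha> \<beta> (v j) z) \<in> lspan B S w I" if "j \<in> J" for j
      using that by (intro lspan_add lspan_mult v D a(1) vderiv_dring ab)
  qed (use eq in auto)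
qed

section \<open>Polynomial first integrals of a pencil and their jets\<close>

context pencil begin

text \<open>With \<open>t\<close> for the polynomial variable the conditions read \<open>Y h = t X h\<close>, equivalently \<open>dh = (X h) (dF + t w)\<close>: the
polynomial \<open>h\<close> is a first integral of \<open>dF + t w\<close> for every value of \<open>t\<close>.\<close>

definition pencil_integral :: "C2 set \<Rightarrow> nat \<Rightarrow> (C2 \<Rightarrow> complex poly) \<Rightarrow> bool" where
  "pencil_integral B M h \<longleftrightarrow> open B \<and> B \<subseteq> U \<and> (\<forall>z. degree (h z) \<le> M) \<and> (\<forall>k. holo B (\<lambda>z. coeff (h z) k)) \<and>
     (\<forall>z\<in>B. Y (\<lambda>z. coeff (h z) 0) z = 0) \<and>
     (\<forall>k. \<forall>z\<in>B. Y (\<lambda>z. coeff (h z) (Suc k)) z = X (\<lambda>z. coeff (h z) k) z)"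

lemma pencil_integral_mono: "pencil_integral B M h \<Longrightarrow> open B' \<Longrightarrow> B' \<subseteq> B \<Longrightarrow> M \<le> M' \<Longrightarrow> pencil_integral B' M' h"
  unfolding pencil_integral_def by (blast intro: holo_subset order_trans)

lemma XY_const [simp]: "X (\<lambda>z. c) z = 0" "Y (\<lambda>z. c) z = 0"
  by (simp_all add: X_def Y_def)

lemma pencil_integral_monom: "open B \<Longrightarrow> B \<subseteq> U \<Longrightarrow> pencil_integral B a (\<lambda>z. monom 1 a)"
  unfolding pencil_integral_def by (auto simp: degree_monom_le holo_const)

lemma pencil_integral_add: "pencil_integral B M g \<Longrightarrow> pencil_integral B M h \<Longrightarrow> pencil_integral B M (\<lambda>z. g z + h z)"
  unfolding pencil_integral_def X_def Y_def by (auto simp: degree_add_le holo_add vderiv_add[of B])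

lemma pencil_integral_smult: "pencil_integral B M h \<Longrightarrow> pencil_integral B M (\<lambda>z. smult c (h z))"
  unfolding pencil_integral_def X_def Y_def
  by (auto simp: holo_mult holo_const vderiv_cmult[of B] intro: order_trans[OF degree_smult_le])

lemma pencil_integral_zero: "open B \<Longrightarrow> B \<subseteq> U \<Longrightarrow> pencil_integral B M (\<lambda>z. 0)"
  unfolding pencil_integral_def by (auto simp: holo_const)

lemma pencil_integral_sum: "open B \<Longrightarrow> B \<subseteq> U \<Longrightarrow> (\<And>i. i \<in> I \<Longrightarrow> pencil_integral B M (h i)) \<Longrightarrow> pencil_integral B M (\<lambda>z. \<Sum>i\<in>I. h i z)"
  by (induction I rule: infinite_finite_induct) (auto intro: pencil_integral_zero pencil_integral_add)

lemma pencil_integral_mult: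
  assumes g: "pencil_integral B M g" and h: "pencil_integral B N h"
  shows "pencil_integral B (M + N) (\<lambda>z. g z * h z)"
proof -
  have B: "open B" "B \<subseteq> U" using g unfolding pencil_integral_def by auto
  let ?g = "\<lambda>k z. coeff (g z) k" and ?h = "\<lambda>k z. coeff (h z) k"
  have hg: "holo B (?g k)" and hh: "holo B (?h k)" for k using g h unfolding pencil_integral_def by auto
  have g0: "Y (?g 0) z = 0" and h0: "Y (?h 0) z = 0" and gS: "Y (?g (Suc k)) z = X (?g k) z"
    and hS: "Y (?h (Suc k)) z = X (?h k) z" if "z \<in> B" for z k using g h that unfolding pencil_integral_def by auto
  have c: "(\<lambda>z. coeff (g z * h z) k) = (\<lambda>z. \<Sum>i\<le>k. ?g i z * ?h (k - i) z)" for k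
    by (simp add: coeff_mult)
  have hm: "holo B (\<lambda>z. ?g i z * ?h j z)" for i j by (rule holo_mult[OF hg hh])
  have Xc: "X (\<lambda>z. coeff (g z * h z) k) z = (\<Sum>i\<le>k. X (?g i) z * ?h (k - i) z + ?g i z * X (?h (k - i)) z)"
   and Yc: "Y (\<lambda>z. coeff (g z * h z) k) z = (\<Sum>i\<le>k. Y (?g i) z * ?h (k - i) z + ?g i z * Y (?h (k - i)) z)"
    if z: "z \<in> B" for z k
    unfolding c X_def Y_def by (subst vderiv_sum[OF hm z], simp add: vderiv_mult[OF hg hh z])+
  show ?thesis
    unfolding pencil_integral_def
  proof (intro conjI allI ballI B)
    show "degree (g z * h z) \<le> M + N" for z
      using g h unfolding pencil_integral_def by (meson add_mono degree_mult_le order_trans)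
    show "holo B (\<lambda>z. coeff (g z * h z) k)" for k
      unfolding c by (rule holo_sum[OF B(1) hm])
    show "Y (\<lambda>z. coeff (g z * h z) 0) z = 0" if "z \<in> B" for z
      using that by (simp add: Yc g0 h0)
    show "Y (\<lambda>z. coeff (g z * h z) (Suc k)) z = X (\<lambda>z. coeff (g z * h z) k) z" if z: "z \<in> B" for z k
    proof -
      have 1: "(\<Sum>i\<le>Suc k. Y (?g i) z * ?h (Suc k - i) z) = (\<Sum>i\<le>k. X (?g i) z * ?h (k - i) z)"
        by (subst sum.atMost_Suc_shift) (simp add: g0[OF z] gS[OF z])
      have 2: "(\<Sum>i\<le>Suc k. ?g i z * Y (?h (Suc k - i)) z) = (\<Sum>i\<le>k. ?g i z * X (?h (k - i)) z)"
        by (simp add: h0[OF z] Suc_diff_le hS[OF z])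
      show ?thesis unfolding Xc[OF z] Yc[OF z] sum.distrib 1 2 ..
    qed
  qed
qed

lemma pencil_integral_power: "pencil_integral B M h \<Longrightarrow> pencil_integral B (M * n) (\<lambda>z. h z ^ n)"
proof (induction n)
  case 0
  have "open B" "B \<subseteq> U" using 0 unfolding pencil_integral_def by auto
  from pencil_integral_monom[OF this, of 0] show ?case by (simp add: monom_0 one_pCons)
next
  case (Suc n)
  from pencil_integral_mult[OF Suc.prems Suc.IH[OF Suc.prems]] show ?case by simp
qed

text \<open>Division by \<open>t\<^sup>i\<close> preserves \<open>Y h = t X h\<close>. The new constant coefficient satisfies its equation because \<open>Y\<close> maps it
to \<open>X\<close> of the vanishing coefficient before it.\<close>

lemma pencil_integral_shift:
  assumes h: "pencil_integral B M h" and z: "\<And>k z. k < i \<Longrightarrow> z \<in> B \<Longrightarrow> coeff (h z) k = 0"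
  shows "pencil_integral B M (\<lambda>z. poly_shift i (h z))"
  unfolding pencil_integral_def
proof (intro conjI allI ballI)
  show B: "open B" "B \<subseteq> U" using h unfolding pencil_integral_def by auto
  show "degree (poly_shift i (h z)) \<le> M" for z
  proof -
    have "degree (h z) \<le> M" using h unfolding pencil_integral_def by blast
    then show ?thesis by (intro degree_le) (auto simp: coeff_poly_shift intro!: coeff_eq_0)
  qed
  show "holo B (\<lambda>z. coeff (poly_shift i (h z)) k)" for k
    using h unfolding pencil_integral_def by (simp add: coeff_poly_shift)
  show "Y (\<lambda>z. coeff (poly_shift i (h z)) (Suc k)) z = X (\<lambda>z. coeff (poly_shift i (h z)) k) z" if "z \<in> B" for z k
    using h that unfolding pencil_integral_def by (simp add: coeff_poly_shift)
  show "Y (\<lambda>z. coeff (poly_shift i (h z)) 0) z = 0" if zB: "z \<in> B" for z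
  proof (cases i)
    case 0 then show ?thesis using h zB unfolding pencil_integral_def by (simp add: coeff_poly_shift)
  next
    case (Suc j)
    have "Y (\<lambda>z. coeff (h z) i) z = X (\<lambda>z. coeff (h z) j) z" using h zB Suc unfolding pencil_integral_def by auto
    also have "\<dots> = 0" unfolding X_def by (rule vderiv_zero[OF B(1) zB]) (use z Suc in auto)
    finally show ?thesis by (simp add: coeff_poly_shift)
  qed
qed

text \<open>Only derivatives along \<open>X\<close> are recorded, since \<open>Y\<close> turns a coefficient of \<open>h\<close> into \<open>X\<close> of the preceding one.\<close>

definition jet :: "(C2 \<Rightarrow> complex poly) \<Rightarrow> nat \<times> nat \<Rightarrow> C2 \<Rightarrow> complex" where
  "jet h q = (X ^^ fst q) (\<lambda>z. coeff (h z) (snd q))"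

definition "jet_indices M = {(j, k). j + k \<le> (M::nat)}"

lemma finite_jet_indices: "finite (jet_indices M)"
  by (rule finite_subset[of _ "{..M} \<times> {..M}"]) (auto simp: jet_indices_def)

lemma card_jet_indices: "card (jet_indices M) \<le> (M + 1)^2"
proof -
  have "card (jet_indices M) \<le> card ({..M} \<times> {..M})" by (rule card_mono) (auto simp: jet_indices_def)
  then show ?thesis by (simp add: power2_eq_square)
qed

lemma Xpow_holo: "B \<subseteq> U \<Longrightarrow> holo B f \<Longrightarrow> holo B ((X ^^ j) f)"
  by (induction j) (auto intro: XY_holo)

lemma XY_cong:
  assumes "open W" "z \<in> W" "\<And>w. w \<in> W \<Longrightarrow> f w = g w"
  shows "X f z = X g z" "Y f z = Y g z"
  unfolding X_def Y_def by (rule vderiv_cong[OF assms]; assumption)+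

lemmas X_cong = XY_cong(1)
lemmas Y_cong = XY_cong(2)

lemma Xpow_cong:
  assumes "open W" "\<And>w. w \<in> W \<Longrightarrow> f w = g w"
  shows "z \<in> W \<Longrightarrow> (X ^^ j) f z = (X ^^ j) g z"
proof (induction j arbitrary: z)
  case (Suc j)
  show ?case unfolding funpow.simps o_def by (rule X_cong[OF assms(1) Suc.prems Suc.IH])
qed (simp add: assms(2))

text \<open>Moving \<open>Y\<close> past the powers of \<open>X\<close> costs, by \<open>commutator\<close>, lower powers of \<open>X\<close> applied to \<open>Y f\<close>, with
coefficients in the ring of the data.\<close>

lemma Y_Xpow:
  assumes B: "open B" "B \<subseteq> U" and f: "holo B f"
  shows "(\<lambda>z. Y ((X ^^ j) f) z - (X ^^ j) (Y f) z) \<in> lspan B S0 (\<lambda>a. (X ^^ a) (Y f)) {..<j}"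
proof (induction j)
  case 0 show ?case by (rule lspan_zero) simp
next
  case (Suc j)
  define v where "v = (\<lambda>a. (X ^^ a) (Y f))"
  define s where "s = (\<lambda>z. Y ((X ^^ j) f) z - (X ^^ j) (Y f) z)"
  let ?L = "lspan B S0 v {..<Suc j}"
  have hv: "holo B (v a)" for a unfolding v_def by (intro Xpow_holo XY_holo B f)
  have vX: "X (v a) = v (Suc a)" for a unfolding v_def by simp
  have hf: "holo B ((X ^^ j) f)" by (intro Xpow_holo B f)
  have hs: "holo B s" unfolding s_def using hv[of j] XY_holo(2)[OF B(2) hf] unfolding v_def by (intro holo_diff)
  have sL: "s \<in> lspan B S0 v {..<j}" using Suc.IH unfolding s_def v_def .
  have gen: "v a \<in> ?L" if "a < Suc j" for a using that by (intro lspan_gen) auto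
  have sL': "s \<in> ?L" by (rule lspan_trans[OF sL]) (auto intro: gen)
  have "X s \<in> ?L" unfolding X_def
    by (rule lspan_vderiv[OF sL coeffs_dring(2,3)[OF B(2) order_refl]])
       (use vX in \<open>auto intro: gen hv B S0_holo[OF _ B(2,1)] simp flip: X_def\<close>)
  moreover have "(\<lambda>z. cc z * (v j z + s z)) \<in> ?L"
    by (intro lspan_mult lspan_add gen sL' coeffs_dring B) auto
  ultimately have L: "(\<lambda>z. X s z + cc z * (v j z + s z)) \<in> ?L" by (rule lspan_add)
  have "Y ((X ^^ Suc j) f) z - (X ^^ Suc j) (Y f) z = X s z + cc z * (v j z + s z)" if z: "z \<in> B" for z
  proof -
    have "Y ((X ^^ Suc j) f) z = X (Y ((X ^^ j) f)) z + cc z * Y ((X ^^ j) f) z"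
      using commutator[OF B(2) hf z] by simp
    also have "X (Y ((X ^^ j) f)) z = X (\<lambda>z. v j z + s z) z"
      by (rule X_cong[OF B(1) z]) (simp add: s_def v_def)
    also have "\<dots> = v (Suc j) z + X s z" unfolding X_def vderiv_add[OF hv hs z] by (simp add: vX flip: X_def)
    also have "Y ((X ^^ j) f) z = v j z + s z" by (simp add: s_def v_def)
    finally show ?thesis by (simp add: v_def)
  qed
  then show ?case using lspan_cong[OF L] unfolding v_def by auto
qed

lemma Y_Xpow':
  assumes B: "open B" "B \<subseteq> U" and f: "holo B f"
  shows "Y ((X ^^ j) f) \<in> lspan B S0 (\<lambda>a. (X ^^ a) (Y f)) {..j}"
proof -
  have "(X ^^ j) (Y f) \<in> lspan B S0 (\<lambda>a. (X ^^ a) (Y f)) {..j}"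
    by (rule lspan_gen[where v = "\<lambda>a. (X ^^ a) (Y f)"]) auto
  moreover have "(\<lambda>z. Y ((X ^^ j) f) z - (X ^^ j) (Y f) z) \<in> lspan B S0 (\<lambda>a. (X ^^ a) (Y f)) {..j}"
    by (rule lspan_trans[OF Y_Xpow[OF assms]]) (rule lspan_gen[where v = "\<lambda>a. (X ^^ a) (Y f)"], auto)
  ultimately show ?thesis by (rule lspan_cong[OF lspan_add]) simp
qed

lemma Xpow_zero: "(X ^^ a) (\<lambda>z. 0) = (\<lambda>z. 0)"
proof (induction a)
  case (Suc a)
  have "X (\<lambda>z. 0) = (\<lambda>z. 0)" by (rule ext) simp
  then show ?case using Suc by simp
qed simp

lemma pencil_integral_degree: "pencil_integral B M h \<Longrightarrow> degree (h z) \<le> M"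
  unfolding pencil_integral_def by blast

lemma jet_holo: "pencil_integral B M h \<Longrightarrow> holo B (jet h q)"
  unfolding jet_def pencil_integral_def by (auto intro: Xpow_holo)

lemma jet_closed_Y:
  assumes h: "pencil_integral B M h" and q: "q \<in> jet_indices M"
  shows "Y (jet h q) \<in> lspan B S0 (jet h) (jet_indices M)"
proof -
  obtain j k where jk: "q = (j, k)" by fastforce
  have B: "open B" "B \<subseteq> U" and hk: "holo B (\<lambda>z. coeff (h z) k)" using h unfolding pencil_integral_def by auto
  have *: "Y (jet h q) \<in> lspan B S0 (\<lambda>a. (X ^^ a) (Y (\<lambda>z. coeff (h z) k))) {..j}"
    unfolding jet_def jk using Y_Xpow'[OF B hk] by simp
  show ?thesis
  proof (cases k)
    case 0
    have "(X ^^ a) (Y (\<lambda>z. coeff (h z) k)) z = 0" if "z \<in> B" for z a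
    proof -
      have "(X ^^ a) (Y (\<lambda>z. coeff (h z) k)) z = (X ^^ a) (\<lambda>z. 0) z"
        by (rule Xpow_cong[OF B(1) _ that]) (use h 0 in \<open>auto simp: pencil_integral_def\<close>)
      also have "\<dots> = 0" by (simp add: Xpow_zero)
      finally show ?thesis .
    qed
    then show ?thesis by (intro lspan_trans[OF *] lspan_zero) auto
  next
    case (Suc k')
    have "(X ^^ a) (Y (\<lambda>z. coeff (h z) k)) \<in> lspan B S0 (jet h) (jet_indices M)" if "a \<le> j" for a
    proof (rule lspan_cong[OF lspan_gen[OF finite_jet_indices, of "(Suc a, k')"]])
      show "(Suc a, k') \<in> jet_indices M" using q that jk Suc by (auto simp: jet_indices_def)
      show "(X ^^ a) (Y (\<lambda>z. coeff (h z) k)) z = jet h (Suc a, k') z" if "z \<in> B" for z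
        unfolding jet_def fst_conv snd_conv funpow_Suc_right o_def
        by (rule Xpow_cong[OF B(1) _ that]) (use h Suc in \<open>auto simp: pencil_integral_def\<close>)
    qed
    then show ?thesis by (intro lspan_trans[OF *]) auto
  qed
qed

text \<open>Jets on the line just outside the triangle \<open>j + k \<le> M\<close> reduce to jets inside. At its end \<open>k = M\<close> this is
\<open>X h\<^sub>M = Y h\<^sub>M\<^sub>+\<^sub>1 = 0\<close>. Applying \<open>Y\<close> to the reduction of \<open>X\<^sup>d\<^sup>+\<^sup>1 h\<^sub>k\<^sub>+\<^sub>1\<close> gives that of \<open>X\<^sup>d\<^sup>+\<^sup>2 h\<^sub>k\<close>, because
\<open>Y h\<^sub>k\<^sub>+\<^sub>1 = X h\<^sub>k\<close>.\<close>

lemma jet_top: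
  assumes h: "pencil_integral B M h"
  shows "d \<le> M \<Longrightarrow> jet h (Suc d, M - d) \<in> lspan B S0 (jet h) (jet_indices M)"
proof (induction d)
  case 0
  have B: "open B" "B \<subseteq> U" using h unfolding pencil_integral_def by auto
  have "X (\<lambda>z. coeff (h z) M) z = 0" if z: "z \<in> B" for z
  proof -
    have "X (\<lambda>z. coeff (h z) M) z = Y (\<lambda>z. coeff (h z) (Suc M)) z" using h z unfolding pencil_integral_def by simp
    also have "\<dots> = 0" unfolding Y_def
      by (rule vderiv_zero[OF B(1) z]) (simp add: coeff_eq_0 pencil_integral_degree[OF h] less_Suc_eq_le)
    finally show ?thesis .
  qed
  then show ?case by (intro lspan_zero) (simp add: jet_def)
next
  case (Suc d)
  have B: "open B" "B \<subseteq> U" using h unfolding pencil_integral_def by auto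
  let ?L = "lspan B S0 (jet h) (jet_indices M)"
  define k where "k = M - Suc d"
  have k: "M - d = Suc k" using Suc.prems k_def by simp
  have hk: "holo B (\<lambda>z. coeff (h z) (Suc k))" using h unfolding pencil_integral_def by auto
  define v where "v = (\<lambda>a. (X ^^ a) (Y (\<lambda>z. coeff (h z) (Suc k))))"
  have IH: "jet h (Suc d, Suc k) \<in> ?L" using Suc k by simp
  have 1: "Y (jet h (Suc d, Suc k)) \<in> ?L" unfolding Y_def
    by (rule lspan_vderiv[OF IH coeffs_dring(4,5)[OF B(2) order_refl]])
       (use jet_closed_Y[OF h] lspan_gen[OF finite_jet_indices] jet_holo[OF h] B(1) S0_holo[OF _ B(2,1)]
        in \<open>simp_all flip: Y_def\<close>)
  have v: "v a z = jet h (Suc a, k) z" if "z \<in> B" for a z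
    unfolding v_def jet_def fst_conv snd_conv funpow_Suc_right o_def
    by (rule Xpow_cong[OF B(1) _ that]) (use h in \<open>auto simp: pencil_integral_def\<close>)
  have "(\<lambda>z. Y (jet h (Suc d, Suc k)) z - v (Suc d) z) \<in> lspan B S0 v {..<Suc d}"
    using Y_Xpow[OF B hk, of "Suc d"] unfolding v_def jet_def by simp
  then have 2: "(\<lambda>z. Y (jet h (Suc d, Suc k)) z - v (Suc d) z) \<in> ?L"
  proof (rule lspan_trans)
    fix a assume "a \<in> {..<Suc d}"
    then have "(Suc a, k) \<in> jet_indices M" using Suc.prems k_def by (auto simp: jet_indices_def)
    then show "v a \<in> ?L" using lspan_cong[OF lspan_gen[OF finite_jet_indices]] v by blast
  qed
  have "(\<lambda>z. Y (jet h (Suc d, Suc k)) z - (Y (jet h (Suc d, Suc k)) z - v (Suc d) z)) \<in> ?L"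
    by (rule lspan_diff[OF 1 2])
  then show ?case unfolding k_def[symmetric] by (rule lspan_cong) (use v in simp)
qed

lemma jet_closed_X:
  assumes h: "pencil_integral B M h" and q: "q \<in> jet_indices M"
  shows "X (jet h q) \<in> lspan B S0 (jet h) (jet_indices M)"
proof -
  obtain j k where jk: "q = (j, k)" by fastforce
  have X: "X (jet h q) = jet h (Suc j, k)" by (simp add: jet_def jk)
  show ?thesis
  proof (cases "Suc j + k \<le> M")
    case True then show ?thesis unfolding X by (intro lspan_gen finite_jet_indices) (auto simp: jet_indices_def)
  next
    case False
    then have "k = M - j" "j \<le> M" using q jk by (auto simp: jet_indices_def)
    then show ?thesis unfolding X using jet_top[OF h] by simp
  qed
qed

text \<open>So the jets form a solution of a linear Pfaffian system with coefficients in the ring of the data, and \<open>h\<close> is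
determined by the values of its jets at one point.\<close>

lemma jet_closed_pd:
  assumes h: "pencil_integral B M h" and q: "q \<in> jet_indices M"
  shows "pdx (jet h q) \<in> lspan B S0 (jet h) (jet_indices M)" "pdy (jet h q) \<in> lspan B S0 (jet h) (jet_indices M)"
proof -
  have B: "open B" "B \<subseteq> U" using h unfolding pencil_integral_def by auto
  have Y: "Y (jet h q) \<in> lspan B S0 (jet h) (jet_indices M)"
    by (rule jet_closed_Y[OF h q])
  note XY = jet_closed_X[OF h q] Y
  have g: "pdx F \<in> dring B S0" "pdy F \<in> dring B S0" "w1 \<in> dring B S0" "w2 \<in> dring B S0"
    by (auto simp: S0_def intro: dring.gen)
  show "pdx (jet h q) \<in> lspan B S0 (jet h) (jet_indices M)"
    by (rule lspan_cong[OF lspan_add[OF lspan_mult[OF XY(1) g(1)] lspan_mult[OF XY(2) g(3)]]])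
       (use pd_XY B in blast)
  show "pdy (jet h q) \<in> lspan B S0 (jet h) (jet_indices M)"
    by (rule lspan_cong[OF lspan_add[OF lspan_mult[OF XY(1) g(2)] lspan_mult[OF XY(2) g(4)]]])
       (use pd_XY B in blast)
qed

end

section \<open>Algebraic dependence of polynomial first integrals\<close>

text \<open>More unknowns than equations: eliminate one unknown by one equation and induct.\<close>

lemma solve_homogeneous:
  fixes e :: "'i \<Rightarrow> 'k \<Rightarrow> complex"
  assumes "finite K" "finite I" "card K < card I"
  shows "\<exists>l. (\<exists>i\<in>I. l i \<noteq> 0) \<and> (\<forall>k\<in>K. (\<Sum>i\<in>I. l i * e i k) = 0)"
  using assms
proof (induction K arbitrary: I e rule: finite_induct)
  case empty
  then have "I \<noteq> {}" by auto
  then show ?case by (intro exI[of _ "\<lambda>i. 1"]) auto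
next
  case (insert k K)
  show ?case
  proof (cases "\<exists>i0\<in>I. e i0 k \<noteq> 0")
    case False
    have "card K < card I" using insert.prems insert.hyps by simp
    from insert.IH[OF insert.prems(1) this] show ?thesis using False by auto
  next
    case True
    then obtain i0 where i0: "i0 \<in> I" "e i0 k \<noteq> 0" by blast
    let ?I = "I - {i0}" and ?e = "\<lambda>i k'. e i k' - e i k / e i0 k * e i0 k'"
    have "card K < card ?I" using insert.prems insert.hyps i0 by simp
    moreover have "finite ?I" using insert.prems by simp
    ultimately obtain l where l: "\<exists>i\<in>?I. l i \<noteq> 0" "\<forall>k'\<in>K. (\<Sum>i\<in>?I. l i * ?e i k') = 0"
      using insert.IH[of ?I ?e] by blast
    define m where "m = (\<lambda>i. if i = i0 then - (\<Sum>i\<in>?I. l i * e i k / e i0 k) else l i)"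
    have s: "(\<Sum>i\<in>I. m i * e i k') = (\<Sum>i\<in>?I. l i * ?e i k')" for k'
    proof -
      have "(\<Sum>i\<in>I. m i * e i k') = m i0 * e i0 k' + (\<Sum>i\<in>?I. m i * e i k')"
        using i0 insert.prems by (simp add: sum.remove)
      also have "(\<Sum>i\<in>?I. m i * e i k') = (\<Sum>i\<in>?I. l i * e i k')"
        by (intro sum.cong) (auto simp: m_def)
      also have "m i0 * e i0 k' = - (\<Sum>i\<in>?I. l i * (e i k / e i0 k * e i0 k'))"
        by (simp add: m_def sum_distrib_right mult.assoc)
      finally show ?thesis by (simp add: right_diff_distrib sum_subtractf)
    qed
    have "(\<Sum>i\<in>I. m i * e i k') = 0" if "k' \<in> insert k K" for k'
      unfolding s using that l(2) i0 by auto
    moreover have "\<exists>i\<in>I. m i \<noteq> 0" using l(1) by (auto simp: m_def)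
    ultimately show ?thesis by blast
  qed
qed

lemma continuous_bounded_near:
  fixes f :: "C2 \<Rightarrow> complex"
  assumes "continuous_on (ball p r) f" "0 < r"
  shows "\<exists>C. \<forall>z\<in>cball p (r/2). norm (f z) \<le> C"
proof -
  have "cball p (r/2) \<subseteq> ball p r" using assms(2) by auto
  then have "compact (f ` cball p (r/2))"
    by (intro compact_continuous_image continuous_on_subset[OF assms(1)] compact_cball)
  then have "bounded (f ` cball p (r/2))" by (rule compact_imp_bounded)
  then show ?thesis unfolding bounded_iff by auto
qed

lemma finite_common_bound:
  assumes "finite I" "\<And>i. i \<in> I \<Longrightarrow> \<exists>C::real. \<forall>z\<in>A. f i z \<le> C"
  shows "\<exists>C>0. \<forall>i\<in>I. \<forall>z\<in>A. f i z \<le> C"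
proof -
  obtain C where C: "\<And>i z. i \<in> I \<Longrightarrow> z \<in> A \<Longrightarrow> f i z \<le> C i" using assms(2) by metis
  have "f i z \<le> 1 + (\<Sum>i\<in>I. \<bar>C i\<bar>)" if "i \<in> I" "z \<in> A" for i z
  proof -
    have "\<bar>C i\<bar> \<le> (\<Sum>i\<in>I. \<bar>C i\<bar>)" using assms(1) that by (intro member_le_sum) auto
    then show ?thesis using C[OF that] by linarith
  qed
  moreover have "1 + (\<Sum>i\<in>I. \<bar>C i\<bar>) > 0" by (simp add: add_pos_nonneg sum_nonneg)
  ultimately show ?thesis by blast
qed

text \<open>On a small ball the maximum of the sum of the norms \<open>norm (v j z)\<close> is, by the mean value inequality, at most half
of itself.\<close>

lemma linear_system_unique:
  fixes v :: "'j \<Rightarrow> C2 \<Rightarrow> complex"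
  assumes J: "finite J" and r: "0 < r"
    and v: "\<And>j. j \<in> J \<Longrightarrow> holo (ball p r) (v j)"
    and a: "\<And>j k. j \<in> J \<Longrightarrow> k \<in> J \<Longrightarrow> holo (ball p r) (a j k)"
    and b: "\<And>j k. j \<in> J \<Longrightarrow> k \<in> J \<Longrightarrow> holo (ball p r) (b j k)"
    and vx: "\<And>j z. j \<in> J \<Longrightarrow> z \<in> ball p r \<Longrightarrow> pdx (v j) z = (\<Sum>k\<in>J. a j k z * v k z)"
    and vy: "\<And>j z. j \<in> J \<Longrightarrow> z \<in> ball p r \<Longrightarrow> pdy (v j) z = (\<Sum>k\<in>J. b j k z * v k z)"
    and v0: "\<And>j. j \<in> J \<Longrightarrow> v j p = 0"
  shows "\<exists>s>0. s \<le> r \<and> (\<forall>j\<in>J. \<forall>z\<in>ball p s. v j z = 0)"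
proof -
  obtain C where C: "C > 0" "\<forall>q\<in>J \<times> J. \<forall>z\<in>cball p (r/2). norm (a (fst q) (snd q) z) \<le> C"
    using finite_common_bound[of "J \<times> J" "cball p (r/2)" "\<lambda>q z. norm (a (fst q) (snd q) z)"]
      continuous_bounded_near[OF holo_continuous_on[OF a] r] J by auto
  obtain C' where C': "C' > 0" "\<forall>q\<in>J \<times> J. \<forall>z\<in>cball p (r/2). norm (b (fst q) (snd q) z) \<le> C'"
    using finite_common_bound[of "J \<times> J" "cball p (r/2)" "\<lambda>q z. norm (b (fst q) (snd q) z)"]
      continuous_bounded_near[OF holo_continuous_on[OF b] r] J by auto
  define n where "n = real (card J)"
  \<comment> \<open>The radius is small against the size of the system, so that the final estimate has the factor \<open>1 / 2\<close>.\<close>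
  define s where "s = min (r/2) (1 / (2 * (n + 1) * (C + C')))"
  have n0: "n \<ge> 0" by (simp add: n_def)
  have pos: "2 * (n + 1) * (C + C') > 0" using n0 C(1) C'(1) by simp
  have s: "s > 0" "s \<le> r/2" using r pos by (auto simp: s_def)
  have "s * (2 * (n + 1) * (C + C')) \<le> 1"
  proof -
    have "s \<le> 1 / (2 * (n + 1) * (C + C'))" by (simp add: s_def)
    then show ?thesis using pos by (simp add: pos_le_divide_eq)
  qed
  then have sn: "n * ((C + C') * s) \<le> 1 / 2"
  proof -
    have "n * ((C + C') * s) \<le> (n + 1) * ((C + C') * s)"
      using C(1) C'(1) s(1) by (intro mult_right_mono) auto
    then show ?thesis using \<open>s * (2 * (n + 1) * (C + C')) \<le> 1\<close> by (simp add: algebra_simps)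
  qed
  define m where "m z = (\<Sum>j\<in>J. norm (v j z))" for z
  have sub: "cball p s \<subseteq> ball p r" using s r by auto
  have "continuous_on (cball p s) m" unfolding m_def
    by (intro continuous_intros continuous_on_subset[OF holo_continuous_on[OF v] sub])
  then obtain q where q: "q \<in> cball p s" "\<And>z. z \<in> cball p s \<Longrightarrow> m z \<le> m q"
    using continuous_attains_sup[OF compact_cball, of p s m] s(1) by force
  have mq0: "m z \<ge> 0" for z by (simp add: m_def sum_nonneg)
  have bnd: "norm (v j z) \<le> (C + C') * m q * s" if j: "j \<in> J" and z: "z \<in> cball p s" for j z
  proof -
    have "norm (v j z - v j p) \<le> ((C + C') * m q) * norm (z - p)"
    proof (rule differentiable_bound[of "cball p s" "v j" "\<lambda>w k. pdx (v j) w * fst k + pdy (v j) w * snd k"])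
      show "(v j has_derivative (\<lambda>k. pdx (v j) w * fst k + pdy (v j) w * snd k)) (at w within cball p s)"
        if "w \<in> cball p s" for w
        using holo_hasd[OF v[OF j], of w] that sub unfolding hasd_def by (blast intro: has_derivative_at_withinI)
      show "onorm (\<lambda>k. pdx (v j) w * fst k + pdy (v j) w * snd k) \<le> (C + C') * m q" if w: "w \<in> cball p s" for w
      proof (rule onorm_bound)
        show "0 \<le> (C + C') * m q" using C(1) C'(1) mq0 by simp
        fix k :: C2
        have wr: "w \<in> ball p r" "w \<in> cball p (r/2)" using w sub s by auto
        have "norm (pdx (v j) w) \<le> (\<Sum>k\<in>J. norm (a j k w) * norm (v k w))"
          unfolding vx[OF j wr(1)] by (rule order_trans[OF norm_sum]) (simp add: norm_mult)
        also have "\<dots> \<le> (\<Sum>k\<in>J. C * norm (v k w))"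
          by (intro sum_mono mult_right_mono) (use C(2) j wr in auto)
        also have "\<dots> = C * m w" by (simp add: m_def sum_distrib_left)
        also have "\<dots> \<le> C * m q" using q(2)[OF w] C(1) by simp
        finally have 1: "norm (pdx (v j) w) \<le> C * m q" .
        have "norm (pdy (v j) w) \<le> (\<Sum>k\<in>J. norm (b j k w) * norm (v k w))"
          unfolding vy[OF j wr(1)] by (rule order_trans[OF norm_sum]) (simp add: norm_mult)
        also have "\<dots> \<le> (\<Sum>k\<in>J. C' * norm (v k w))"
          by (intro sum_mono mult_right_mono) (use C'(2) j wr in auto)
        also have "\<dots> = C' * m w" by (simp add: m_def sum_distrib_left)
        also have "\<dots> \<le> C' * m q" using q(2)[OF w] C'(1) by simp
        finally have 2: "norm (pdy (v j) w) \<le> C' * m q" .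
        have "norm (pdx (v j) w * fst k + pdy (v j) w * snd k) \<le> norm (pdx (v j) w) * norm (fst k) + norm (pdy (v j) w) * norm (snd k)"
          by (rule order_trans[OF norm_triangle_ineq]) (simp add: norm_mult)
        also have "\<dots> \<le> (C * m q) * norm k + (C' * m q) * norm k"
          using 1 2 mq0 C(1) C'(1) norm_fst_le[of "fst k" "snd k"] norm_snd_le[of "snd k" "fst k"]
          by (intro add_mono mult_mono) simp_all
        finally show "norm (pdx (v j) w * fst k + pdy (v j) w * snd k) \<le> (C + C') * m q * norm k"
          by (simp add: algebra_simps)
      qed
    qed (use z s in auto)
    also have "\<dots> \<le> ((C + C') * m q) * s"
      using z C(1) C'(1) mq0 by (intro mult_left_mono) (auto simp: dist_norm norm_minus_commute)
    finally show ?thesis using v0[OF j] by simp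
  qed
  have "m q \<le> (\<Sum>j\<in>J. (C + C') * m q * s)"
    unfolding m_def[of q] using bnd q(1) by (intro sum_mono) (auto simp: m_def)
  also have "\<dots> = n * ((C + C') * s) * m q" by (simp add: n_def)
  also have "\<dots> \<le> 1/2 * m q" using sn mq0 by (intro mult_right_mono) auto
  finally have "m q \<le> 0" using mq0[of q] by simp
  then have "m z = 0" if "z \<in> cball p s" for z using q(2)[OF that] mq0[of z] by simp
  then have "v j z = 0" if "z \<in> ball p s" "j \<in> J" for z j
  proof -
    have "m z = 0" using \<open>\<And>z. z \<in> cball p s \<Longrightarrow> m z = 0\<close> that by auto
    then show ?thesis using that J unfolding m_def by (simp add: sum_nonneg_eq_0_iff)
  qed
  then show ?thesis using s r by (intro exI[of _ s]) auto
qed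

context pencil begin

lemma pencil_integral_vanish:
  assumes h: "pencil_integral (ball p r) M h" and r: "r > 0" and z: "\<And>q. q \<in> jet_indices M \<Longrightarrow> jet h q p = 0"
  shows "\<exists>s>0. s \<le> r \<and> (\<forall>z\<in>ball p s. h z = 0)"
proof -
  have B: "ball p r \<subseteq> U" using h unfolding pencil_integral_def by auto
  let ?B = "ball p r"
  have "\<forall>q\<in>jet_indices M. \<exists>a. (\<forall>k\<in>jet_indices M. a k \<in> dring ?B S0) \<and> (\<forall>z\<in>?B. pdx (jet h q) z = (\<Sum>k\<in>jet_indices M. a k z * jet h k z))"
    using jet_closed_pd(1)[OF h] unfolding lspan_def by simp
  from bchoice[OF this] obtain a where
    a: "\<forall>q\<in>jet_indices M. (\<forall>k\<in>jet_indices M. a q k \<in> dring ?B S0) \<and> (\<forall>z\<in>?B. pdx (jet h q) z = (\<Sum>k\<in>jet_indices M. a q k z * jet h k z))" ..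
  have "\<forall>q\<in>jet_indices M. \<exists>b. (\<forall>k\<in>jet_indices M. b k \<in> dring ?B S0) \<and> (\<forall>z\<in>?B. pdy (jet h q) z = (\<Sum>k\<in>jet_indices M. b k z * jet h k z))"
    using jet_closed_pd(2)[OF h] unfolding lspan_def by simp
  from bchoice[OF this] obtain b where
    b: "\<forall>q\<in>jet_indices M. (\<forall>k\<in>jet_indices M. b q k \<in> dring ?B S0) \<and> (\<forall>z\<in>?B. pdy (jet h q) z = (\<Sum>k\<in>jet_indices M. b q k z * jet h k z))" ..
  have hd: "holo ?B f" if "f \<in> dring ?B S0" for f
    by (rule dring_holo[OF that open_ball]) (rule S0_holo[OF _ B open_ball])
  have "\<exists>s>0. s \<le> r \<and> (\<forall>q\<in>jet_indices M. \<forall>z\<in>ball p s. jet h q z = 0)"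
  proof (rule linear_system_unique[OF finite_jet_indices r, where a = a and b = b])
    show "holo ?B (jet h q)" for q by (rule jet_holo[OF h])
    show "holo ?B (a q k)" "holo ?B (b q k)" if "q \<in> jet_indices M" "k \<in> jet_indices M" for q k
      using a b that by (blast intro: hd)+
  qed (use a b z in simp_all)
  then obtain s where s: "s > 0" "s \<le> r" "\<forall>q\<in>jet_indices M. \<forall>z\<in>ball p s. jet h q z = 0" by blast
  have "h z = 0" if "z \<in> ball p s" for z
  proof (rule poly_eqI)
    fix k
    show "coeff (h z) k = coeff 0 k"
    proof (cases "k \<le> M")
      case True
      then have "(0, k) \<in> jet_indices M" by (simp add: jet_indices_def)
      then have "jet h (0, k) z = 0" using s(3) that by blast
      then show ?thesis by (simp add: jet_def)
    next
      case False then show ?thesis using pencil_integral_degree[OF h, of z] by (simp add: coeff_eq_0)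
    qed
  qed
  then show ?thesis using s by blast
qed

lemma jet_lincomb:
  assumes B: "open B" "B \<subseteq> U" and h: "\<And>i. i \<in> I \<Longrightarrow> pencil_integral B M (h i)" and z: "z \<in> B"
  shows "jet (\<lambda>z. \<Sum>i\<in>I. smult (c i) (h i z)) q z = (\<Sum>i\<in>I. c i * jet (h i) q z)"
proof -
  obtain j k where q: "q = (j, k)" by fastforce
  have "(X ^^ j) (\<lambda>z. coeff (\<Sum>i\<in>I. smult (c i) (h i z)) k) z = (\<Sum>i\<in>I. c i * (X ^^ j) (\<lambda>z. coeff (h i z) k) z)"
    using z
  proof (induction j arbitrary: z)
    case 0 show ?case by (simp add: coeff_sum)
  next
    case (Suc j)
    have hk: "holo B ((X ^^ j) (\<lambda>z. coeff (h i z) k))" if "i \<in> I" for i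
      using h[OF that] unfolding pencil_integral_def by (auto intro: Xpow_holo)
    have "(X ^^ Suc j) (\<lambda>z. coeff (\<Sum>i\<in>I. smult (c i) (h i z)) k) z
        = X (\<lambda>z. \<Sum>i\<in>I. c i * (X ^^ j) (\<lambda>z. coeff (h i z) k) z) z"
      unfolding funpow.simps o_def by (rule X_cong[OF B(1) Suc.prems Suc.IH])
    also have "\<dots> = (\<Sum>i\<in>I. X (\<lambda>z. c i * (X ^^ j) (\<lambda>z. coeff (h i z) k) z) z)"
      unfolding X_def by (rule vderiv_sum[OF _ Suc.prems]) (use hk B in \<open>auto simp flip: X_def intro: holo_mult holo_const\<close>)
    also have "\<dots> = (\<Sum>i\<in>I. c i * X ((X ^^ j) (\<lambda>z. coeff (h i z) k)) z)"
      unfolding X_def by (intro sum.cong refl vderiv_cmult[OF _ Suc.prems]) (use hk in \<open>simp flip: X_def\<close>)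
    finally show ?case by simp
  qed
  then show ?thesis by (simp add: jet_def q)
qed

text \<open>The products \<open>t\<^sup>a P\<^sup>b h\<^sup>c\<close> are first integrals, and for exponents of large size they outnumber the jets that
determine a first integral of their degree. A combination whose jets at \<open>p\<close> are zero vanishes identically, and the
lowest power of \<open>t\<close> occurring in it gives a relation between the constant coefficients.\<close>

lemma algebraic_dependence:
  assumes P: "pencil_integral (ball p r) N P" and h: "pencil_integral (ball p r) N h" and r: "r > 0"
  shows "\<exists>s>0. s \<le> r \<and> (\<exists>T \<mu>. (\<exists>b\<le>T. \<exists>c\<le>T. \<mu> b c \<noteq> 0) \<and>
     (\<forall>z\<in>ball p s. (\<Sum>c\<le>T. (\<Sum>b\<le>T. \<mu> b c * coeff (P z) 0 ^ b) * coeff (h z) 0 ^ c) = 0))"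
proof -
  let ?B = "ball p r"
  have B: "open ?B" "?B \<subseteq> U" using P unfolding pencil_integral_def by auto
  \<comment> \<open>The bound \<open>L\<close> on the degrees is positive. With \<open>T = 16 L\<close> the at most \<open>(4 L T)\<^sup>2\<close> jets are fewer than the more than
    \<open>L T\<^sup>3\<close> products.\<close>
  define L where "L = N + 1"
  have P: "pencil_integral ?B L P" and h: "pencil_integral ?B L h" using pencil_integral_mono[OF P B(1) order_refl] pencil_integral_mono[OF h B(1) order_refl] by (auto simp: L_def)
  define T where "T = 16 * L"
  define M where "M = 3 * L * T"
  define I where "I = {..L * T} \<times> {..T} \<times> {..T}"
  define H where "H = (\<lambda>(a, b, c) z. monom 1 a * (P z ^ b * h z ^ c))"
  have HI: "pencil_integral ?B M (H i)" if iI: "i \<in> I" for i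
  proof -
    obtain a b c where i: "i = (a, b, c)" using prod_cases3 by blast
    have le: "a \<le> L * T" "b \<le> T" "c \<le> T" using iI i by (auto simp: I_def)
    have "L * b \<le> L * T" "L * c \<le> L * T" using le by auto
    then have "a + (L * b + L * c) \<le> M" using le unfolding M_def by linarith
    from pencil_integral_mono[OF pencil_integral_mult[OF pencil_integral_monom[OF B] pencil_integral_mult[OF pencil_integral_power[OF P] pencil_integral_power[OF h]]] B(1) order_refl this]
    show ?thesis by (simp add: H_def i)
  qed
  have "card (jet_indices M) < card I"
  proof -
    have L: "L \<ge> 1" by (simp add: L_def)
    have "card (jet_indices M) \<le> (3 * L * T + 1)^2" using card_jet_indices[of M] by (simp add: M_def)
    also have "\<dots> \<le> (4 * L * T)^2" using L by (intro power_mono) (auto simp: T_def)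
    also have "\<dots> = (L * T) * (T * T)" by (simp add: T_def power2_eq_square)
    also have "\<dots> < (L * T + 1) * ((T + 1) * (T + 1))"
      by (intro mult_less_le_imp_less mult_mono) (use L in \<open>auto simp: T_def\<close>)
    also have "\<dots> = card I" by (simp add: I_def)
    finally show ?thesis .
  qed
  then obtain l where l: "\<exists>i\<in>I. l i \<noteq> 0" "\<forall>q\<in>jet_indices M. (\<Sum>i\<in>I. l i * jet (H i) q p) = 0"
    using solve_homogeneous[OF finite_jet_indices, of I M "\<lambda>i q. jet (H i) q p"] by (auto simp: I_def)
  define G where "G = (\<lambda>z. \<Sum>i\<in>I. smult (l i) (H i z))"
  have G: "pencil_integral ?B M G" unfolding G_def by (rule pencil_integral_sum[OF B]) (rule pencil_integral_smult[OF HI])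
  have "jet G q p = 0" if "q \<in> jet_indices M" for q
    unfolding G_def using jet_lincomb[OF B HI, where z = p and c = l and q = q and I = I] l(2) that r by simp
  then obtain s where s: "s > 0" "s \<le> r" "\<forall>z\<in>ball p s. G z = 0"
    using pencil_integral_vanish[OF G r] by blast
  \<comment> \<open>The coefficient of \<open>t\<^sup>a\<^sup>0\<close> in the combination sees only constant coefficients of \<open>P\<close> and \<open>h\<close>.\<close>
  define a0 where "a0 = (LEAST a. \<exists>b c. (a, b, c) \<in> I \<and> l (a, b, c) \<noteq> 0)"
  have ex: "\<exists>a b c. (a, b, c) \<in> I \<and> l (a, b, c) \<noteq> 0" using l(1) by (metis prod_cases3)
  have a0: "\<exists>b c. (a0, b, c) \<in> I \<and> l (a0, b, c) \<noteq> 0" unfolding a0_def by (rule LeastI_ex[OF ex])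
  have lt: "l (a, b, c) = 0" if "a < a0" "(a, b, c) \<in> I" for a b c
    using not_less_Least[of a "\<lambda>a. \<exists>b c. (a, b, c) \<in> I \<and> l (a, b, c) \<noteq> 0"] that unfolding a0_def by blast
  have a0T: "a0 \<le> L * T" using a0 by (auto simp: I_def)
  have cf: "coeff (H (a, b, c) z) a0 = (if a = a0 then coeff (P z) 0 ^ b * coeff (h z) 0 ^ c else 0)" if "a \<ge> a0" for a b c z
  proof (cases "a = a0")
    case True
    then show ?thesis by (simp add: H_def coeff_monom_mult poly_0_coeff_0[symmetric])
  next
    case False
    then show ?thesis using that by (simp add: H_def coeff_monom_mult)
  qed
  have key: "(\<Sum>c\<le>T. (\<Sum>b\<le>T. l (a0, b, c) * coeff (P z) 0 ^ b) * coeff (h z) 0 ^ c) = 0" if z: "z \<in> ball p s" for z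
  proof -
    have "0 = coeff (G z) a0" using s(3) z by simp
    also have "\<dots> = (\<Sum>i\<in>I. l i * coeff (H i z) a0)" by (simp add: G_def coeff_sum)
    also have "\<dots> = (\<Sum>(a, b, c)\<in>I. l (a, b, c) * coeff (H (a, b, c) z) a0)" by (simp add: case_prod_beta)
    also have "\<dots> = (\<Sum>(a, b, c)\<in>I. if a = a0 then l (a0, b, c) * (coeff (P z) 0 ^ b * coeff (h z) 0 ^ c) else 0)"
    proof (rule sum.cong[OF refl], clarify)
      fix a b c assume i: "(a, b, c) \<in> I"
      show "l (a, b, c) * coeff (H (a, b, c) z) a0 = (if a = a0 then l (a0, b, c) * (coeff (P z) 0 ^ b * coeff (h z) 0 ^ c) else 0)"
        using lt[OF _ i] cf[of a b c z] by (cases "a < a0") auto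
    qed
    also have "\<dots> = (\<Sum>a\<le>L * T. \<Sum>b\<le>T. \<Sum>c\<le>T. if a = a0 then l (a0, b, c) * (coeff (P z) 0 ^ b * coeff (h z) 0 ^ c) else 0)"
      unfolding I_def by (simp add: sum.cartesian_product' split_def cong: if_cong)
    also have "\<dots> = (\<Sum>a\<le>L * T. if a = a0 then \<Sum>b\<le>T. \<Sum>c\<le>T. l (a0, b, c) * (coeff (P z) 0 ^ b * coeff (h z) 0 ^ c) else 0)"
      by (intro sum.cong) auto
    also have "\<dots> = (\<Sum>b\<le>T. \<Sum>c\<le>T. l (a0, b, c) * (coeff (P z) 0 ^ b * coeff (h z) 0 ^ c))"
      using a0T by simp
    also have "\<dots> = (\<Sum>c\<le>T. \<Sum>b\<le>T. l (a0, b, c) * (coeff (P z) 0 ^ b * coeff (h z) 0 ^ c))" by (rule sum.swap)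
    also have "\<dots> = (\<Sum>c\<le>T. (\<Sum>b\<le>T. l (a0, b, c) * coeff (P z) 0 ^ b) * coeff (h z) 0 ^ c)"
      by (simp add: sum_distrib_right mult.assoc)
    finally show ?thesis by simp
  qed
  have "\<exists>b\<le>T. \<exists>c\<le>T. l (a0, b, c) \<noteq> 0" using a0 by (auto simp: I_def)
  then have "\<exists>T \<mu>. (\<exists>b\<le>T. \<exists>c\<le>T. \<mu> b c \<noteq> 0) \<and>
     (\<forall>z\<in>ball p s. (\<Sum>c\<le>T. (\<Sum>b\<le>T. \<mu> b c * coeff (P z) 0 ^ b) * coeff (h z) 0 ^ c) = 0)"
    using key by (intro exI[of _ T] exI[of _ "\<lambda>b c. l (a0, b, c)"]) simp
  then show ?thesis using s(1,2) by blast
qed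

text \<open>Otherwise \<open>F\<close> takes finitely many values on a ball, so it is constant there, against \<open>dF \<noteq> 0\<close>.\<close>

lemma F_not_root:
  assumes q: "q \<noteq> (0 :: complex poly)" and W: "open W" "W \<noteq> {}" "W \<subseteq> U"
  obtains z where "z \<in> W" "poly q (F z) \<noteq> 0"
proof -
  have "\<exists>z\<in>W. poly q (F z) \<noteq> 0"
  proof (rule ccontr)
    assume "\<not> ?thesis"
    then have roots: "F ` W \<subseteq> {x. poly q x = 0}" by auto
    obtain p r where p: "r > 0" "ball p r \<subseteq> W" using W open_contains_ball by blast
    have "F constant_on ball p r"
    proof (rule continuous_finite_range_constant)
      show "continuous_on (ball p r) F"
        by (rule continuous_on_subset[OF holo_continuous_on[OF hF]]) (use p W in auto)
      show "finite (F ` ball p r)"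
        by (rule finite_subset[OF _ poly_roots_finite[OF q]]) (use roots p in auto)
    qed (rule connected_ball)
    then obtain c where c: "\<And>z. z \<in> ball p r \<Longrightarrow> F z = c" unfolding constant_on_def by blast
    have pB: "p \<in> ball p r" using p by simp
    have "pdx F p = 0" "pdy F p = 0"
      using pd_cong[OF open_ball pB, of F "\<lambda>z. c"] c by auto
    moreover have "p \<in> U" using pB p W by blast
    ultimately show False using nondeg[of p] by simp
  qed
  then show ?thesis using that by blast
qed

text \<open>The relation of \<open>algebraic_dependence\<close> is a polynomial equation for the constant coefficient of \<open>h\<close> over the
polynomials in \<open>F\<close>. It is not constant by \<open>F_not_root\<close>, and a smaller ball avoids the zeros of its top coefficient.\<close>

lemma leading_algebraic:
  assumes P: "pencil_integral (ball p r) N P" and h: "pencil_integral (ball p r) N h" and r: "r > 0"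
    and PF: "\<And>z. z \<in> ball p r \<Longrightarrow> coeff (P z) 0 = F z"
  shows "\<exists>p' r' n c. r' > 0 \<and> ball p' r' \<subseteq> ball p r \<and> n \<ge> (1::nat) \<and> (\<forall>i\<le>n. c i \<in> dring (ball p' r') {F}) \<and>
     (\<forall>z\<in>ball p' r'. c n z \<noteq> 0) \<and> (\<forall>z\<in>ball p' r'. (\<Sum>i\<le>n. c i z * coeff (h z) 0 ^ i) = 0)"
proof -
  obtain s T \<mu> where s: "s > 0" "s \<le> r" and \<mu>: "\<exists>b\<le>T. \<exists>c\<le>T. \<mu> b c \<noteq> (0::complex)"
    and rel: "\<And>z. z \<in> ball p s \<Longrightarrow> (\<Sum>c\<le>T. (\<Sum>b\<le>T. \<mu> b c * coeff (P z) 0 ^ b) * coeff (h z) 0 ^ c) = 0"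
    using algebraic_dependence[OF P h r] by blast
  have sr: "ball p s \<subseteq> ball p r" using s by auto
  have sU: "ball p s \<subseteq> U" using P sr unfolding pencil_integral_def by auto
  define Q where "Q c = (\<Sum>b\<le>T. monom (\<mu> b c) b)" for c
  have Qc: "coeff (Q c) b = (if b \<le> T then \<mu> b c else 0)" for b c by (simp add: Q_def coeff_sum)
  have QF: "poly (Q c) t = (\<Sum>b\<le>T. \<mu> b c * t ^ b)" for c t by (simp add: Q_def poly_sum poly_monom)
  define C where "C = {c. c \<le> T \<and> Q c \<noteq> 0}"
  have "C \<noteq> {}" using \<mu> Qc unfolding C_def by (metis (mono_tags, lifting) coeff_0 empty_iff mem_Collect_eq)
  moreover have fC: "finite C" unfolding C_def by simp
  ultimately have nC: "Max C \<in> C" using Max_in by blast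
  define n where "n = Max C"
  have n: "n \<le> T" "Q n \<noteq> 0" using nC unfolding C_def n_def by auto
  have above: "Q c = 0" if "n < c" "c \<le> T" for c
    using that Max_ge[OF fC, of c] unfolding C_def n_def by fastforce
  have rel': "(\<Sum>c\<le>n. poly (Q c) (F z) * coeff (h z) 0 ^ c) = 0" if z: "z \<in> ball p s" for z
  proof -
    have "(\<Sum>c\<le>n. poly (Q c) (F z) * coeff (h z) 0 ^ c) = (\<Sum>c\<le>T. poly (Q c) (F z) * coeff (h z) 0 ^ c)"
      by (rule sum.mono_neutral_left) (use n above in auto)
    also have "\<dots> = 0" using rel[OF z] PF[OF subsetD[OF sr z]] by (simp add: QF)
    finally show ?thesis .
  qed
  have n1: "n \<ge> 1"
  proof (rule ccontr)
    assume "\<not> n \<ge> 1"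
    then have n0: "n = 0" by simp
    obtain z where "z \<in> ball p s" "poly (Q n) (F z) \<noteq> 0"
      using F_not_root[OF n(2), of "ball p s"] s sU by auto
    then show False using rel'[of z] n0 by simp
  qed
  obtain z0 where z0: "z0 \<in> ball p s" "poly (Q n) (F z0) \<noteq> 0"
    using F_not_root[OF n(2), of "ball p s"] s sU by auto
  have cont: "continuous_on (ball p s) (\<lambda>z. poly (Q n) (F z))"
    by (intro continuous_intros continuous_on_subset[OF holo_continuous_on[OF hF]] sU)
  have "open {z \<in> ball p s. poly (Q n) (F z) \<noteq> 0}"
  proof -
    have "open (ball p s \<inter> (\<lambda>z. poly (Q n) (F z)) -` (- {0}))"
      by (rule continuous_open_preimage[OF cont open_ball]) auto
    moreover have "ball p s \<inter> (\<lambda>z. poly (Q n) (F z)) -` (- {0}) = {z \<in> ball p s. poly (Q n) (F z) \<noteq> 0}" by blast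
    ultimately show ?thesis by simp
  qed
  then obtain r' where r': "r' > 0" "ball z0 r' \<subseteq> {z \<in> ball p s. poly (Q n) (F z) \<noteq> 0}"
    using z0 unfolding open_contains_ball by blast
  have dr: "(\<lambda>z. poly (Q c) (F z)) \<in> dring (ball z0 r') {F}" for c
    unfolding QF by (intro dring_sum dring.mult dring.const dring_power dring.gen) simp
  have sub: "ball z0 r' \<subseteq> ball p s" using r'(2) by blast
  show ?thesis
  proof (rule exI[of _ z0], rule exI[of _ r'], rule exI[of _ n], rule exI[of _ "\<lambda>c z. poly (Q c) (F z)"], intro conjI allI impI ballI)
    show "ball z0 r' \<subseteq> ball p r" using sub sr by (rule order_trans)
    show "poly (Q n) (F z) \<noteq> 0" if "z \<in> ball z0 r'" for z using r'(2) that by blast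
    show "(\<Sum>i\<le>n. poly (Q i) (F z) * coeff (h z) 0 ^ i) = 0" if "z \<in> ball z0 r'" for z
      by (rule rel'[OF subsetD[OF sub that]])
  qed (rule r'(1) n1 dr)+
qed

end

section \<open>Linear Pfaffian systems\<close>

definition y_primitive :: "complex \<Rightarrow> (C2 \<Rightarrow> complex) \<Rightarrow> C2 \<Rightarrow> complex" where
  "y_primitive y0 g z = contour_integral (linepath y0 (snd z)) (\<lambda>\<eta>. g (fst z, \<eta>))"

lemma ball_centre: "y \<in> ball y0 s \<Longrightarrow> y0 \<in> ball y0 s"
  using zero_le_dist[of y0 y] unfolding mem_ball dist_self by linarith

lemma uniform_limit_subst:
  "uniform_limit A f g G \<Longrightarrow> (\<And>x. x \<in> B \<Longrightarrow> h x \<in> A) \<Longrightarrow> uniform_limit B (\<lambda>n x. f n (h x)) (\<lambda>x. g (h x)) G"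
  unfolding uniform_limit_iff by (fast elim: eventually_mono)

lemma yslice_holomorphic:
  assumes "holo (A \<times> ball y0 s) g" "x \<in> A"
  shows "(\<lambda>y. g (x, y)) holomorphic_on ball y0 s"
  unfolding holomorphic_on_def
proof
  fix y assume "y \<in> ball y0 s"
  then have "(x, y) \<in> A \<times> ball y0 s" using assms(2) by simp
  from hasd_slice_y[OF holo_hasd[OF assms(1) this]]
  show "(\<lambda>y. g (x, y)) field_differentiable at y within ball y0 s"
    using field_differentiable_at_within field_differentiable_def by fastforce
qed

lemma y_primitive_y:
  assumes g: "holo (A \<times> ball y0 s) g" and x: "x \<in> A" and y: "y \<in> ball y0 s"
  shows "((\<lambda>y. y_primitive y0 g (x, y)) has_field_derivative g (x, y)) (at y)"
proof -
  have hol: "(\<lambda>y. g (x, y)) holomorphic_on ball y0 s" by (rule yslice_holomorphic[OF g x])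
  obtain G where G: "\<And>y. y \<in> ball y0 s \<Longrightarrow> (G has_field_derivative g (x, y)) (at y within ball y0 s)"
    using holomorphic_convex_primitive'[OF convex_ball open_ball hol] by blast
  have s0: "y0 \<in> ball y0 s" using y by (rule ball_centre)
  have eq: "y_primitive y0 g (x, w) = G w - G y0" if w: "w \<in> ball y0 s" for w
  proof -
    have sub: "path_image (linepath y0 w) \<subseteq> ball y0 s"
      using closed_segment_subset[OF s0 w convex_ball] by simp
    have "((\<lambda>\<eta>. g (x, \<eta>)) has_contour_integral G (pathfinish (linepath y0 w)) - G (pathstart (linepath y0 w))) (linepath y0 w)"
      by (rule contour_integral_primitive[OF G valid_path_linepath sub])
    then show ?thesis unfolding y_primitive_def by (simp add: contour_integral_unique)
  qed
  have "((\<lambda>w. G w - G y0) has_field_derivative g (x, y)) (at y)"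
    using DERIV_diff[OF G[OF y, unfolded at_within_open[OF y open_ball]] DERIV_const[of "G y0"]] by simp
  then show ?thesis
    by (rule has_field_derivative_transform_within_open[OF _ open_ball y]) (simp add: eq)
qed

lemma y_primitive_integral:
  "y_primitive y0 g z = integral (cbox 0 1) (\<lambda>t. g (fst z, linepath y0 (snd z) t) * (snd z - y0))"
  unfolding y_primitive_def contour_integral_integral box_real
  by (intro integral_cong) (simp add: vector_derivative_linepath_at)

lemma linepath_in_ball:
  fixes y0 :: complex
  assumes "y \<in> ball y0 s" "t \<in> {0..1}" shows "linepath y0 y t \<in> ball y0 s"
proof -
  have "y0 \<in> ball y0 s" using assms(1) by (rule ball_centre)
  from closed_segment_subset[OF this assms(1) convex_ball] show ?thesis
    using linepath_image_01[of y0 y] assms(2) by blast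
qed

lemma y_primitive_kernel_continuous:
  fixes y0 :: complex
  assumes g: "continuous_on (A \<times> ball y0 s) g"
  shows "continuous_on ((A \<times> ball y0 s) \<times> cbox 0 1) (\<lambda>(z, t). g (fst z, linepath y0 (snd z) t) * (snd z - y0))"
proof -
  have 1: "continuous_on ((A \<times> ball y0 s) \<times> cbox 0 1) (\<lambda>q. (fst (fst q), linepath y0 (snd (fst q)) (snd q)))"
    unfolding linepath_def by (intro continuous_intros)
  have "continuous_on ((A \<times> ball y0 s) \<times> cbox 0 1) (\<lambda>q. g (fst (fst q), linepath y0 (snd (fst q)) (snd q)))"
  proof (rule continuous_on_compose2[OF g 1])
    show "(\<lambda>q. (fst (fst q), linepath y0 (snd (fst q)) (snd q))) ` ((A \<times> ball y0 s) \<times> cbox 0 1) \<subseteq> A \<times> ball y0 s"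
      using linepath_in_ball[of _ y0 s] by (simp add: image_subset_iff)
  qed
  then show ?thesis unfolding split_def by (rule continuous_on_mult) (intro continuous_intros)
qed

lemma y_primitive_x:
  assumes g: "holo (ball x0 r \<times> ball y0 s) g" and x: "x \<in> ball x0 r" and y: "y \<in> ball y0 s"
  shows "(\<lambda>x. y_primitive y0 g (x, y)) field_differentiable at x"
proof -
  let ?A = "ball x0 r"
  have k: "continuous_on (?A \<times> cbox 0 1) (\<lambda>(x, t). f (x, linepath y0 y t) * (y - y0))"
    if f: "continuous_on (?A \<times> ball y0 s) f" for f
  proof -
    have "continuous_on (?A \<times> cbox 0 1) (\<lambda>q. ((fst q, y), snd q))" by (intro continuous_intros)
    from continuous_on_compose2[OF y_primitive_kernel_continuous[OF f, unfolded split_def] this]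
    show ?thesis using y by (simp add: image_subset_iff split_def)
  qed
  have w: "at x within ?A = at x" by (rule at_within_open[OF x open_ball])
  have "((\<lambda>x. integral (cbox 0 1) (\<lambda>t. g (x, linepath y0 y t) * (y - y0))) has_field_derivative
      integral (cbox 0 1) (\<lambda>t. pdx g (x, linepath y0 y t) * (y - y0))) (at x within ?A)"
  proof (rule leibniz_rule_field_derivative[OF _ _ k x convex_ball])
    show "continuous_on (?A \<times> ball y0 s) (pdx g)" by (rule holo_continuous_on[OF holo_pdx[OF g]])
    show "(\<lambda>t. g (x, linepath y0 y t) * (y - y0)) integrable_on cbox 0 1" if "x \<in> ?A" for x
    proof (rule integrable_continuous)
      have "continuous_on (cbox (0::real) 1) (\<lambda>t. (x, t))" by (intro continuous_intros)
      from continuous_on_compose2[OF k[OF holo_continuous_on[OF g], unfolded split_def] this]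
      show "continuous_on (cbox 0 1) (\<lambda>t. g (x, linepath y0 y t) * (y - y0))"
        using that by (simp add: image_subset_iff)
    qed
    show "((\<lambda>x. g (x, linepath y0 y t) * (y - y0)) has_field_derivative pdx g (x, linepath y0 y t) * (y - y0)) (at x within ?A)"
      if "x \<in> ?A" "t \<in> cbox 0 1" for x t
    proof -
      have "(x, linepath y0 y t) \<in> ?A \<times> ball y0 s" using that linepath_in_ball[OF y] by simp
      from hasd_slice_x[OF holo_hasd[OF g this]]
      have "((\<lambda>x. g (x, linepath y0 y t)) has_field_derivative pdx g (x, linepath y0 y t)) (at x)" by simp
      then show ?thesis by (rule has_field_derivative_at_within[OF DERIV_cmult_right])
    qed
  qed
  then show ?thesis unfolding w y_primitive_integral field_differentiable_def fst_conv snd_conv by (rule exI)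
qed

text \<open>In \<open>y\<close> the function is a primitive, in \<open>x\<close> one differentiates under the integral; Osgood's lemma combines the two.\<close>

lemma y_primitive_holo:
  assumes g: "holo (ball x0 r \<times> ball y0 s) g"
  shows "holo (ball x0 r \<times> ball y0 s) (y_primitive y0 g)"
proof (rule osgood, unfold sep_holo_def, intro conjI ballI)
  show "open (ball x0 r \<times> ball y0 s)" by (intro open_Times open_ball)
  show "continuous_on (ball x0 r \<times> ball y0 s) (y_primitive y0 g)"
    unfolding y_primitive_integral[abs_def]
    by (rule integral_continuous_on_param[OF y_primitive_kernel_continuous[OF holo_continuous_on[OF g]]])
next
  fix z assume "z \<in> ball x0 r \<times> ball y0 s"
  then have z: "fst z \<in> ball x0 r" "snd z \<in> ball y0 s" by auto
  show "(\<lambda>x. y_primitive y0 g (x, snd z)) field_differentiable at (fst z)" by (rule y_primitive_x[OF g z])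
  show "(\<lambda>y. y_primitive y0 g (fst z, y)) field_differentiable at (snd z)"
    using y_primitive_y[OF g z] unfolding field_differentiable_def by blast
qed

lemma y_primitive_pdy:
  assumes "holo (A \<times> ball y0 s) g" "z \<in> A \<times> ball y0 s"
  shows "pdy (y_primitive y0 g) z = g z"
proof -
  have "((\<lambda>y. y_primitive y0 g (fst z, y)) has_field_derivative g (fst z, snd z)) (at (snd z))"
    by (rule y_primitive_y[OF assms(1)]) (use assms(2) in auto)
  then show ?thesis unfolding pdy_def by (simp add: DERIV_imp_deriv)
qed

lemma y_primitive_bound:
  assumes g: "holo (A \<times> ball y0 s) g" and z: "z \<in> A \<times> ball y0 s"
    and b: "\<And>w. w \<in> A \<times> ball y0 s \<Longrightarrow> norm (g w) \<le> C" and C: "C \<ge> 0"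
  shows "norm (y_primitive y0 g z) \<le> C * s"
proof -
  have z': "fst z \<in> A" "snd z \<in> ball y0 s" using z by auto
  then have "y0 \<in> ball y0 s" using ball_centre by blast
  then have sub: "closed_segment y0 (snd z) \<subseteq> ball y0 s"
    using closed_segment_subset[OF _ z'(2) convex_ball] by blast
  have "norm (y_primitive y0 g z) \<le> C * norm (snd z - y0)"
    unfolding y_primitive_def
  proof (rule contour_integral_bound_linepath[OF _ C])
    show "(\<lambda>\<eta>. g (fst z, \<eta>)) contour_integrable_on linepath y0 (snd z)"
      by (rule contour_integrable_continuous_linepath)
         (rule holomorphic_on_imp_continuous_on[OF holomorphic_on_subset[OF yslice_holomorphic[OF g z'(1)] sub]])
    show "norm (g (fst z, x)) \<le> C" if "x \<in> closed_segment y0 (snd z)" for x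
      using b[of "(fst z, x)"] that sub z'(1) by auto
  qed
  also have "\<dots> \<le> C * s" using z'(2) C by (intro mult_left_mono) (auto simp: dist_norm norm_minus_commute)
  finally show ?thesis .
qed

lemma y_primitive_start: "y_primitive y0 g (x, y0) = 0"
  by (simp add: y_primitive_def)

lemma polydisc_bounded:
  assumes "holo (ball x0 R \<times> ball y0 R) f" "R > 0"
  shows "\<exists>C. \<forall>z\<in>cball x0 (R/2) \<times> cball y0 (R/2). norm (f z) \<le> C"
proof -
  have "cball x0 (R/2) \<times> cball y0 (R/2) \<subseteq> ball x0 R \<times> ball y0 R" using assms(2) by (intro Sigma_mono) auto
  then have "compact (f ` (cball x0 (R/2) \<times> cball y0 (R/2)))"
    by (intro compact_continuous_image continuous_on_subset[OF holo_continuous_on[OF assms(1)]] compact_Times compact_cball)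
  then have "bounded (f ` (cball x0 (R/2) \<times> cball y0 (R/2)))" by (rule compact_imp_bounded)
  then show ?thesis unfolding bounded_iff by auto
qed

text \<open>Picard iteration in \<open>y\<close> with \<open>x\<close> as a parameter, on a polydisc so small that the increments decay like \<open>(1/2)\<^sup>m\<close>.\<close>

lemma linear_ode_y:
  fixes b :: "'j \<Rightarrow> 'j \<Rightarrow> C2 \<Rightarrow> complex" and e :: "'j \<Rightarrow> complex \<Rightarrow> complex"
  assumes J: "finite J" and R: "R > 0"
    and b: "\<And>j k. j \<in> J \<Longrightarrow> k \<in> J \<Longrightarrow> holo (ball x0 R \<times> ball y0 R) (b j k)"
    and e: "\<And>j. j \<in> J \<Longrightarrow> holo (ball x0 R \<times> ball y0 R) (\<lambda>z. e j (fst z))"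
  shows "\<exists>s u. 0 < s \<and> s \<le> R \<and> (\<forall>j\<in>J. holo (ball x0 s \<times> ball y0 s) (u j) \<and>
     (\<forall>z\<in>ball x0 s \<times> ball y0 s. pdy (u j) z = (\<Sum>k\<in>J. b j k z * u k z)) \<and>
     (\<forall>x\<in>ball x0 s. u j (x, y0) = e j x))"
proof -
  let ?H = "cball x0 (R/2) \<times> cball y0 (R/2)"
  obtain C where C: "C > 0" "\<forall>q\<in>J \<times> J. \<forall>z\<in>?H. norm (b (fst q) (snd q) z) \<le> C"
    using finite_common_bound[of "J \<times> J" ?H "\<lambda>q z. norm (b (fst q) (snd q) z)"]
      polydisc_bounded[OF b R] J by auto
  obtain K where K: "K > 0" "\<forall>j\<in>J. \<forall>z\<in>?H. norm (e j (fst z)) \<le> K"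
    using finite_common_bound[of J ?H "\<lambda>j z. norm (e j (fst z))"] polydisc_bounded[OF e R] J by auto
  define n where "n = real (card J)"
  define s where "s = min (R/2) (1 / (2 * (n + 1) * C))"
  have n0: "n \<ge> 0" by (simp add: n_def)
  have pos: "2 * (n + 1) * C > 0" using n0 C(1) by simp
  have s: "s > 0" "s \<le> R/2" using R pos by (auto simp: s_def)
  have sn: "n * C * s \<le> 1 / 2"
  proof -
    have "s \<le> 1 / (2 * (n + 1) * C)" by (simp add: s_def)
    then have "s * (2 * (n + 1) * C) \<le> 1" using pos by (simp add: pos_le_divide_eq)
    moreover have "0 \<le> C * s" using C(1) s(1) by simp
    ultimately show ?thesis by (simp add: algebra_simps)
  qed
  let ?A = "ball x0 s" and ?B = "ball y0 s"
  let ?D = "?A \<times> ?B"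
  have DH: "?D \<subseteq> ?H" using s by (intro Sigma_mono) auto
  have DR: "?D \<subseteq> ball x0 R \<times> ball y0 R" using s R by (intro Sigma_mono) auto
  have oD: "open ?D" by (intro open_Times open_ball)
  have bD: "holo ?D (b j k)" if "j \<in> J" "k \<in> J" for j k by (rule holo_subset[OF b[OF that] oD DR])
  \<comment> \<open>The increments of the Picard iteration.\<close>
  define \<delta> where "\<delta> = rec_nat (\<lambda>j z. e j (fst z)) (\<lambda>_ d j. y_primitive y0 (\<lambda>z. \<Sum>k\<in>J. b j k z * d k z))"
  have \<delta>0: "\<delta> 0 j = (\<lambda>z. e j (fst z))" for j by (simp add: \<delta>_def)
  have \<delta>S: "\<delta> (Suc m) j = y_primitive y0 (\<lambda>z. \<Sum>k\<in>J. b j k z * \<delta> m k z)" for m j by (simp add: \<delta>_def)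
  have h\<delta>: "holo ?D (\<delta> m j)" if "j \<in> J" for m j
    using that
  proof (induction m arbitrary: j)
    case 0 then show ?case unfolding \<delta>0 by (rule holo_subset[OF e oD DR])
  next
    case (Suc m) show ?case unfolding \<delta>S
      by (intro y_primitive_holo holo_sum[OF oD] holo_mult bD Suc)
  qed
  have hs: "holo ?D (\<lambda>z. \<Sum>k\<in>J. b j k z * \<delta> m k z)" if "j \<in> J" for m j
    by (intro holo_sum[OF oD] holo_mult bD h\<delta> that)
  have bnd: "norm (\<delta> m j z) \<le> K * (1/2)^m" if "j \<in> J" "z \<in> ?D" for m j z
    using that
  proof (induction m arbitrary: j z)
    case 0 then show ?case using K(2) DH by (auto simp: \<delta>0)
  next
    case (Suc m)
    have "norm (\<Sum>k\<in>J. b j k w * \<delta> m k w) \<le> n * (C * (K * (1/2)^m))" if w: "w \<in> ?D" for w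
    proof -
      have "norm (\<Sum>k\<in>J. b j k w * \<delta> m k w) \<le> (\<Sum>k\<in>J. C * (K * (1/2)^m))"
        unfolding n_def
      proof (rule sum_norm_le)
        fix k assume k: "k \<in> J"
        have "norm (b j k w) \<le> C" using C(2) Suc.prems(1) k subsetD[OF DH w] by auto
        then show "norm (b j k w * \<delta> m k w) \<le> C * (K * (1/2)^m)"
          unfolding norm_mult using Suc.IH[OF k w] C(1) by (intro mult_mono) auto
      qed
      then show ?thesis by (simp add: n_def)
    qed
    then have "norm (\<delta> (Suc m) j z) \<le> n * (C * (K * (1/2)^m)) * s"
      unfolding \<delta>S using n0 C(1) K(1) by (intro y_primitive_bound[OF hs[OF Suc.prems(1)] Suc.prems(2)]) auto
    also have "\<dots> = (n * C * s) * (K * (1/2)^m)" by (simp add: algebra_simps)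
    also have "\<dots> \<le> 1/2 * (K * (1/2)^m)" using sn K(1) by (intro mult_right_mono) auto
    finally show ?case by simp
  qed
  define S where "S j N z = (\<Sum>m<N. \<delta> m j z)" for j N z
  define u where "u j z = (\<Sum>m. \<delta> m j z)" for j z
  have ul: "uniform_limit ?D (S j) (u j) sequentially" if "j \<in> J" for j
    unfolding S_def u_def
    by (rule Weierstrass_m_test[where M = "\<lambda>m. K * (1/2)^m"])
       (use bnd that in \<open>auto intro: summable_mult summable_geometric\<close>)
  have hS: "holo ?D (S j N)" if "j \<in> J" for j N
    unfolding S_def by (rule holo_sum[OF oD h\<delta>[OF that]])
  have yS: "pdy (S j (Suc N)) z = (\<Sum>k\<in>J. b j k z * S k N z)" if "j \<in> J" "z \<in> ?D" for j N z
  proof -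
    have "pdy (S j (Suc N)) z = (\<Sum>m<Suc N. pdy (\<delta> m j) z)"
      unfolding S_def by (rule pd_sum(2)[OF h\<delta>[OF that(1)] that(2)])
    also have "\<dots> = pdy (\<delta> 0 j) z + (\<Sum>m<N. pdy (\<delta> (Suc m) j) z)" by (rule sum.lessThan_Suc_shift)
    also have "pdy (\<delta> 0 j) z = 0" unfolding \<delta>0 pdy_def by simp
    also have "(\<Sum>m<N. pdy (\<delta> (Suc m) j) z) = (\<Sum>m<N. \<Sum>k\<in>J. b j k z * \<delta> m k z)"
      unfolding \<delta>S by (intro sum.cong refl y_primitive_pdy[OF hs[OF that(1)] that(2)])
    also have "\<dots> = (\<Sum>k\<in>J. b j k z * S k N z)"
      unfolding S_def sum_distrib_left by (rule sum.swap)
    finally show ?thesis by simp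
  qed
  have ptw: "(\<lambda>N. S j N z) \<longlonglongrightarrow> u j z" if "j \<in> J" "z \<in> ?D" for j z
    using tendsto_uniform_limitI[OF ul[OF that(1)] that(2)] .
  have sep: "sep_holo ?D (u j)" if j: "j \<in> J" for j
    unfolding sep_holo_def
  proof (intro conjI ballI oD)
    show "continuous_on ?D (u j)"
      by (rule uniform_limit_theorem[OF _ ul[OF j]]) (use holo_continuous_on[OF hS[OF j]] in auto)
    fix z assume z: "z \<in> ?D"
    obtain r where r: "r > 0" "cball (fst z) r \<times> cball (snd z) r \<subseteq> ?D"
      using polydisc_in_open[OF oD z] by blast
    have fz: "fst z \<in> cball (fst z) r" "snd z \<in> cball (snd z) r" using r by auto
    have subx: "(x, snd z) \<in> ?D" if "x \<in> cball (fst z) r" for x by (rule subsetD[OF r(2)]) (use that fz in simp)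
    have suby: "(fst z, y) \<in> ?D" if "y \<in> cball (snd z) r" for y by (rule subsetD[OF r(2)]) (use that fz in simp)
    have "(\<lambda>x. S j N (x, snd z)) holomorphic_on cball (fst z) r" for N
      by (rule holo_slice_x[OF holo_sep_holo[OF hS[OF j]]]) (use subx in auto)
    then have 1: "\<forall>\<^sub>F N in sequentially. continuous_on (cball (fst z) r) (\<lambda>x. S j N (x, snd z)) \<and>
         (\<lambda>x. S j N (x, snd z)) holomorphic_on ball (fst z) r"
      by (intro always_eventually allI conjI)
         (meson holomorphic_on_imp_continuous_on holomorphic_on_subset ball_subset_cball)+
    have 2: "uniform_limit (cball (fst z) r) (\<lambda>N x. S j N (x, snd z)) (\<lambda>x. u j (x, snd z)) sequentially"
      by (rule uniform_limit_subst[OF ul[OF j] subx])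
    obtain "(\<lambda>x. u j (x, snd z)) holomorphic_on ball (fst z) r"
      using holomorphic_uniform_limit[OF 1 2] by auto
    then show "(\<lambda>x. u j (x, snd z)) field_differentiable at (fst z)"
      by (rule holomorphic_on_imp_differentiable_at) (use r in auto)
    have "(\<lambda>y. S j N (fst z, y)) holomorphic_on cball (snd z) r" for N
      by (rule holomorphic_on_subset[OF yslice_holomorphic[OF hS[OF j], of "fst z"]]) (use z suby in auto)
    then have 1: "\<forall>\<^sub>F N in sequentially. continuous_on (cball (snd z) r) (\<lambda>y. S j N (fst z, y)) \<and>
         (\<lambda>y. S j N (fst z, y)) holomorphic_on ball (snd z) r"
      by (intro always_eventually allI conjI)
         (meson holomorphic_on_imp_continuous_on holomorphic_on_subset ball_subset_cball)+
    have 2: "uniform_limit (cball (snd z) r) (\<lambda>N y. S j N (fst z, y)) (\<lambda>y. u j (fst z, y)) sequentially"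
      by (rule uniform_limit_subst[OF ul[OF j] suby])
    obtain "(\<lambda>y. u j (fst z, y)) holomorphic_on ball (snd z) r"
      using holomorphic_uniform_limit[OF 1 2] by auto
    then show "(\<lambda>y. u j (fst z, y)) field_differentiable at (snd z)"
      by (rule holomorphic_on_imp_differentiable_at) (use r in auto)
  qed
  have hu: "holo ?D (u j)" if "j \<in> J" for j by (rule osgood[OF sep[OF that]])
  have uy: "pdy (u j) z = (\<Sum>k\<in>J. b j k z * u k z)" if j: "j \<in> J" and z: "z \<in> ?D" for j z
  proof -
    obtain r where r: "r > 0" "cball (fst z) r \<times> cball (snd z) r \<subseteq> ?D"
      using polydisc_in_open[OF oD z] by blast
    have suby: "(fst z, y) \<in> ?D" if "y \<in> cball (snd z) r" for y
      by (rule subsetD[OF r(2)]) (use that r(1) in simp)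
    have d: "((\<lambda>y. S j (Suc N) (fst z, y)) has_field_derivative (\<Sum>k\<in>J. b j k (fst z, y) * S k N (fst z, y))) (at y)"
      if "y \<in> cball (snd z) r" for N y
      using hasd_slice_y[OF holo_hasd[OF hS[OF j, of "Suc N"] suby[OF that]]]
      unfolding yS[OF j suby[OF that]] by (simp only: fst_conv snd_conv)
    have c: "continuous_on (cball (snd z) r) (\<lambda>y. S j (Suc N) (fst z, y))" for N
      by (rule DERIV_continuous_on, rule has_field_derivative_at_within, rule d)
    have 1: "\<forall>\<^sub>F N in sequentially. continuous_on (cball (snd z) r) (\<lambda>y. S j (Suc N) (fst z, y)) \<and>
        (\<forall>y\<in>ball (snd z) r. ((\<lambda>y. S j (Suc N) (fst z, y)) has_field_derivative (\<Sum>k\<in>J. b j k (fst z, y) * S k N (fst z, y))) (at y))"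
      using c d by (intro always_eventually) auto
    have "uniform_limit (cball (snd z) r) (\<lambda>N y. S j N (fst z, y)) (\<lambda>y. u j (fst z, y)) sequentially"
      by (rule uniform_limit_subst[OF ul[OF j] suby])
    from filterlim_compose[OF this filterlim_Suc]
    have 2: "uniform_limit (cball (snd z) r) (\<lambda>N y. S j (Suc N) (fst z, y)) (\<lambda>y. u j (fst z, y)) sequentially" .
    obtain g' where g: "\<And>w. w \<in> ball (snd z) r \<Longrightarrow> ((\<lambda>y. u j (fst z, y)) has_field_derivative g' w) (at w) \<and>
        ((\<lambda>N. \<Sum>k\<in>J. b j k (fst z, w) * S k N (fst z, w)) \<longlonglongrightarrow> g' w)"
      using has_complex_derivative_uniform_limit[OF 1 2 _ r(1)] by auto
    have zb: "snd z \<in> ball (snd z) r" using r(1) by simp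
    have "(\<lambda>N. \<Sum>k\<in>J. b j k z * S k N z) \<longlonglongrightarrow> (\<Sum>k\<in>J. b j k z * u k z)"
      by (intro tendsto_intros ptw z)
    then have "g' (snd z) = (\<Sum>k\<in>J. b j k z * u k z)"
      using g[OF zb] LIMSEQ_unique by fastforce
    then show ?thesis using g[OF zb] unfolding pdy_def by (simp add: DERIV_imp_deriv)
  qed
  have u0: "u j (x, y0) = e j x" if "j \<in> J" for x j
  proof -
    have "(\<lambda>m. \<delta> m j (x, y0)) = (\<lambda>m. if m = 0 then e j x else 0)"
    proof
      fix m show "\<delta> m j (x, y0) = (if m = 0 then e j x else 0)"
        by (cases m) (simp_all add: \<delta>0 \<delta>S y_primitive_start)
    qed
    then show ?thesis
      unfolding u_def using suminf_finite[of "{0::nat}" "\<lambda>m. if m = 0 then e j x else 0"] by simp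
  qed
  show ?thesis
    by (rule exI[of _ s], rule exI[of _ u]) (use s R hu uy u0 in simp)
qed

lemma hasd_fix_x:
  assumes "holo U f" "(x, snd z) \<in> U"
  shows "hasd (\<lambda>z. f (x, snd z)) 0 (pdy f (x, snd z)) z"
proof -
  have "(f has_derivative (\<lambda>v. pdx f (x, snd z) * fst v + pdy f (x, snd z) * snd v)) (at ((\<lambda>z. (x, snd z)) z))"
    using holo_hasd[OF assms] by (simp add: hasd_def)
  moreover have "((\<lambda>z::C2. (x, snd z)) has_derivative (\<lambda>v. (0, snd v))) (at z)"
    by (auto intro!: derivative_eq_intros)
  ultimately show ?thesis
    unfolding hasd_def using diff_chain_at by (fastforce simp: o_def)
qed

lemma hasd_flip:
  assumes "holo U f" "(snd z, y) \<in> U"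
  shows "hasd (\<lambda>z. f (snd z, y)) 0 (pdx f (snd z, y)) z"
proof -
  have "(f has_derivative (\<lambda>v. pdx f (snd z, y) * fst v + pdy f (snd z, y) * snd v)) (at ((\<lambda>z. (snd z, y)) z))"
    using holo_hasd[OF assms] by (simp add: hasd_def)
  moreover have "((\<lambda>z::C2. (snd z, y)) has_derivative (\<lambda>v. (snd v, 0))) (at z)"
    by (auto intro!: derivative_eq_intros)
  ultimately show ?thesis
    unfolding hasd_def using diff_chain_at by (fastforce simp: o_def)
qed

text \<open>For fixed \<open>x\<close> this is a Pfaffian system with zero matrix in one direction, so \<open>linear_system_unique\<close> and the
identity theorem apply.\<close>

lemma linear_ode_y_unique:
  assumes J: "finite J"
    and b: "\<And>j k. j \<in> J \<Longrightarrow> k \<in> J \<Longrightarrow> holo (ball x0 s \<times> ball y0 s) (b j k)"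
    and v: "\<And>j. j \<in> J \<Longrightarrow> holo (ball x0 s \<times> ball y0 s) (v j)"
    and vy: "\<And>j z. j \<in> J \<Longrightarrow> z \<in> ball x0 s \<times> ball y0 s \<Longrightarrow> pdy (v j) z = (\<Sum>k\<in>J. b j k z * v k z)"
    and v0: "\<And>j x. j \<in> J \<Longrightarrow> x \<in> ball x0 s \<Longrightarrow> v j (x, y0) = 0"
    and j: "j \<in> J" and z: "z \<in> ball x0 s \<times> ball y0 s"
  shows "v j z = 0"
proof -
  let ?x = "fst z" and ?p = "(fst z, y0)"
  have x: "?x \<in> ball x0 s" and y: "snd z \<in> ball y0 s" using z by auto
  have s: "s > 0" using ball_centre[OF x] by simp
  have in': "(?x, snd w) \<in> ball x0 s \<times> ball y0 s" if "w \<in> ball ?p s" for w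
  proof -
    have "dist y0 (snd w) \<le> dist ?p w" using dist_snd_le[of ?p w] by simp
    then show ?thesis using that x by simp
  qed
  have hd: "hasd (\<lambda>w. f (?x, snd w)) 0 (pdy f (?x, snd w)) w" if "holo (ball x0 s \<times> ball y0 s) f" "w \<in> ball ?p s" for f w
    by (rule hasd_fix_x[OF that(1) in'[OF that(2)]])
  have hh: "holo (ball ?p s) (\<lambda>w. f (?x, snd w))" if "holo (ball x0 s \<times> ball y0 s) f" for f
    by (rule hasd_holo[OF open_ball], intro exI, rule hd[OF that])
  have "\<exists>t>0. t \<le> s \<and> (\<forall>j\<in>J. \<forall>w\<in>ball ?p t. v j (?x, snd w) = 0)"
  proof (rule linear_system_unique[OF J s, where a = "\<lambda>j k w. 0" and b = "\<lambda>j k w. b j k (?x, snd w)" and v = "\<lambda>j w. v j (?x, snd w)"])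
    show "pdx (\<lambda>w. v j (?x, snd w)) w = (\<Sum>k\<in>J. 0 * v k (?x, snd w))" if "j \<in> J" "w \<in> ball ?p s" for j w
      using hasd_pdx[OF hd[OF v[OF that(1)] that(2)]] by simp
    show "pdy (\<lambda>w. v j (?x, snd w)) w = (\<Sum>k\<in>J. b j k (?x, snd w) * v k (?x, snd w))" if "j \<in> J" "w \<in> ball ?p s" for j w
      using hasd_pdy[OF hd[OF v[OF that(1)] that(2)]] vy[OF that(1) in'[OF that(2)]] by simp
  qed (use v0 x in \<open>auto intro: hh b v holo_const\<close>)
  then obtain t where t: "t > 0" "t \<le> s" "\<forall>j\<in>J. \<forall>w\<in>ball ?p t. v j (?x, snd w) = 0" by blast
  have "v j (?x, snd z) = 0"
  proof (rule holo_zero_ball[OF hh[OF v[OF j]] open_ball, of ?p t])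
    show "ball ?p t \<noteq> {}" using t(1) by simp
    show "ball ?p t \<subseteq> ball ?p s" using t(2) by (rule subset_ball)
    show "v j (?x, snd w) = 0" if "w \<in> ball ?p t" for w using t(3) j that by blast
    show "z \<in> ball ?p s" using y by (simp add: dist_Pair_Pair dist_prod_def)
  qed
  then show ?thesis by simp
qed

text \<open>Solve the equation in \<open>x\<close> along the line \<open>y = y0\<close>, then the equation in \<open>y\<close> from these initial values. By flatness the
defect in the \<open>x\<close>-equation satisfies the homogeneous equation in \<open>y\<close>; it vanishes on the line, hence everywhere.\<close>

theorem frobenius_linear:
  fixes a b :: "'j \<Rightarrow> 'j \<Rightarrow> C2 \<Rightarrow> complex" and c :: "'j \<Rightarrow> complex"
  assumes J: "finite J" and W: "open W" "p \<in> W"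
    and a: "\<And>j k. j \<in> J \<Longrightarrow> k \<in> J \<Longrightarrow> holo W (a j k)"
    and b: "\<And>j k. j \<in> J \<Longrightarrow> k \<in> J \<Longrightarrow> holo W (b j k)"
    and flat: "\<And>j k z. j \<in> J \<Longrightarrow> k \<in> J \<Longrightarrow> z \<in> W \<Longrightarrow>
       pdy (a j k) z + (\<Sum>i\<in>J. a j i z * b i k z) = pdx (b j k) z + (\<Sum>i\<in>J. b j i z * a i k z)"
  shows "\<exists>s u. 0 < s \<and> ball p s \<subseteq> W \<and> (\<forall>j\<in>J. holo (ball p s) (u j) \<and> u j p = c j \<and>
     (\<forall>z\<in>ball p s. pdx (u j) z = (\<Sum>k\<in>J. a j k z * u k z) \<and> pdy (u j) z = (\<Sum>k\<in>J. b j k z * u k z)))"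
proof -
  obtain x0 y0 where p: "p = (x0, y0)" by fastforce
  obtain R where R: "R > 0" "cball x0 R \<times> cball y0 R \<subseteq> W" using polydisc_in_open[OF W] p by auto
  have RW: "ball x0 R \<times> ball y0 R \<subseteq> W"
    by (rule order_trans[OF Sigma_mono R(2)]) auto
  have oP: "open (ball x s \<times> ball y s)" for x y :: complex and s by (intro open_Times open_ball)
  \<comment> \<open>For the equation in \<open>x\<close> the lemma is applied with \<open>x\<close> as its second variable and a first variable on which nothing
    depends.\<close>
  have fl: "(snd z, y0) \<in> W" if "z \<in> ball 0 R \<times> ball x0 R" for z
    by (rule subsetD[OF RW]) (use that R in auto)
  have "\<exists>s u. 0 < s \<and> s \<le> R \<and> (\<forall>j\<in>J. holo (ball 0 s \<times> ball x0 s) (u j) \<and>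
     (\<forall>z\<in>ball 0 s \<times> ball x0 s. pdy (u j) z = (\<Sum>k\<in>J. a j k (snd z, y0) * u k z)) \<and>
     (\<forall>x\<in>ball 0 s. u j (x, x0) = c j))"
  proof (rule linear_ode_y[OF J R(1)])
    show "holo (ball 0 R \<times> ball x0 R) (\<lambda>z. a j k (snd z, y0))" if "j \<in> J" "k \<in> J" for j k
      by (rule hasd_holo[OF oP], intro exI, rule hasd_flip[OF a[OF that] fl])
    show "holo (ball 0 R \<times> ball x0 R) (\<lambda>z. c j)" for j by (rule holo_const[OF oP])
  qed
  then obtain s1 u1 where s1: "0 < s1" "s1 \<le> R" and u1: "\<forall>j\<in>J. holo (ball 0 s1 \<times> ball x0 s1) (u1 j) \<and>
     (\<forall>z\<in>ball 0 s1 \<times> ball x0 s1. pdy (u1 j) z = (\<Sum>k\<in>J. a j k (snd z, y0) * u1 k z)) \<and>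
     (\<forall>x\<in>ball 0 s1. u1 j (x, x0) = c j)" by blast
  define e where "e j x = u1 j (0, x)" for j x
  have de: "(e j has_field_derivative (\<Sum>k\<in>J. a j k (x, y0) * e k x)) (at x)" if "j \<in> J" "x \<in> ball x0 s1" for j x
  proof -
    have "(0, x) \<in> ball 0 s1 \<times> ball x0 s1" using that s1 by simp
    then show ?thesis
      using hasd_slice_y[OF holo_hasd[of _ "u1 j" "(0, x)"]] u1 that(1) unfolding e_def[abs_def] by fastforce
  qed
  have s1W: "ball x0 s1 \<times> ball y0 s1 \<subseteq> W"
    by (rule order_trans[OF Sigma_mono RW]) (use s1 in auto)
  have "\<exists>s u. 0 < s \<and> s \<le> s1 \<and> (\<forall>j\<in>J. holo (ball x0 s \<times> ball y0 s) (u j) \<and>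
     (\<forall>z\<in>ball x0 s \<times> ball y0 s. pdy (u j) z = (\<Sum>k\<in>J. b j k z * u k z)) \<and>
     (\<forall>x\<in>ball x0 s. u j (x, y0) = e j x))"
  proof (rule linear_ode_y[OF J s1(1)])
    show "holo (ball x0 s1 \<times> ball y0 s1) (b j k)" if "j \<in> J" "k \<in> J" for j k
      by (rule holo_subset[OF b[OF that] oP s1W])
    show "holo (ball x0 s1 \<times> ball y0 s1) (\<lambda>z. e j (fst z))" if "j \<in> J" for j
    proof (rule hasd_holo[OF oP], intro exI)
      fix z assume z: "z \<in> ball x0 s1 \<times> ball y0 s1"
      have f: "hasd fst 1 0 z" unfolding hasd_def by (auto intro!: bounded_linear_imp_has_derivative bounded_linear_fst)
      show "hasd (\<lambda>z. e j (fst z)) ((\<Sum>k\<in>J. a j k (fst z, y0) * e k (fst z)) * 1) ((\<Sum>k\<in>J. a j k (fst z, y0) * e k (fst z)) * 0) z"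
        by (rule hasd_comp[OF f de[OF that]]) (use z in auto)
    qed
  qed
  then obtain s u where s: "0 < s" "s \<le> s1" and u: "\<forall>j\<in>J. holo (ball x0 s \<times> ball y0 s) (u j) \<and>
     (\<forall>z\<in>ball x0 s \<times> ball y0 s. pdy (u j) z = (\<Sum>k\<in>J. b j k z * u k z)) \<and>
     (\<forall>x\<in>ball x0 s. u j (x, y0) = e j x)" by blast
  let ?D = "ball x0 s \<times> ball y0 s"
  have DW: "?D \<subseteq> W" by (rule order_trans[OF Sigma_mono s1W]) (use s in auto)
  have hu: "holo ?D (u j)" if "j \<in> J" for j using u that by blast
  have uy: "pdy (u j) z = (\<Sum>k\<in>J. b j k z * u k z)" if "j \<in> J" "z \<in> ?D" for j z using u that by blast
  have aD: "holo ?D (a j k)" and bD: "holo ?D (b j k)" if "j \<in> J" "k \<in> J" for j k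
    using holo_subset[OF a[OF that] oP DW] holo_subset[OF b[OF that] oP DW] by blast+
  define E where "E j z = pdx (u j) z - (\<Sum>k\<in>J. a j k z * u k z)" for j z
  have hau: "holo ?D (\<lambda>z. \<Sum>k\<in>J. a j k z * u k z)" "holo ?D (\<lambda>z. \<Sum>k\<in>J. b j k z * u k z)" if "j \<in> J" for j
    using that by (auto intro!: holo_sum[OF oP] holo_mult aD bD hu)
  have E0: "E j z = 0" if j: "j \<in> J" and z: "z \<in> ?D" for j z
  proof (rule linear_ode_y_unique[OF J bD _ _ _ j z])
    show "holo ?D (E j)" if "j \<in> J" for j
      unfolding E_def[abs_def] by (intro holo_diff holo_pdx hu hau that)
    show "E j (x, y0) = 0" if j: "j \<in> J" and x: "x \<in> ball x0 s" for j x
    proof -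
      have xD: "(x, y0) \<in> ?D" using x s by simp
      have "((\<lambda>x. u j (x, y0)) has_field_derivative pdx (u j) (x, y0)) (at x)"
        using hasd_slice_x[OF holo_hasd[OF hu[OF j] xD]] by simp
      moreover have "((\<lambda>x. u j (x, y0)) has_field_derivative (\<Sum>k\<in>J. a j k (x, y0) * e k x)) (at x)"
        by (rule has_field_derivative_transform_within_open[OF de[OF j] open_ball x]) (use x s u j in auto)
      ultimately have "pdx (u j) (x, y0) = (\<Sum>k\<in>J. a j k (x, y0) * e k x)" by (rule DERIV_unique)
      also have "\<dots> = (\<Sum>k\<in>J. a j k (x, y0) * u k (x, y0))" using u x by (intro sum.cong) auto
      finally show ?thesis by (simp add: E_def)
    qed
    show "pdy (E j) z = (\<Sum>k\<in>J. b j k z * E k z)" if j: "j \<in> J" and z: "z \<in> ?D" for j z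
    proof -
      have "pdy (E j) z = pdy (pdx (u j)) z - pdy (\<lambda>z. \<Sum>k\<in>J. a j k z * u k z) z"
        unfolding E_def[abs_def] by (rule pd_diff(2)[OF holo_pdx[OF hu[OF j]] hau(1)[OF j] z])
      also have "pdy (pdx (u j)) z = pdx (pdy (u j)) z" by (rule pd_commute[OF hu[OF j] z])
      also have "\<dots> = pdx (\<lambda>z. \<Sum>k\<in>J. b j k z * u k z) z"
        by (rule pd_cong(1)[OF oP z]) (rule uy[OF j])
      also have "\<dots> = (\<Sum>k\<in>J. pdx (\<lambda>z. b j k z * u k z) z)"
        by (rule pd_sum(1)[OF _ z]) (intro holo_mult bD hu j)
      also have "\<dots> = (\<Sum>k\<in>J. pdx (b j k) z * u k z + b j k z * pdx (u k) z)"
        by (intro sum.cong refl pd_mult(1)[OF bD hu z] j)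
      also have "pdy (\<lambda>z. \<Sum>k\<in>J. a j k z * u k z) z = (\<Sum>k\<in>J. pdy (\<lambda>z. a j k z * u k z) z)"
        by (rule pd_sum(2)[OF _ z]) (intro holo_mult aD hu j)
      also have "\<dots> = (\<Sum>k\<in>J. pdy (a j k) z * u k z + a j k z * pdy (u k) z)"
        by (intro sum.cong refl pd_mult(2)[OF aD hu z] j)
      also have "\<dots> = (\<Sum>k\<in>J. pdy (a j k) z * u k z) + (\<Sum>i\<in>J. a j i z * (\<Sum>k\<in>J. b i k z * u k z))"
        unfolding sum.distrib using uy[OF _ z] by simp
      also have "(\<Sum>i\<in>J. a j i z * (\<Sum>k\<in>J. b i k z * u k z)) = (\<Sum>k\<in>J. (\<Sum>i\<in>J. a j i z * b i k z) * u k z)"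
        unfolding sum_distrib_left sum_distrib_right mult.assoc by (rule sum.swap)
      also have "(\<Sum>k\<in>J. pdy (a j k) z * u k z) + \<dots> = (\<Sum>k\<in>J. (pdy (a j k) z + (\<Sum>i\<in>J. a j i z * b i k z)) * u k z)"
        by (simp add: sum.distrib distrib_right)
      also have "\<dots> = (\<Sum>k\<in>J. (pdx (b j k) z + (\<Sum>i\<in>J. b j i z * a i k z)) * u k z)"
        using flat[OF j _ subsetD[OF DW z]] by simp
      also have "\<dots> = (\<Sum>k\<in>J. pdx (b j k) z * u k z) + (\<Sum>k\<in>J. (\<Sum>i\<in>J. b j i z * a i k z) * u k z)"
        by (simp add: sum.distrib distrib_right)
      also have "(\<Sum>k\<in>J. (\<Sum>i\<in>J. b j i z * a i k z) * u k z) = (\<Sum>i\<in>J. b j i z * (\<Sum>k\<in>J. a i k z * u k z))"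
        unfolding sum_distrib_left sum_distrib_right mult.assoc by (rule sum.swap)
      finally show ?thesis
        unfolding E_def by (simp add: sum.distrib right_diff_distrib sum_subtractf)
    qed
  qed
  have in': "ball p s \<subseteq> ?D"
  proof
    fix w assume "w \<in> ball p s"
    then show "w \<in> ?D" using dist_fst_le[of p w] dist_snd_le[of p w] by (cases w) (auto simp: p)
  qed
  show ?thesis
  proof (rule exI[of _ s], rule exI[of _ u], intro conjI ballI)
    show "ball p s \<subseteq> W" using in' DW by (rule order_trans)
    show "holo (ball p s) (u j)" if "j \<in> J" for j by (rule holo_subset[OF hu[OF that] open_ball in'])
    show "u j p = c j" if "j \<in> J" for j
      using u u1 that s s1 unfolding p e_def by simp
    show "pdx (u j) z = (\<Sum>k\<in>J. a j k z * u k z)" if "j \<in> J" "z \<in> ball p s" for j z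
      using E0[OF that(1) subsetD[OF in' that(2)]] by (simp add: E_def)
    show "pdy (u j) z = (\<Sum>k\<in>J. b j k z * u k z)" if "j \<in> J" "z \<in> ball p s" for j z
      by (rule uy[OF that(1) subsetD[OF in' that(2)]])
  qed (rule s)
qed

section \<open>Reduction of order\<close>

text \<open>The new coordinates depend on \<open>t\<close> and on the matrices alone, not on the solution \<open>V\<close>. This lets a differential
identity be transported from one solution of the Pfaffian system to another.\<close>

lemma vderiv_linear_combination:
  assumes I: "finite I" and t: "\<And>q. q \<in> I \<Longrightarrow> holo B (t q)" and V: "\<And>q. q \<in> I \<Longrightarrow> holo B (V q)"
    and dx: "\<And>k z. k \<in> I \<Longrightarrow> z \<in> B \<Longrightarrow> pdx (V k) z = (\<Sum>q\<in>I. a k q z * V q z)"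
    and dy: "\<And>k z. k \<in> I \<Longrightarrow> z \<in> B \<Longrightarrow> pdy (V k) z = (\<Sum>q\<in>I. b k q z * V q z)"
    and z: "z \<in> B"
  shows "vderiv \<alpha> \<beta> (\<lambda>z. \<Sum>q\<in>I. t q z * V q z) z =
     (\<Sum>q\<in>I. (vderiv \<alpha> \<beta> (t q) z + (\<Sum>k\<in>I. t k z * (\<alpha> z * a k q z + \<beta> z * b k q z))) * V q z)"
proof -
  have "vderiv \<alpha> \<beta> (\<lambda>z. \<Sum>q\<in>I. t q z * V q z) z = (\<Sum>q\<in>I. vderiv \<alpha> \<beta> (\<lambda>z. t q z * V q z) z)"
    by (rule vderiv_sum[OF _ z]) (intro holo_mult t V)
  also have "\<dots> = (\<Sum>q\<in>I. vderiv \<alpha> \<beta> (t q) z * V q z + t q z * vderiv \<alpha> \<beta> (V q) z)"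
    by (intro sum.cong refl vderiv_mult[OF t V z])
  also have "\<dots> = (\<Sum>q\<in>I. vderiv \<alpha> \<beta> (t q) z * V q z) + (\<Sum>k\<in>I. t k z * (\<Sum>q\<in>I. (\<alpha> z * a k q z + \<beta> z * b k q z) * V q z))"
    unfolding sum.distrib
    by (simp add: vderiv_def[of \<alpha> \<beta> "V _"] dx[OF _ z] dy[OF _ z] sum_distrib_left distrib_right sum.distrib mult.assoc cong: sum.cong)
  also have "(\<Sum>k\<in>I. t k z * (\<Sum>q\<in>I. (\<alpha> z * a k q z + \<beta> z * b k q z) * V q z)) =
     (\<Sum>q\<in>I. (\<Sum>k\<in>I. t k z * (\<alpha> z * a k q z + \<beta> z * b k q z)) * V q z)"
    unfolding sum_distrib_left sum_distrib_right mult.assoc[symmetric] by (rule sum.swap)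
  finally show ?thesis by (simp add: sum.distrib distrib_right)
qed

text \<open>The vector \<open>v\<close> and the vectors \<open>Um m\<close> solve one Pfaffian system over the ring of \<open>S\<close>. By the last assumption a
coordinate vector, up to its entry at \<open>o'\<close>, is determined by its pairings with the \<open>Um m\<close>.\<close>

locale fundamental_solutions = pencil U F w1 w2 for U F w1 w2 +
  fixes B :: "C2 set" and I :: "'j set" and o' :: 'j and v :: "'j \<Rightarrow> C2 \<Rightarrow> complex"
    and a b :: "'j \<Rightarrow> 'j \<Rightarrow> C2 \<Rightarrow> complex" and Um :: "'j \<Rightarrow> 'j \<Rightarrow> C2 \<Rightarrow> complex" and S :: "(C2 \<Rightarrow> complex) set"
  assumes fI: "finite I" and oI: "o' \<in> I" and oB: "open B" and BU: "B \<subseteq> U" and S0S: "S0 \<subseteq> S"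
    and hv: "\<And>q. q \<in> I \<Longrightarrow> holo B (v q)" and vo: "\<And>z. z \<in> B \<Longrightarrow> v o' z = 1"
    and hU: "\<And>m q. m \<in> I - {o'} \<Longrightarrow> q \<in> I \<Longrightarrow> holo B (Um m q)"
    and ad: "\<And>k q. k \<in> I \<Longrightarrow> q \<in> I \<Longrightarrow> a k q \<in> dring B S" and bd: "\<And>k q. k \<in> I \<Longrightarrow> q \<in> I \<Longrightarrow> b k q \<in> dring B S"
    and vx: "\<And>k z. k \<in> I \<Longrightarrow> z \<in> B \<Longrightarrow> pdx (v k) z = (\<Sum>q\<in>I. a k q z * v q z)"
    and vy: "\<And>k z. k \<in> I \<Longrightarrow> z \<in> B \<Longrightarrow> pdy (v k) z = (\<Sum>q\<in>I. b k q z * v q z)"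
    and Ux: "\<And>m k z. m \<in> I - {o'} \<Longrightarrow> k \<in> I \<Longrightarrow> z \<in> B \<Longrightarrow> pdx (Um m k) z = (\<Sum>q\<in>I. a k q z * Um m q z)"
    and Uy: "\<And>m k z. m \<in> I - {o'} \<Longrightarrow> k \<in> I \<Longrightarrow> z \<in> B \<Longrightarrow> pdy (Um m k) z = (\<Sum>q\<in>I. b k q z * Um m q z)"
    and Uinv: "\<And>z t. z \<in> B \<Longrightarrow> (\<And>m. m \<in> I - {o'} \<Longrightarrow> (\<Sum>q\<in>I. t q * Um m q z) = 0) \<Longrightarrow> (\<forall>q\<in>I - {o'}. t q = 0)"
begin

text \<open>The function \<open>\<phi> m\<close> is what becomes of \<open>y\<close> when the solution \<open>v\<close> is replaced by \<open>Um m\<close>.\<close>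

definition same_coordinates where
  "same_coordinates B' S' y \<phi> \<longleftrightarrow> (\<exists>t. (\<forall>q\<in>I. t q \<in> dring B' S') \<and> (\<forall>z\<in>B'. y z = (\<Sum>q\<in>I. t q z * v q z)) \<and>
     (\<forall>m\<in>I - {o'}. \<forall>z\<in>B'. \<phi> m z = (\<Sum>q\<in>I. t q z * Um m q z)))"

text \<open>Induction on the number of indices \<open>m\<close> at which \<open>\<phi> m\<close> is not zero. If there is none, the coordinates of \<open>y\<close> other
than the one of \<open>v o' = 1\<close> vanish, and \<open>y\<close> is already in the ring. Otherwise divide \<open>y\<close> and all \<open>\<phi> m\<close> by a nonzero
\<open>\<phi> m0\<close> and apply \<open>X\<close>: the pair so obtained satisfies the same hypotheses, and its entry at \<open>m0\<close> is \<open>X 1 = 0\<close>. Once the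
new \<open>y\<close> is known, so is the differential of \<open>y / \<phi> m0\<close>, and \<open>y\<close> is reached by one quadrature.\<close>

lemma reduction_of_order:
  assumes "r > 0" "ball p r \<subseteq> B" "S \<subseteq> S'" "darboux_chain (ball p r) S0 S'" "holo (ball p r) y" "Y y \<in> dring (ball p r) S'"
    and "\<And>m. m \<in> I - {o'} \<Longrightarrow> \<phi> m \<in> dring (ball p r) S'"
    and "\<And>m z. m \<in> I - {o'} \<Longrightarrow> z \<in> ball p r \<Longrightarrow> Y (\<phi> m) z = 0"
    and "same_coordinates (ball p r) S' y \<phi>"
  shows "\<exists>p' r' S''. r' > 0 \<and> ball p' r' \<subseteq> ball p r \<and> S' \<subseteq> S'' \<and> darboux_chain (ball p' r') S0 S'' \<and> y \<in> dring (ball p' r') S''"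
  using assms
proof (induction "card {m \<in> I - {o'}. \<exists>z\<in>ball p r. \<phi> m z \<noteq> 0}" arbitrary: p r S' y \<phi> rule: less_induct)
  case less
  note r = less.prems(1) and sub = less.prems(2) and SS = less.prems(3) and ch = less.prems(4) and hy = less.prems(5)
    and Yy = less.prems(6) and \<phi>d = less.prems(7) and Y\<phi> = less.prems(8)
  have S0S': "S0 \<subseteq> S'" using S0S SS by blast
  have subU: "ball p r \<subseteq> U" using sub BU by blast
  have hS: "holo (ball p r) s" if "s \<in> S'" for s
    using darboux_chain_holo[OF ch _ that] S0_holo[OF _ subU open_ball] by blast
  obtain t where td: "\<And>q. q \<in> I \<Longrightarrow> t q \<in> dring (ball p r) S'"
    and ty: "\<And>z. z \<in> ball p r \<Longrightarrow> y z = (\<Sum>q\<in>I. t q z * v q z)"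
    and t\<phi>: "\<And>m z. m \<in> I - {o'} \<Longrightarrow> z \<in> ball p r \<Longrightarrow> \<phi> m z = (\<Sum>q\<in>I. t q z * Um m q z)"
    using less.prems(9) unfolding same_coordinates_def by blast
  show ?case
  proof (cases "\<exists>m0\<in>I - {o'}. \<exists>z0\<in>ball p r. \<phi> m0 z0 \<noteq> 0")
    case False
    have t0: "t q z = 0" if "z \<in> ball p r" "q \<in> I - {o'}" for q z
    proof -
      have "(\<Sum>q\<in>I. t q z * Um m q z) = 0" if m: "m \<in> I - {o'}" for m
        using t\<phi>[OF m \<open>z \<in> ball p r\<close>] False m \<open>z \<in> ball p r\<close> by simp
      then show ?thesis using Uinv[of z "\<lambda>q. t q z"] sub that by blast
    qed
    have "y z = t o' z" if z: "z \<in> ball p r" for z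
    proof -
      have "y z = t o' z * v o' z + (\<Sum>q\<in>I - {o'}. t q z * v q z)"
        unfolding ty[OF z] using fI oI by (simp add: sum.remove)
      also have "(\<Sum>q\<in>I - {o'}. t q z * v q z) = 0" using t0[OF z] by (intro sum.neutral) simp
      finally show ?thesis using vo[OF subsetD[OF sub z]] by simp
    qed
    then have "y \<in> dring (ball p r) S'" by (rule dring.cong[OF td[OF oI]])
    then show ?thesis using r ch by blast
  next
    case True
    then obtain m0 z0 where m0: "m0 \<in> I - {o'}" and z0: "z0 \<in> ball p r" "\<phi> m0 z0 \<noteq> 0" by blast
    have h\<phi>: "holo (ball p r) (\<phi> m)" if "m \<in> I - {o'}" for m
      by (rule dring_holo[OF \<phi>d[OF that] open_ball hS])
    obtain r1 where r1: "r1 > 0" "ball z0 r1 \<subseteq> {z \<in> ball p r. \<phi> m0 z \<noteq> 0}"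
      using open_nonzero[OF h\<phi>[OF m0]] z0 unfolding open_contains_ball by blast
    let ?B = "ball z0 r1"
    have sub1: "?B \<subseteq> ball p r" and nz: "\<phi> m0 z \<noteq> 0" if "z \<in> ?B" for z using r1(2) that by blast+
    have sub1: "?B \<subseteq> ball p r" using r1(2) by blast
    have subB: "?B \<subseteq> B" and subU1: "?B \<subseteq> U" using sub1 sub subU by blast+
    have mono: "f \<in> dring ?B S'" if "f \<in> dring (ball p r) S'" for f by (rule dring_mono[OF that sub1 order_refl])
    have hS1: "holo ?B s" if "s \<in> S'" for s by (rule holo_subset[OF hS[OF that] open_ball sub1])
    \<comment> \<open>As \<open>Y (\<phi> m0) = 0\<close>, division by \<open>\<phi> m0\<close> commutes with \<open>Y\<close>; it turns \<open>\<phi> m0\<close> into \<open>1\<close>, which \<open>X\<close> then annihilates.\<close>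
    define g where "g z = inverse (\<phi> m0 z)" for z
    have gd: "g \<in> dring ?B S'" unfolding g_def[abs_def] by (rule dring.inverse[OF mono[OF \<phi>d[OF m0]] nz])
    have hg: "holo ?B g" by (rule dring_holo[OF gd open_ball hS1])
    have hy1: "holo ?B y" by (rule holo_subset[OF hy open_ball sub1])
    have h\<phi>1: "holo ?B (\<phi> m)" if "m \<in> I - {o'}" for m by (rule holo_subset[OF h\<phi>[OF that] open_ball sub1])
    have Yg: "Y g z = 0" if z: "z \<in> ?B" for z
    proof -
      have "0 = Y (\<lambda>z. \<phi> m0 z * g z) z"
      proof -
        have "Y (\<lambda>z. \<phi> m0 z * g z) z = Y (\<lambda>z. 1) z"
          by (rule Y_cong[OF open_ball z]) (simp add: g_def nz)
        then show ?thesis by simp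
      qed
      also have "\<dots> = Y (\<phi> m0) z * g z + \<phi> m0 z * Y g z"
        unfolding Y_def by (rule vderiv_mult[OF h\<phi>1[OF m0] hg z])
      finally show ?thesis using Y\<phi>[OF m0 subsetD[OF sub1 z]] nz[OF z] by simp
    qed
    have Ygf: "Y (\<lambda>z. g z * f z) z = g z * Y f z" if "holo ?B f" "z \<in> ?B" for f z
      using vderiv_mult[OF hg that, of aY bY] Yg[OF that(2)] by (simp add: Y_def)
    define y1 where "y1 = X (\<lambda>z. g z * y z)"
    define \<phi>1 where "\<phi>1 m = X (\<lambda>z. g z * \<phi> m z)" for m
    have hgy: "holo ?B (\<lambda>z. g z * y z)" by (rule holo_mult[OF hg hy1])
    have hg\<phi>: "holo ?B (\<lambda>z. g z * \<phi> m z)" if "m \<in> I - {o'}" for m by (rule holo_mult[OF hg h\<phi>1[OF that]])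
    have gYy: "(\<lambda>z. g z * Y y z) \<in> dring ?B S'" by (rule dring.mult[OF gd mono[OF Yy]])
    have Yy1: "Y y1 \<in> dring ?B S'"
    proof (rule dring.cong)
      show "(\<lambda>z. X (\<lambda>z. g z * Y y z) z + cc z * (g z * Y y z)) \<in> dring ?B S'"
        by (intro dring.add dring.mult[OF coeffs_dring(6)] XY_dring subU1 S0S' gYy)
      fix z assume z: "z \<in> ?B"
      have "X (Y (\<lambda>z. g z * y z)) z = X (\<lambda>z. g z * Y y z) z"
        by (rule X_cong[OF open_ball z]) (rule Ygf[OF hy1])
      then show "Y y1 z = X (\<lambda>z. g z * Y y z) z + cc z * (g z * Y y z)"
        unfolding y1_def commutator[OF subU1 hgy z] Ygf[OF hy1 z] by simp
    qed
    have \<phi>1d: "\<phi>1 m \<in> dring ?B S'" if "m \<in> I - {o'}" for m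
      unfolding \<phi>1_def by (intro XY_dring subU1 S0S' dring.mult gd mono \<phi>d that)
    have Y\<phi>1: "Y (\<phi>1 m) z = 0" if m: "m \<in> I - {o'}" and z: "z \<in> ?B" for m z
    proof -
      have 0: "Y (\<lambda>z. g z * \<phi> m z) w = 0" if "w \<in> ?B" for w
        using Ygf[OF h\<phi>1[OF m] that] Y\<phi>[OF m subsetD[OF sub1 that]] by simp
      have "X (Y (\<lambda>z. g z * \<phi> m z)) z = 0"
        unfolding X_def by (rule vderiv_zero[OF open_ball z]) (rule 0)
      then show ?thesis unfolding \<phi>1_def commutator[OF subU1 hg\<phi>[OF m] z] using 0[OF z] by simp
    qed
    define t1 where "t1 q z = vderiv aX bX (\<lambda>z. g z * t q z) z + (\<Sum>k\<in>I. (g z * t k z) * (aX z * a k q z + bX z * b k q z))" for q z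
    have gtd: "(\<lambda>z. g z * t q z) \<in> dring ?B S'" if "q \<in> I" for q by (rule dring.mult[OF gd mono[OF td[OF that]]])
    have hgt: "holo ?B (\<lambda>z. g z * t q z)" if "q \<in> I" for q by (rule dring_holo[OF gtd[OF that] open_ball hS1])
    have t1d: "t1 q \<in> dring ?B S'" if q: "q \<in> I" for q
    proof -
      have ab: "a k q \<in> dring ?B S'" "b k q \<in> dring ?B S'" if "k \<in> I" for k
        using dring_mono[OF ad[OF that q] subB SS] dring_mono[OF bd[OF that q] subB SS] .
      show ?thesis unfolding t1_def[abs_def]
        by (intro dring.add vderiv_dring coeffs_dring subU1 S0S' gtd[OF q] dring_sum dring.mult[OF gtd] dring.mult ab; assumption)
    qed
    have rep1: "same_coordinates ?B S' y1 \<phi>1"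
      unfolding same_coordinates_def
    proof (intro exI[of _ t1] conjI ballI t1d)
      fix z assume z: "z \<in> ?B"
      have "y1 z = X (\<lambda>z. \<Sum>q\<in>I. (g z * t q z) * v q z) z"
        unfolding y1_def
        by (rule X_cong[OF open_ball z]) (use ty subsetD[OF sub1] in \<open>simp add: sum_distrib_left mult.assoc\<close>)
      also have "\<dots> = (\<Sum>q\<in>I. t1 q z * v q z)"
        unfolding X_def t1_def
        by (rule vderiv_linear_combination[OF fI hgt holo_subset[OF hv open_ball subB] _ _ z])
           (use vx vy subB in \<open>auto\<close>)
      finally show "y1 z = (\<Sum>q\<in>I. t1 q z * v q z)" .
    next
      fix m z assume m: "m \<in> I - {o'}" and z: "z \<in> ?B"
      have "\<phi>1 m z = X (\<lambda>z. \<Sum>q\<in>I. (g z * t q z) * Um m q z) z"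
        unfolding \<phi>1_def
        by (rule X_cong[OF open_ball z]) (use t\<phi>[OF m] subsetD[OF sub1] in \<open>simp add: sum_distrib_left mult.assoc\<close>)
      also have "\<dots> = (\<Sum>q\<in>I. t1 q z * Um m q z)"
        unfolding X_def t1_def
        by (rule vderiv_linear_combination[OF fI hgt holo_subset[OF hU[OF m] open_ball subB] _ _ z])
           (use Ux[OF m] Uy[OF m] subB in \<open>auto\<close>)
      finally show "\<phi>1 m z = (\<Sum>q\<in>I. t1 q z * Um m q z)" .
    qed
    have "card {m \<in> I - {o'}. \<exists>z\<in>?B. \<phi>1 m z \<noteq> 0} < card {m \<in> I - {o'}. \<exists>z\<in>ball p r. \<phi> m z \<noteq> 0}"
    proof (rule psubset_card_mono)
      show "finite {m \<in> I - {o'}. \<exists>z\<in>ball p r. \<phi> m z \<noteq> 0}" using fI by simp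
      have 1: "{m \<in> I - {o'}. \<exists>z\<in>?B. \<phi>1 m z \<noteq> 0} \<subseteq> {m \<in> I - {o'}. \<exists>z\<in>ball p r. \<phi> m z \<noteq> 0}"
      proof
        fix m assume "m \<in> {m \<in> I - {o'}. \<exists>z\<in>?B. \<phi>1 m z \<noteq> 0}"
        then obtain z where m: "m \<in> I - {o'}" and z: "z \<in> ?B" "\<phi>1 m z \<noteq> 0" by blast
        have "\<exists>w\<in>?B. \<phi> m w \<noteq> 0"
        proof (rule ccontr)
          assume "\<not> ?thesis"
          then have "\<phi>1 m z = 0" unfolding \<phi>1_def X_def by (intro vderiv_zero[OF open_ball z(1)]) simp
          then show False using z(2) by simp
        qed
        then show "m \<in> {m \<in> I - {o'}. \<exists>z\<in>ball p r. \<phi> m z \<noteq> 0}" using m sub1 by blast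
      qed
      have "m0 \<in> {m \<in> I - {o'}. \<exists>z\<in>ball p r. \<phi> m z \<noteq> 0}" using m0 z0 by blast
      moreover have "\<phi>1 m0 z = 0" if z: "z \<in> ?B" for z
      proof -
        have "X (\<lambda>z. g z * \<phi> m0 z) z = X (\<lambda>z. 1) z"
          by (rule X_cong[OF open_ball z]) (simp add: g_def nz)
        then show ?thesis by (simp add: \<phi>1_def)
      qed
      ultimately show "{m \<in> I - {o'}. \<exists>z\<in>?B. \<phi>1 m z \<noteq> 0} \<subset> {m \<in> I - {o'}. \<exists>z\<in>ball p r. \<phi> m z \<noteq> 0}"
        using 1 by blast
    qed
    from less.hyps[OF this r1(1) subB SS darboux_chain_mono[OF ch sub1 open_ball] _ Yy1 \<phi>1d Y\<phi>1 rep1]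
    obtain p2 r2 S2 where 2: "r2 > 0" "ball p2 r2 \<subseteq> ?B" "S' \<subseteq> S2" "darboux_chain (ball p2 r2) S0 S2" "y1 \<in> dring (ball p2 r2) S2"
      using XY_holo(1)[OF subU1 hgy] unfolding y1_def by blast
    let ?B2 = "ball p2 r2"
    have subU2: "?B2 \<subseteq> U" using 2(2) subU1 by blast
    have S02: "S0 \<subseteq> S2" using S0S' 2(3) by blast
    \<comment> \<open>The quadrature: \<open>du = y1 dF + g (Y y) w\<close> with both coefficients known.\<close>
    define u where "u z = g z * y z" for z
    have hu: "holo ?B2 u" unfolding u_def[abs_def] by (rule holo_subset[OF hgy open_ball 2(2)])
    have gens: "pdx F \<in> dring ?B2 S2" "pdy F \<in> dring ?B2 S2" "w1 \<in> dring ?B2 S2" "w2 \<in> dring ?B2 S2"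
      using S02 unfolding S0_def by (auto intro: dring.gen)
    have Yud: "(\<lambda>z. g z * Y y z) \<in> dring ?B2 S2" by (rule dring_mono[OF gYy 2(2,3)])
    have XYu: "X u z = y1 z" "Y u z = g z * Y y z" if "z \<in> ?B2" for z
      using Ygf[OF hy1 subsetD[OF 2(2) that]] by (simp_all add: u_def[abs_def] y1_def)
    have "darboux_chain ?B2 S0 (insert u S2)"
    proof (rule darboux_chain.primitive[OF 2(4) hu])
      show "(\<lambda>z. pdx F z * y1 z + w1 z * (g z * Y y z)) \<in> dring ?B2 S2"
           "(\<lambda>z. pdy F z * y1 z + w2 z * (g z * Y y z)) \<in> dring ?B2 S2"
        by (intro dring.add dring.mult[OF gens(1) 2(5)] dring.mult[OF gens(2) 2(5)] dring.mult[OF gens(3) Yud] dring.mult[OF gens(4) Yud])+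
      fix z assume z: "z \<in> ?B2"
      show "pdx u z = pdx F z * y1 z + w1 z * (g z * Y y z)" "pdy u z = pdy F z * y1 z + w2 z * (g z * Y y z)"
        using pd_XY[OF subsetD[OF subU2 z], of u] XYu[OF z] by simp_all
    qed
    moreover have "y \<in> dring ?B2 (insert u S2)"
    proof (rule dring.cong)
      have "\<phi> m0 \<in> dring ?B2 (insert u S2)"
        by (rule dring_mono[OF \<phi>d[OF m0]]) (use 2(2,3) sub1 in auto)
      then show "(\<lambda>z. \<phi> m0 z * u z) \<in> dring ?B2 (insert u S2)"
        by (rule dring.mult) (rule dring.gen, simp)
      show "y z = \<phi> m0 z * u z" if "z \<in> ?B2" for z
        using nz[OF subsetD[OF 2(2) that]] by (simp add: u_def g_def)
    qed
    moreover have "?B2 \<subseteq> ball p r" using 2(2) sub1 by blast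
    moreover have "S' \<subseteq> insert u S2" using 2(3) by blast
    ultimately show ?thesis using 2(1) by blast
  qed
qed

end

text \<open>Take a spanning subfamily containing \<open>o'\<close> of least cardinality over all smaller balls. In a relation with a
coefficient that is nonzero somewhere, at an index other than \<open>o'\<close>, that member could be dropped near that point; so
only the coefficient of \<open>v o' = 1\<close> is left, and it vanishes too.\<close>

lemma minimal_span:
  fixes v :: "'j \<Rightarrow> C2 \<Rightarrow> complex"
  assumes J: "finite J" "o' \<in> J" and vo: "\<And>z. v o' z = 1" and r: "r > 0"
    and S: "\<And>s. s \<in> S \<Longrightarrow> holo (ball p r) s"
  shows "\<exists>I p' r'. o' \<in> I \<and> I \<subseteq> J \<and> r' > 0 \<and> ball p' r' \<subseteq> ball p r \<and>
    (\<forall>j\<in>J. v j \<in> lspan (ball p' r') S v I) \<and>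
    (\<forall>a p'' r''. r'' > 0 \<longrightarrow> ball p'' r'' \<subseteq> ball p' r' \<longrightarrow> (\<forall>q\<in>I. a q \<in> dring (ball p'' r'') S) \<longrightarrow>
       (\<forall>z\<in>ball p'' r''. (\<Sum>q\<in>I. a q z * v q z) = 0) \<longrightarrow> (\<forall>q\<in>I. \<forall>z\<in>ball p'' r''. a q z = 0))"
proof -
  define Q where "Q n \<longleftrightarrow> (\<exists>I p' r'. card I = n \<and> o' \<in> I \<and> I \<subseteq> J \<and> r' > 0 \<and> ball p' r' \<subseteq> ball p r \<and>
    (\<forall>j\<in>J. v j \<in> lspan (ball p' r') S v I))" for n
  have "Q (card J)" unfolding Q_def
    by (intro exI[of _ J] exI[of _ p] exI[of _ r]) (use J r in \<open>auto intro: lspan_gen\<close>)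
  then have QL: "Q (LEAST n. Q n)" by (rule LeastI)
  obtain I p' r' where I: "card I = (LEAST n. Q n)" "o' \<in> I" "I \<subseteq> J" and r': "r' > 0" "ball p' r' \<subseteq> ball p r"
    and sp: "\<And>j. j \<in> J \<Longrightarrow> v j \<in> lspan (ball p' r') S v I" using QL unfolding Q_def by blast
  have fI: "finite I" using I(3) J(1) finite_subset by blast
  have ind: "\<forall>q\<in>I. \<forall>z\<in>ball p'' r''. a q z = 0"
    if r'': "r'' > 0" and sub: "ball p'' r'' \<subseteq> ball p' r'" and a: "\<And>q. q \<in> I \<Longrightarrow> a q \<in> dring (ball p'' r'') S"
      and z: "\<And>z. z \<in> ball p'' r'' \<Longrightarrow> (\<Sum>q\<in>I. a q z * v q z) = 0" for a p'' r''
  proof -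
    have subr: "ball p'' r'' \<subseteq> ball p r" using sub r'(2) by blast
    have ha: "holo (ball p'' r'') (a q)" if "q \<in> I" for q
      by (rule dring_holo[OF a[OF that] open_ball]) (rule holo_subset[OF S open_ball subr])
    have other: "a q z = 0" if q: "q \<in> I" "q \<noteq> o'" and zB: "z \<in> ball p'' r''" for q z
    proof (rule ccontr)
      assume nz: "a q z \<noteq> 0"
      obtain r3 where r3: "r3 > 0" "ball z r3 \<subseteq> {w \<in> ball p'' r''. a q w \<noteq> 0}"
        using open_nonzero[OF ha[OF q(1)]] nz zB unfolding open_contains_ball by blast
      let ?B = "ball z r3" and ?I = "I - {q}"
      have sub3: "?B \<subseteq> ball p'' r''" and nz3: "\<And>w. w \<in> ?B \<Longrightarrow> a q w \<noteq> 0" using r3(2) by blast+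
      have a3: "a k \<in> dring ?B S" if "k \<in> I" for k by (rule dring_mono[OF a[OF that] sub3 order_refl])
      have vq: "v q \<in> lspan ?B S v ?I"
      proof (rule lspanI[of _ "\<lambda>k w. - (a k w / a q w)"])
        show "(\<lambda>w. - (a k w / a q w)) \<in> dring ?B S" if "k \<in> ?I" for k
          using that by (intro dring_uminus dring_divide a3 q(1) nz3) auto
        fix w assume w: "w \<in> ?B"
        have "0 = a q w * v q w + (\<Sum>k\<in>?I. a k w * v k w)"
          using z[OF subsetD[OF sub3 w]] fI q(1) by (simp add: sum.remove)
        then have "a q w * v q w = - (\<Sum>k\<in>?I. a k w * v k w)" by (metis add.inverse_inverse add_eq_0_iff)
        then have "v q w = - (\<Sum>k\<in>?I. a k w * v k w) / a q w" using nz3[OF w] by (metis nonzero_mult_div_cancel_left)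
        also have "\<dots> = (\<Sum>k\<in>?I. - (a k w / a q w) * v k w)"
          by (simp add: sum_negf sum_divide_distrib)
        finally show "v q w = (\<Sum>k\<in>?I. - (a k w / a q w) * v k w)" .
      qed
      have vI: "v k \<in> lspan ?B S v ?I" if "k \<in> I" for k
        using vq lspan_gen[of ?I k v ?B S] fI that by (cases "k = q") auto
      have "v j \<in> lspan ?B S v ?I" if "j \<in> J" for j
        by (rule lspan_trans[OF lspan_mono[OF sp[OF that]] vI]) (use sub3 sub in auto)
      moreover have "?B \<subseteq> ball p r" using sub3 subr by blast
      ultimately have "Q (card ?I)" unfolding Q_def
        by (intro exI[of _ ?I] exI[of _ z] exI[of _ r3]) (use I q r3 in auto)
      then have "(LEAST n. Q n) \<le> card ?I" by (rule Least_le)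
      moreover have "card ?I < card I" using fI q(1) by (rule card_Diff1_less)
      ultimately show False using I(1) by simp
    qed
    have "a o' z = 0" if zB: "z \<in> ball p'' r''" for z
    proof -
      have "0 = a o' z * v o' z + (\<Sum>k\<in>I - {o'}. a k z * v k z)"
        using z[OF zB] fI I(2) by (simp add: sum.remove)
      also have "(\<Sum>k\<in>I - {o'}. a k z * v k z) = 0" using other zB by (intro sum.neutral) auto
      finally show ?thesis using vo by simp
    qed
    then show ?thesis using other by blast
  qed
  have "\<forall>a p'' r''. r'' > 0 \<longrightarrow> ball p'' r'' \<subseteq> ball p' r' \<longrightarrow> (\<forall>q\<in>I. a q \<in> dring (ball p'' r'') S) \<longrightarrow>
       (\<forall>z\<in>ball p'' r''. (\<Sum>q\<in>I. a q z * v q z) = 0) \<longrightarrow> (\<forall>q\<in>I. \<forall>z\<in>ball p'' r''. a q z = 0)"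
  proof (intro allI impI)
    fix a p'' r'' assume *: "r'' > 0" "ball p'' r'' \<subseteq> ball p' r'" "\<forall>q\<in>I. a q \<in> dring (ball p'' r'') S"
       "\<forall>z\<in>ball p'' r''. (\<Sum>q\<in>I. a q z * v q z) = 0"
    show "\<forall>q\<in>I. \<forall>z\<in>ball p'' r''. a q z = 0"
      by (rule ind[OF *(1,2) bspec[OF *(3)] bspec[OF *(4)]])
  qed
  then show ?thesis using I(2,3) r' sp by (intro exI[of _ I] exI[of _ p'] exI[of _ r'] conjI ballI)
qed

section \<open>Coefficients of polynomial first integrals by quadratures\<close>

text \<open>Diagonal dominance: look at the equation of an index at which \<open>norm (t q)\<close> is largest.\<close>

lemma near_identity_injective:
  fixes M :: "'j \<Rightarrow> 'j \<Rightarrow> complex"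
  assumes I: "finite I" and near: "\<And>m q. m \<in> I \<Longrightarrow> q \<in> I \<Longrightarrow> norm (M m q - (if q = m then 1 else 0)) * (card I + 1) \<le> 1"
    and z: "\<And>m. m \<in> I \<Longrightarrow> (\<Sum>q\<in>I. t q * M m q) = 0"
  shows "\<forall>q\<in>I. t q = 0"
proof (cases "I = {}")
  case False
  let ?n = "real (card I)"
  have fin: "finite ((\<lambda>q. norm (t q)) ` I)" "(\<lambda>q. norm (t q)) ` I \<noteq> {}" using I False by simp_all
  obtain m where m0: "m \<in> I" "Max ((\<lambda>q. norm (t q)) ` I) = norm (t m)" using Max_in[OF fin] by blast
  have m: "m \<in> I" "\<And>q. q \<in> I \<Longrightarrow> norm (t q) \<le> norm (t m)"
    using m0 Max_ge[OF fin(1)] by (simp_all flip: m0(2))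
  have near': "norm (M m q - (if q = m then 1 else 0)) * (?n + 1) \<le> 1" if "q \<in> I" for q
    using near[OF m(1) that] by (simp add: add.commute)
  have "(\<Sum>q\<in>I. t q * (if q = m then 1 else 0)) = (\<Sum>q\<in>I. if q = m then t q else 0)"
    by (intro sum.cong) simp_all
  then have "t m = (\<Sum>q\<in>I. t q * (if q = m then 1 else 0))" using I m(1) by simp
  also have "\<dots> = (\<Sum>q\<in>I. t q * (if q = m then 1 else 0)) - (\<Sum>q\<in>I. t q * M m q)" using z[OF m(1)] by simp
  also have "\<dots> = (\<Sum>q\<in>I. t q * ((if q = m then 1 else 0) - M m q))"
    by (simp add: sum_subtractf right_diff_distrib)
  finally have "norm (t m) * (?n + 1) = norm (\<Sum>q\<in>I. t q * ((if q = m then 1 else 0) - M m q)) * (?n + 1)" by simp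
  also have "\<dots> \<le> (\<Sum>q\<in>I. norm (t q * ((if q = m then 1 else 0) - M m q))) * (?n + 1)"
    by (intro mult_right_mono norm_sum) simp
  also have "\<dots> = (\<Sum>q\<in>I. norm (t q) * (norm (M m q - (if q = m then 1 else 0)) * (?n + 1)))"
    by (simp add: sum_distrib_right norm_mult norm_minus_commute mult.assoc)
  also have "\<dots> \<le> (\<Sum>q\<in>I. norm (t m) * 1)"
    by (intro sum_mono mult_mono m(2) near') simp_all
  also have "\<dots> = norm (t m) * ?n" by simp
  finally have "norm (t m) \<le> 0" by (simp add: distrib_left)
  then show ?thesis using m(2) by fastforce
qed simp

context pencil begin

text \<open>The ball shrinks at each use of \<open>leading_algebraic\<close>, so finitely many coefficients are adjoined one by one.\<close>

lemma adjoin_leading_coeffs: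
  assumes P: "pencil_integral B0 N P" and PF: "\<And>z. z \<in> B0 \<Longrightarrow> coeff (P z) 0 = F z"
    and M: "finite M"
  shows "r > 0 \<Longrightarrow> ball p r \<subseteq> B0 \<Longrightarrow> darboux_chain (ball p r) S0 S \<Longrightarrow> F \<in> dring (ball p r) S \<Longrightarrow>
    (\<And>m. m \<in> M \<Longrightarrow> pencil_integral (ball p r) N (g m)) \<Longrightarrow>
    \<exists>p' r'. r' > 0 \<and> ball p' r' \<subseteq> ball p r \<and> darboux_chain (ball p' r') S0 (S \<union> (\<lambda>m z. coeff (g m z) 0) ` M)"
  using M
proof (induction M arbitrary: p r rule: finite_induct)
  case empty
  then show ?case by (intro exI[of _ p] exI[of _ r]) simp
next
  case (insert m M)
  have "pencil_integral (ball p r) N (g m)" if "m \<in> M" for m using insert.prems(5) that by blast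
  from insert.IH[OF insert.prems(1-4) this]
  obtain p1 r1 where 1: "r1 > 0" "ball p1 r1 \<subseteq> ball p r" "darboux_chain (ball p1 r1) S0 (S \<union> (\<lambda>m z. coeff (g m z) 0) ` M)" by blast
  let ?S = "S \<union> (\<lambda>m z. coeff (g m z) 0) ` M"
  have P1: "pencil_integral (ball p1 r1) N P" by (rule pencil_integral_mono[OF P open_ball]) (use 1(2) insert.prems(2) in auto)
  have g1: "pencil_integral (ball p1 r1) N (g m)" by (rule pencil_integral_mono[OF insert.prems(5) open_ball 1(2)]) auto
  have PF1: "coeff (P z) 0 = F z" if "z \<in> ball p1 r1" for z
    by (rule PF) (use 1(2) insert.prems(2) that in blast)
  obtain p2 r2 n c where *: "r2 > 0 \<and> ball p2 r2 \<subseteq> ball p1 r1 \<and> n \<ge> (1::nat) \<and> (\<forall>i\<le>n. c i \<in> dring (ball p2 r2) {F}) \<and>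
     (\<forall>z\<in>ball p2 r2. c n z \<noteq> 0) \<and> (\<forall>z\<in>ball p2 r2. (\<Sum>i\<le>n. c i z * coeff (g m z) 0 ^ i) = 0)"
    using leading_algebraic[OF P1 g1 1(1) PF1] by blast
  then have 2: "r2 > 0" "ball p2 r2 \<subseteq> ball p1 r1" "n \<ge> (1::nat)" "\<And>i. i \<le> n \<Longrightarrow> c i \<in> dring (ball p2 r2) {F}"
     "\<And>z. z \<in> ball p2 r2 \<Longrightarrow> c n z \<noteq> 0" "\<And>z. z \<in> ball p2 r2 \<Longrightarrow> (\<Sum>i\<le>n. c i z * coeff (g m z) 0 ^ i) = 0"
    by blast+
  have sub2: "ball p2 r2 \<subseteq> ball p r" using 2(2) 1(2) by blast
  have F2: "{F} \<subseteq> dring (ball p2 r2) ?S"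
    using dring_mono[OF insert.prems(4) sub2, of ?S] by blast
  have "darboux_chain (ball p2 r2) S0 (insert (\<lambda>z. coeff (g m z) 0) ?S)"
  proof (rule darboux_chain.algebraic[OF darboux_chain_mono[OF 1(3) 2(2) open_ball] _ 2(3) _ 2(5,6)])
    show "holo (ball p2 r2) (\<lambda>z. coeff (g m z) 0)"
      using pencil_integral_mono[OF g1 open_ball 2(2) order_refl] unfolding pencil_integral_def by blast
    show "c i \<in> dring (ball p2 r2) ?S" if "i \<le> n" for i by (rule dring_trans[OF 2(4)[OF that] F2])
  qed
  then show ?case using 2(1) sub2 by (intro exI[of _ p2] exI[of _ r2]) simp
qed

text \<open>The induction step. Over the ring of the known functions, \<open>1\<close> and the jets of \<open>P\<close> are spanned by an independent
subfamily \<open>v\<close>, which satisfies a Pfaffian system. Independence makes the system flat and lets every identity between the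
coefficients of \<open>P\<close> be read off on coordinates. The solutions \<open>Um m\<close> start at the unit vectors other than the one of
\<open>1\<close>; their entry at \<open>1\<close> is constant, hence zero. Substituting \<open>Um m\<close> for \<open>v\<close> turns \<open>P\<close> into a first integral \<open>h m\<close> in
which the known coefficients have become zero, so its coefficient of index \<open>i\<close> is the constant coefficient of a first
integral and thus algebraic. These algebraic functions are the input of \<open>reduction_of_order\<close>.\<close>

lemma adjoin_next_coeff:
  assumes P: "pencil_integral B0 N P" and PF: "\<And>z. z \<in> B0 \<Longrightarrow> coeff (P z) 0 = F z"
    and r: "r > 0" and sub0: "ball p r \<subseteq> B0" and ch: "darboux_chain (ball p r) S0 S"
    and known: "\<And>k. k < i \<Longrightarrow> (\<lambda>z. coeff (P z) k) \<in> dring (ball p r) S" and i: "i \<ge> 1"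
  shows "\<exists>p' r' S'. r' > 0 \<and> ball p' r' \<subseteq> ball p r \<and> S \<subseteq> S' \<and> darboux_chain (ball p' r') S0 S' \<and>
     (\<lambda>z. coeff (P z) i) \<in> dring (ball p' r') S'"
proof -
  have B0U: "B0 \<subseteq> U" using P unfolding pencil_integral_def by blast
  have subU: "ball p r \<subseteq> U" using sub0 B0U by blast
  have S0S: "S0 \<subseteq> S" by (rule darboux_chain_sub[OF ch])
  have hS: "holo (ball p r) s" if "s \<in> S" for s
    using darboux_chain_holo[OF ch _ that] S0_holo[OF _ subU open_ball] by blast
  define c where "c k = (\<lambda>z. coeff (P z) k)" for k
  define J where "J = insert None (Some ` jet_indices N)"
  define v where "v = case_option (\<lambda>z::C2. 1::complex) (jet P)"
  have fJ: "finite J" using finite_jet_indices by (simp add: J_def)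
  have vN: "v None z = 1" for z by (simp add: v_def)
  have vS: "v (Some q) = jet P q" for q by (simp add: v_def)
  have "None \<in> J" by (simp add: J_def)
  then have "\<exists>I p1 r1. None \<in> I \<and> I \<subseteq> J \<and> r1 > 0 \<and> ball p1 r1 \<subseteq> ball p r \<and>
    (\<forall>j\<in>J. v j \<in> lspan (ball p1 r1) S v I) \<and>
    (\<forall>a p'' r''. r'' > 0 \<longrightarrow> ball p'' r'' \<subseteq> ball p1 r1 \<longrightarrow> (\<forall>q\<in>I. a q \<in> dring (ball p'' r'') S) \<longrightarrow>
       (\<forall>z\<in>ball p'' r''. (\<Sum>q\<in>I. a q z * v q z) = 0) \<longrightarrow> (\<forall>q\<in>I. \<forall>z\<in>ball p'' r''. a q z = 0))"
    by (rule minimal_span[where v = v, OF fJ _ vN r hS])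
  then obtain I p1 r1 where main: "None \<in> I \<and> I \<subseteq> J \<and> r1 > 0 \<and> ball p1 r1 \<subseteq> ball p r \<and>
    (\<forall>j\<in>J. v j \<in> lspan (ball p1 r1) S v I) \<and>
    (\<forall>a p'' r''. r'' > 0 \<longrightarrow> ball p'' r'' \<subseteq> ball p1 r1 \<longrightarrow> (\<forall>q\<in>I. a q \<in> dring (ball p'' r'') S) \<longrightarrow>
       (\<forall>z\<in>ball p'' r''. (\<Sum>q\<in>I. a q z * v q z) = 0) \<longrightarrow> (\<forall>q\<in>I. \<forall>z\<in>ball p'' r''. a q z = 0))"
    by (elim exE) (rule that)
  have oI: "None \<in> I" by (rule main[THEN conjunct1])
  have IJ: "I \<subseteq> J" by (rule main[THEN conjunct2, THEN conjunct1])
  have r1: "r1 > 0" by (rule main[THEN conjunct2, THEN conjunct2, THEN conjunct1])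
  have sub1: "ball p1 r1 \<subseteq> ball p r" by (rule main[THEN conjunct2, THEN conjunct2, THEN conjunct2, THEN conjunct1])
  have sp: "v j \<in> lspan (ball p1 r1) S v I" if "j \<in> J" for j
    by (rule bspec[OF main[THEN conjunct2, THEN conjunct2, THEN conjunct2, THEN conjunct2, THEN conjunct1] that])
  note ind = main[THEN conjunct2, THEN conjunct2, THEN conjunct2, THEN conjunct2, THEN conjunct2]
  let ?B1 = "ball p1 r1"
  have fI: "finite I" using IJ fJ finite_subset by blast
  have sub1U: "?B1 \<subseteq> U" and sub10: "?B1 \<subseteq> B0" using sub1 subU sub0 by blast+
  have P1: "pencil_integral ?B1 N P" by (rule pencil_integral_mono[OF P open_ball sub10 order_refl])
  have hS1: "holo ?B1 s" if "s \<in> S" for s by (rule holo_subset[OF hS[OF that] open_ball sub1])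
  have hd1: "holo ?B1 f" if "f \<in> dring ?B1 S" for f by (rule dring_holo[OF that open_ball hS1])
  have hv: "holo ?B1 (v q)" for q
    by (cases q) (simp_all add: v_def holo_const jet_holo[OF P1])
  have vpd: "pdx (v j) \<in> lspan ?B1 S v I" "pdy (v j) \<in> lspan ?B1 S v I" if "j \<in> J" for j
  proof -
    have tr: "f \<in> lspan ?B1 S v I" if f: "f \<in> lspan ?B1 S0 (jet P) (jet_indices N)" for f
    proof (rule lspan_trans[OF lspan_mono[OF f order_refl S0S]])
      fix q assume "q \<in> jet_indices N"
      then show "jet P q \<in> lspan ?B1 S v I" using sp[of "Some q"] by (simp add: J_def vS)
    qed
    show "pdx (v j) \<in> lspan ?B1 S v I" "pdy (v j) \<in> lspan ?B1 S v I"
      using that jet_closed_pd[OF P1] tr by (auto simp: J_def v_def intro: lspan_zero)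
  qed
  have "\<forall>j\<in>I. \<exists>a. (\<forall>k\<in>I. a k \<in> dring ?B1 S) \<and> (\<forall>z\<in>?B1. pdx (v j) z = (\<Sum>k\<in>I. a k z * v k z))"
    using vpd(1) IJ unfolding lspan_def by blast
  from bchoice[OF this] obtain a where
    a: "\<forall>j\<in>I. (\<forall>k\<in>I. a j k \<in> dring ?B1 S) \<and> (\<forall>z\<in>?B1. pdx (v j) z = (\<Sum>k\<in>I. a j k z * v k z))" ..
  have "\<forall>j\<in>I. \<exists>b. (\<forall>k\<in>I. b k \<in> dring ?B1 S) \<and> (\<forall>z\<in>?B1. pdy (v j) z = (\<Sum>k\<in>I. b k z * v k z))"
    using vpd(2) IJ unfolding lspan_def by blast
  from bchoice[OF this] obtain b where
    b: "\<forall>j\<in>I. (\<forall>k\<in>I. b j k \<in> dring ?B1 S) \<and> (\<forall>z\<in>?B1. pdy (v j) z = (\<Sum>k\<in>I. b j k z * v k z))" ..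
  have ad: "a j k \<in> dring ?B1 S" and bd: "b j k \<in> dring ?B1 S" if "j \<in> I" "k \<in> I" for j k using a b that by blast+
  have vx: "pdx (v j) z = (\<Sum>k\<in>I. a j k z * v k z)" and vy: "pdy (v j) z = (\<Sum>k\<in>I. b j k z * v k z)"
    if "j \<in> I" "z \<in> ?B1" for j z using a b that by blast+
  have ind1: "t q z = 0" if "\<And>q. q \<in> I \<Longrightarrow> t q \<in> dring ?B1 S" "\<And>z. z \<in> ?B1 \<Longrightarrow> (\<Sum>q\<in>I. t q z * v q z) = 0" "q \<in> I" "z \<in> ?B1" for t q z
    by (rule ind[rule_format, OF r1 order_refl that])
  have aN: "a None k z = 0" if "k \<in> I" "z \<in> ?B1" for k z
    by (rule ind1[OF ad[OF oI] _ that]) (use vx[OF oI] in \<open>simp_all add: v_def\<close>)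
  have bN: "b None k z = 0" if "k \<in> I" "z \<in> ?B1" for k z
    by (rule ind1[OF bd[OF oI] _ that]) (use vy[OF oI] in \<open>simp_all add: v_def\<close>)
  \<comment> \<open>If \<open>t\<close> is the coordinate vector of \<open>f\<close>, then \<open>dc \<alpha> \<beta> t\<close> is one of its derivative, see \<open>Dv\<close>.\<close>
  define dc where "dc \<alpha> \<beta> t q z = vderiv \<alpha> \<beta> (t q) z + (\<Sum>k\<in>I. t k z * (\<alpha> z * a k q z + \<beta> z * b k q z))" for \<alpha> \<beta> t q z
  have dcd: "dc \<alpha> \<beta> t q \<in> dring ?B1 S" if "\<alpha> \<in> dring ?B1 S" "\<beta> \<in> dring ?B1 S" "\<And>q. q \<in> I \<Longrightarrow> t q \<in> dring ?B1 S" "q \<in> I" for \<alpha> \<beta> t q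
    unfolding dc_def[abs_def]
    by (intro dring.add vderiv_dring dring_sum dring.mult that ad bd; assumption)
  have Dv: "vderiv \<alpha> \<beta> f z = (\<Sum>q\<in>I. dc \<alpha> \<beta> t q z * v q z)"
    if t: "\<And>q. q \<in> I \<Longrightarrow> t q \<in> dring ?B1 S" and f: "\<And>z. z \<in> ?B1 \<Longrightarrow> f z = (\<Sum>q\<in>I. t q z * v q z)" and z: "z \<in> ?B1"
    for \<alpha> \<beta> t f z
  proof -
    have "vderiv \<alpha> \<beta> f z = vderiv \<alpha> \<beta> (\<lambda>z. \<Sum>q\<in>I. t q z * v q z) z" by (rule vderiv_cong[OF open_ball z f])
    also have "\<dots> = (\<Sum>q\<in>I. dc \<alpha> \<beta> t q z * v q z)" unfolding dc_def
      by (rule vderiv_linear_combination[OF fI hd1[OF t] hv vx vy z])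
    finally show ?thesis .
  qed
  have one: "(\<lambda>z. 1) \<in> dring ?B1 S" and zero: "(\<lambda>z. 0) \<in> dring ?B1 S" by (rule dring.const)+
  have flat: "pdy (a j k) z + (\<Sum>i\<in>I. a j i z * b i k z) = pdx (b j k) z + (\<Sum>i\<in>I. b j i z * a i k z)"
    if j: "j \<in> I" and k: "k \<in> I" and z: "z \<in> ?B1" for j k z
  proof -
    let ?e = "\<lambda>q z. dc (\<lambda>z. 0) (\<lambda>z. 1) (a j) q z - dc (\<lambda>z. 1) (\<lambda>z. 0) (b j) q z"
    have "?e k z = 0"
    proof (rule ind1[OF _ _ k z])
      show "?e q \<in> dring ?B1 S" if "q \<in> I" for q
        by (intro dring.diff dcd one zero ad bd j that)
      fix w assume w: "w \<in> ?B1"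
      have "pdy (pdx (v j)) w = (\<Sum>q\<in>I. dc (\<lambda>z. 0) (\<lambda>z. 1) (a j) q w * v q w)"
        using Dv[OF ad[OF j] vx[OF j] w, of "\<lambda>z. 0" "\<lambda>z. 1"] by (simp add: vderiv_pdy)
      moreover have "pdx (pdy (v j)) w = (\<Sum>q\<in>I. dc (\<lambda>z. 1) (\<lambda>z. 0) (b j) q w * v q w)"
        using Dv[OF bd[OF j] vy[OF j] w, of "\<lambda>z. 1" "\<lambda>z. 0"] by (simp add: vderiv_pdx)
      ultimately show "(\<Sum>q\<in>I. ?e q w * v q w) = 0"
        using pd_commute[OF hv w, of j] by (simp add: left_diff_distrib sum_subtractf)
    qed
    then show ?thesis by (simp add: dc_def vderiv_def)
  qed
  let ?I = "I - {None}"
  have fI': "finite ?I" using fI by simp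
  have p1: "p1 \<in> ?B1" using r1 by simp
  have "\<forall>m\<in>?I. \<exists>su. 0 < fst su \<and> ball p1 (fst su) \<subseteq> ?B1 \<and> (\<forall>j\<in>I. holo (ball p1 (fst su)) (snd su j) \<and> snd su j p1 = (if j = m then 1 else 0) \<and>
     (\<forall>z\<in>ball p1 (fst su). pdx (snd su j) z = (\<Sum>k\<in>I. a j k z * snd su k z) \<and> pdy (snd su j) z = (\<Sum>k\<in>I. b j k z * snd su k z)))"
  proof
    fix m assume "m \<in> ?I"
    obtain s u where "0 < s \<and> ball p1 s \<subseteq> ?B1 \<and> (\<forall>j\<in>I. holo (ball p1 s) (u j) \<and> u j p1 = (if j = m then 1 else 0) \<and>
     (\<forall>z\<in>ball p1 s. pdx (u j) z = (\<Sum>k\<in>I. a j k z * u k z) \<and> pdy (u j) z = (\<Sum>k\<in>I. b j k z * u k z)))"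
      using frobenius_linear[OF fI open_ball p1 hd1[OF ad] hd1[OF bd] flat, of "\<lambda>j. if j = m then 1 else 0"] by blast
    then show "\<exists>su. 0 < fst su \<and> ball p1 (fst su) \<subseteq> ?B1 \<and> (\<forall>j\<in>I. holo (ball p1 (fst su)) (snd su j) \<and> snd su j p1 = (if j = m then 1 else 0) \<and>
     (\<forall>z\<in>ball p1 (fst su). pdx (snd su j) z = (\<Sum>k\<in>I. a j k z * snd su k z) \<and> pdy (snd su j) z = (\<Sum>k\<in>I. b j k z * snd su k z)))"
      by (intro exI[of _ "(s, u)"]) (unfold fst_conv snd_conv, assumption)
  qed
  from bchoice[OF this] obtain su where su: "\<forall>m\<in>?I. 0 < fst (su m) \<and> ball p1 (fst (su m)) \<subseteq> ?B1 \<and> (\<forall>j\<in>I. holo (ball p1 (fst (su m))) (snd (su m) j) \<and> snd (su m) j p1 = (if j = m then 1 else 0) \<and>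
     (\<forall>z\<in>ball p1 (fst (su m)). pdx (snd (su m) j) z = (\<Sum>k\<in>I. a j k z * snd (su m) k z) \<and> pdy (snd (su m) j) z = (\<Sum>k\<in>I. b j k z * snd (su m) k z)))" ..
  define Um where "Um m = snd (su m)" for m
  define s0 where "s0 = Min (insert r1 ((\<lambda>m. fst (su m)) ` ?I))"
  have "\<forall>m\<in>?I. 0 < fst (su m)" using su by blast
  then have s0: "s0 > 0" unfolding s0_def using fI' r1 by (subst Min_gr_iff) simp_all
  have s0r: "s0 \<le> r1" and s0m: "m \<in> ?I \<Longrightarrow> s0 \<le> fst (su m)" for m
    unfolding s0_def using fI' by (auto intro: Min_le)
  have hU0: "holo (ball p1 s0) (Um m j)" and Up: "Um m j p1 = (if j = m then 1 else 0)"
    and Ux0: "z \<in> ball p1 s0 \<Longrightarrow> pdx (Um m j) z = (\<Sum>k\<in>I. a j k z * Um m k z)"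
    and Uy0: "z \<in> ball p1 s0 \<Longrightarrow> pdy (Um m j) z = (\<Sum>k\<in>I. b j k z * Um m k z)"
    if m: "m \<in> ?I" and j: "j \<in> I" for m j z
  proof -
    have sub: "ball p1 s0 \<subseteq> ball p1 (fst (su m))" using s0m[OF m] by (rule subset_ball)
    have su': "holo (ball p1 (fst (su m))) (Um m j)" "Um m j p1 = (if j = m then 1 else 0)"
      "\<And>z. z \<in> ball p1 (fst (su m)) \<Longrightarrow> pdx (Um m j) z = (\<Sum>k\<in>I. a j k z * Um m k z)"
      "\<And>z. z \<in> ball p1 (fst (su m)) \<Longrightarrow> pdy (Um m j) z = (\<Sum>k\<in>I. b j k z * Um m k z)"
      using su m j unfolding Um_def by blast+
    show "holo (ball p1 s0) (Um m j)" by (rule holo_subset[OF su'(1) open_ball sub])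
    show "Um m j p1 = (if j = m then 1 else 0)" by (rule su'(2))
    show "pdx (Um m j) z = (\<Sum>k\<in>I. a j k z * Um m k z)" "pdy (Um m j) z = (\<Sum>k\<in>I. b j k z * Um m k z)" if "z \<in> ball p1 s0"
      using su'(3,4)[OF subsetD[OF sub that]] by blast+
  qed
  have s0B: "ball p1 s0 \<subseteq> ?B1" using s0r by (rule subset_ball)
  have UN: "Um m None z = 0" if m: "m \<in> ?I" and z: "z \<in> ball p1 s0" for m z
  proof -
    have "(Um m None has_derivative (\<lambda>k. 0)) (at w within ball p1 s0)" if w: "w \<in> ball p1 s0" for w
    proof -
      have "pdx (Um m None) w = 0" "pdy (Um m None) w = 0"
        unfolding Ux0[OF m oI w] Uy0[OF m oI w] using aN bN subsetD[OF s0B w] by simp_all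
      then have "(Um m None has_derivative (\<lambda>k. 0)) (at w)"
        using holo_hasd[OF hU0[OF m oI] w] by (simp add: hasd_def)
      then show ?thesis by (rule has_derivative_at_withinI)
    qed
    then obtain e where "\<forall>w\<in>ball p1 s0. Um m None w = e"
      using has_derivative_zero_constant[OF convex_ball] by blast
    moreover have "p1 \<in> ball p1 s0" using s0 by simp
    ultimately have "Um m None z = Um m None p1" using z by simp
    then show ?thesis using Up[OF m oI] m by auto
  qed
  \<comment> \<open>Near \<open>p1\<close> the matrix of the \<open>Um m\<close> is close to its initial value, the identity.\<close>
  have "\<forall>\<^sub>F z in nhds p1. \<forall>x\<in>?I \<times> ?I. norm (Um (fst x) (snd x) z - (if snd x = fst x then 1 else 0)) * (card ?I + 1) < 1"
  proof (rule eventually_ball_finite)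
    show "finite (?I \<times> ?I)" using fI' by simp
    show "\<forall>x\<in>?I \<times> ?I. \<forall>\<^sub>F z in nhds p1. norm (Um (fst x) (snd x) z - (if snd x = fst x then 1 else 0)) * (card ?I + 1) < 1"
    proof
      fix x assume x: "x \<in> ?I \<times> ?I"
      let ?f = "\<lambda>z. norm (Um (fst x) (snd x) z - (if snd x = fst x then 1 else 0)) * (card ?I + 1)"
      have hol: "holo (ball p1 s0) (Um (fst x) (snd x))" using hU0 x by auto
      have "continuous_on (ball p1 s0) ?f"
        by (intro continuous_intros holo_continuous_on[OF hol])
      then have op: "open (ball p1 s0 \<inter> ?f -` {..<1})"
        by (rule continuous_open_preimage[OF _ open_ball open_lessThan])
      have "Um (fst x) (snd x) p1 = (if snd x = fst x then 1 else 0)" using Up x by auto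
      then have "p1 \<in> ball p1 s0 \<inter> ?f -` {..<1}" using s0 by simp
      from eventually_nhds_in_open[OF op this]
      show "\<forall>\<^sub>F z in nhds p1. ?f z < 1" by (rule eventually_mono) simp
    qed
  qed
  then obtain s1 where s1: "s1 > 0" and s1': "\<forall>z. dist z p1 < s1 \<longrightarrow> (\<forall>x\<in>?I \<times> ?I.
      norm (Um (fst x) (snd x) z - (if snd x = fst x then 1 else 0)) * (card ?I + 1) < 1)"
    unfolding eventually_nhds_metric by blast
  have near: "norm (Um m q z - (if q = m then 1 else 0)) * (card ?I + 1) \<le> 1"
    if "z \<in> ball p1 s1" "m \<in> ?I" "q \<in> ?I" for z m q
  proof -
    have "dist z p1 < s1" using that(1) by (simp add: dist_commute)
    moreover have "(m, q) \<in> ?I \<times> ?I" using that(2,3) by blast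
    ultimately show ?thesis using s1'[rule_format, of z "(m, q)"] unfolding fst_conv snd_conv by (intro less_imp_le)
  qed
  define s where "s = min s0 s1"
  have s: "s > 0" using s0 s1 by (simp add: s_def)
  let ?B = "ball p1 s"
  have Bs0: "?B \<subseteq> ball p1 s0" and Bs1: "?B \<subseteq> ball p1 s1" by (rule subset_ball, simp add: s_def)+
  have B1: "?B \<subseteq> ?B1" using Bs0 s0B by blast
  have BU: "?B \<subseteq> U" using B1 sub1U by blast
  have Br: "?B \<subseteq> ball p r" using B1 sub1 by blast
  have hUm: "holo ?B (Um m q)" if "m \<in> ?I" "q \<in> I" for m q by (rule holo_subset[OF hU0[OF that] open_ball Bs0])
  have Ux: "pdx (Um m j) z = (\<Sum>k\<in>I. a j k z * Um m k z)" and Uy: "pdy (Um m j) z = (\<Sum>k\<in>I. b j k z * Um m k z)"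
    if "m \<in> ?I" "j \<in> I" "z \<in> ?B" for m j z
    using Ux0[OF that(1,2) subsetD[OF Bs0 that(3)]] Uy0[OF that(1,2) subsetD[OF Bs0 that(3)]] .
  interpret fd: fundamental_solutions U F w1 w2 ?B I None v a b Um S
  proof unfold_locales
    show "finite I" "None \<in> I" "open ?B" "?B \<subseteq> U" "S0 \<subseteq> S" using fI oI BU S0S by simp_all
    show "holo ?B (v q)" for q by (rule holo_subset[OF hv open_ball B1])
    show "a k q \<in> dring ?B S" "b k q \<in> dring ?B S" if "k \<in> I" "q \<in> I" for k q
      using dring_mono[OF ad[OF that] B1 order_refl] dring_mono[OF bd[OF that] B1 order_refl] .
    show "pdx (v k) z = (\<Sum>q\<in>I. a k q z * v q z)" "pdy (v k) z = (\<Sum>q\<in>I. b k q z * v q z)" if "k \<in> I" "z \<in> ?B" for k z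
      using vx[OF that(1) subsetD[OF B1 that(2)]] vy[OF that(1) subsetD[OF B1 that(2)]] .
    show "\<forall>q\<in>?I. t q = 0" if z: "z \<in> ?B" and t: "\<And>m. m \<in> ?I \<Longrightarrow> (\<Sum>q\<in>I. t q * Um m q z) = 0" for z t
    proof (rule near_identity_injective[OF fI', where M = "\<lambda>m q. Um m q z"])
      show "norm (Um m q z - (if q = m then 1 else 0)) * (card ?I + 1) \<le> 1" if "m \<in> ?I" "q \<in> ?I" for m q
        by (rule near[OF subsetD[OF Bs1 z] that])
      show "(\<Sum>q\<in>?I. t q * Um m q z) = 0" if m: "m \<in> ?I" for m
        using t[OF m] UN[OF m subsetD[OF Bs0 z]] fI oI by (simp add: sum.remove)
    qed
    show "v None z = 1" for z by (rule vN)
    show "holo ?B (Um m q)" if "m \<in> ?I" "q \<in> I" for m q by (rule hUm[OF that])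
    show "pdx (Um m k) z = (\<Sum>q\<in>I. a k q z * Um m q z)" if "m \<in> ?I" "k \<in> I" "z \<in> ?B" for m k z by (rule Ux[OF that])
    show "pdy (Um m k) z = (\<Sum>q\<in>I. b k q z * Um m q z)" if "m \<in> ?I" "k \<in> I" "z \<in> ?B" for m k z by (rule Uy[OF that])
  qed
  \<comment> \<open>A known coefficient gets a coordinate vector supported at \<open>None\<close>; this makes the first \<open>i\<close> coefficients of \<open>h m\<close> vanish.\<close>
  have "\<exists>t. (\<forall>q\<in>I. t q \<in> dring ?B1 S) \<and> (\<forall>z\<in>?B1. c k z = (\<Sum>q\<in>I. t q z * v q z)) \<and> (k < i \<longrightarrow> (\<forall>q\<in>?I. \<forall>z. t q z = 0))" for k
  proof (cases "k < i")
    case True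
    let ?t = "\<lambda>q. if q = None then c k else (\<lambda>z. 0)"
    have t1: "(\<Sum>q\<in>I. ?t q z * v q z) = c k z" for z
    proof -
      have "(\<Sum>q\<in>I. ?t q z * v q z) = (\<Sum>q\<in>I. if q = None then c k z * v q z else 0)" by (intro sum.cong) auto
      then show ?thesis using fI oI vN by simp
    qed
    have t2: "?t q \<in> dring ?B1 S" for q
      using dring_mono[OF known[OF True] sub1 order_refl] zero by (simp add: c_def)
    have t3: "?t q z = 0" if "q \<in> ?I" for q z using that by auto
    show ?thesis by (intro exI[of _ ?t] conjI ballI allI impI) (rule t2 t1[symmetric] t3, assumption?)+
  next
    case False
    have "c k \<in> lspan ?B1 S v I"
    proof (cases "k \<le> N")
      case True
      then show ?thesis using sp[of "Some (0, k)"] by (simp add: J_def jet_indices_def vS jet_def c_def)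
    next
      case False
      then show ?thesis by (intro lspan_zero) (simp add: c_def coeff_eq_0 le_less_trans[OF pencil_integral_degree[OF P1]])
    qed
    then show ?thesis using False unfolding lspan_def by blast
  qed
  then have "\<forall>k. \<exists>t. (\<forall>q\<in>I. t q \<in> dring ?B1 S) \<and> (\<forall>z\<in>?B1. c k z = (\<Sum>q\<in>I. t q z * v q z)) \<and> (k < i \<longrightarrow> (\<forall>q\<in>?I. \<forall>z. t q z = 0))" ..
  from choice[OF this] obtain tk where
    tk: "\<forall>k. (\<forall>q\<in>I. tk k q \<in> dring ?B1 S) \<and> (\<forall>z\<in>?B1. c k z = (\<Sum>q\<in>I. tk k q z * v q z)) \<and> (k < i \<longrightarrow> (\<forall>q\<in>?I. \<forall>z. tk k q z = 0))" ..
  have tkd: "tk k q \<in> dring ?B1 S" if "q \<in> I" for k q using tk that by blast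
  have tkv: "c k z = (\<Sum>q\<in>I. tk k q z * v q z)" if "z \<in> ?B1" for k z using tk that by blast
  have tk0: "tk k q z = 0" if "k < i" "q \<in> ?I" for k q z using tk that by blast
  define w where "w k m z = (\<Sum>q\<in>I. tk k q z * Um m q z)" for k m z
  have Dw: "vderiv \<alpha> \<beta> (w k m) z = (\<Sum>q\<in>I. dc \<alpha> \<beta> (tk k) q z * Um m q z)" if "m \<in> ?I" "z \<in> ?B" for \<alpha> \<beta> k m z
    unfolding w_def[abs_def] dc_def
    by (rule vderiv_linear_combination[OF fI holo_subset[OF hd1[OF tkd] open_ball B1] hUm[OF that(1)] Ux[OF that(1)] Uy[OF that(1)] that(2)])
  have XYd: "aX \<in> dring ?B1 S" "bX \<in> dring ?B1 S" "aY \<in> dring ?B1 S" "bY \<in> dring ?B1 S"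
    using coeffs_dring[OF sub1U S0S] by blast+
  have tN: "tk k q z = 0" if k: "k > N" and "q \<in> I" "z \<in> ?B1" for k q z
  proof (rule ind1[OF tkd _ that(2,3)])
    fix z assume "z \<in> ?B1"
    moreover have "c k z = 0" by (simp add: c_def coeff_eq_0 le_less_trans[OF pencil_integral_degree[OF P1] k])
    ultimately show "(\<Sum>q\<in>I. tk k q z * v q z) = 0" using tkv by simp
  qed
  have Y0: "dc aY bY (tk 0) q z = 0" if "q \<in> I" "z \<in> ?B1" for q z
  proof (rule ind1[OF dcd[OF XYd(3,4) tkd] _ that])
    fix z assume z: "z \<in> ?B1"
    have "0 = vderiv aY bY (c 0) z" using P1 z unfolding pencil_integral_def Y_def c_def by simp
    then show "(\<Sum>q\<in>I. dc aY bY (tk 0) q z * v q z) = 0" using Dv[OF tkd tkv z] by simp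
  qed
  have YX: "dc aY bY (tk (Suc k)) q z - dc aX bX (tk k) q z = 0" if "q \<in> I" "z \<in> ?B1" for k q z
  proof (rule ind1[OF dring.diff[OF dcd[OF XYd(3,4) tkd] dcd[OF XYd(1,2) tkd]] _ that])
    fix z assume z: "z \<in> ?B1"
    have "vderiv aY bY (c (Suc k)) z = vderiv aX bX (c k) z" using P1 z unfolding pencil_integral_def Y_def X_def c_def by simp
    then show "(\<Sum>q\<in>I. (dc aY bY (tk (Suc k)) q z - dc aX bX (tk k) q z) * v q z) = 0"
      using Dv[OF tkd tkv z] by (simp add: left_diff_distrib sum_subtractf)
  qed
  define h where "h m z = (\<Sum>k\<le>N. monom (w k m z) k)" for m z
  have hc: "coeff (h m z) k = (if k \<le> N then w k m z else 0)" for m z k by (simp add: h_def coeff_sum)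
  have hc': "coeff (h m z) k = w k m z" if "z \<in> ?B" for m z k
    using tN subsetD[OF B1 that] by (auto simp: hc w_def intro!: sum.neutral[symmetric])
  have hw: "holo ?B (w k m)" if "m \<in> ?I" for k m
    unfolding w_def[abs_def] by (intro holo_sum holo_mult holo_subset[OF hd1[OF tkd] open_ball B1] hUm that open_ball)
  have Hh: "pencil_integral ?B N (h m)" if m: "m \<in> ?I" for m
    unfolding pencil_integral_def
  proof (intro conjI allI ballI open_ball BU)
    show "degree (h m z) \<le> N" for z by (rule degree_le) (simp add: hc)
    show "holo ?B (\<lambda>z. coeff (h m z) k)" for k by (rule holo_cong[OF hw[OF m]]) (rule hc')
    fix z assume z: "z \<in> ?B"
    have D: "vderiv \<alpha> \<beta> (\<lambda>z. coeff (h m z) k) z = (\<Sum>q\<in>I. dc \<alpha> \<beta> (tk k) q z * Um m q z)" for \<alpha> \<beta> k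
    proof -
      have "vderiv \<alpha> \<beta> (\<lambda>z. coeff (h m z) k) z = vderiv \<alpha> \<beta> (w k m) z" by (rule vderiv_cong[OF open_ball z hc'])
      then show ?thesis using Dw[OF m z] by simp
    qed
    have z1: "z \<in> ?B1" by (rule subsetD[OF B1 z])
    show "Y (\<lambda>z. coeff (h m z) 0) z = 0"
      unfolding Y_def D by (rule sum.neutral) (simp add: Y0[OF _ z1])
    show "Y (\<lambda>z. coeff (h m z) (Suc k)) z = X (\<lambda>z. coeff (h m z) k) z" for k
      unfolding Y_def X_def D
    proof (rule sum.cong[OF refl])
      fix q assume "q \<in> I"
      from YX[OF this z1] show "dc aY bY (tk (Suc k)) q z * Um m q z = dc aX bX (tk k) q z * Um m q z" by simp
    qed
  qed
  have hlow: "coeff (h m z) k = 0" if "m \<in> ?I" "k < i" "z \<in> ?B" for m k z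
  proof -
    have "w k m z = tk k None z * Um m None z + (\<Sum>q\<in>?I. tk k q z * Um m q z)"
      unfolding w_def using fI oI by (simp add: sum.remove)
    then show ?thesis using hc'[OF that(3)] UN[OF that(1) subsetD[OF Bs0 that(3)]] tk0[OF that(2)] by simp
  qed
  \<comment> \<open>The first \<open>i\<close> coefficients of \<open>h m\<close> vanish, so division by \<open>t\<^sup>i\<close> makes \<open>w i m\<close> a constant coefficient.\<close>
  define g where "g m z = poly_shift i (h m z)" for m z
  have Hg: "pencil_integral ?B N (g m)" if "m \<in> ?I" for m
    unfolding g_def[abs_def] by (rule pencil_integral_shift[OF Hh[OF that] hlow[OF that]])
  have gc: "coeff (g m z) 0 = w i m z" if "z \<in> ?B" for m z
    using hc'[OF that] by (simp add: g_def coeff_poly_shift)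
  have chB: "darboux_chain ?B S0 S" by (rule darboux_chain_mono[OF ch Br open_ball])
  have FB: "F \<in> dring ?B S"
  proof (rule dring.cong)
    show "(\<lambda>z. coeff (P z) 0) \<in> dring ?B S" using dring_mono[OF known[of 0] Br order_refl] i by simp
    show "F z = coeff (P z) 0" if "z \<in> ?B" for z using PF[OF subsetD[OF sub10 subsetD[OF B1 that]]] by simp
  qed
  have B0': "?B \<subseteq> B0" using B1 sub10 by blast
  have "\<exists>p2 r2. r2 > 0 \<and> ball p2 r2 \<subseteq> ?B \<and> darboux_chain (ball p2 r2) S0 (S \<union> (\<lambda>m z. coeff (g m z) 0) ` ?I)"
    by (rule adjoin_leading_coeffs[where g = g, OF P PF fI' s B0' chB FB Hg])
  then obtain p2 r2 where 2: "r2 > 0" "ball p2 r2 \<subseteq> ?B" "darboux_chain (ball p2 r2) S0 (S \<union> (\<lambda>m z. coeff (g m z) 0) ` ?I)"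
    by blast
  let ?B2 = "ball p2 r2" and ?S2 = "S \<union> (\<lambda>m z. coeff (g m z) 0) ` ?I"
  have sub21: "?B2 \<subseteq> ?B1" using 2(2) B1 by blast
  have "\<exists>p' r' S''. r' > 0 \<and> ball p' r' \<subseteq> ?B2 \<and> ?S2 \<subseteq> S'' \<and> darboux_chain (ball p' r') S0 S'' \<and> c i \<in> dring (ball p' r') S''"
  proof (rule fd.reduction_of_order[OF 2(1,2) _ 2(3), where \<phi> = "w i"])
    show "S \<subseteq> ?S2" by blast
    show "holo ?B2 (c i)" using pencil_integral_mono[OF P1 open_ball sub21 order_refl] unfolding pencil_integral_def c_def by blast
    show "Y (c i) \<in> dring ?B2 ?S2"
    proof (rule dring.cong)
      have "c (i - 1) \<in> dring (ball p r) S" using known[of "i - 1"] i by (simp add: c_def)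
      then have "c (i - 1) \<in> dring ?B2 ?S2" by (rule dring_mono) (use 2(2) Br in auto)
      then show "X (c (i - 1)) \<in> dring ?B2 ?S2" by (rule XY_dring(1)[rotated 2]) (use 2(2) BU S0S in auto)
      show "Y (c i) z = X (c (i - 1)) z" if "z \<in> ?B2" for z
      proof -
        have "z \<in> ?B1" using sub21 that by blast
        then have "Y (c (Suc (i - 1))) z = X (c (i - 1)) z" using P1 unfolding pencil_integral_def c_def by blast
        then show ?thesis using i by simp
      qed
    qed
    show "w i m \<in> dring ?B2 ?S2" if "m \<in> ?I" for m
      by (rule dring.cong[OF dring.gen[of "\<lambda>z. coeff (g m z) 0"]]) (use that gc 2(2) in auto)
    show "Y (w i m) z = 0" if m: "m \<in> ?I" and z: "z \<in> ?B2" for m z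
    proof -
      have zB: "z \<in> ?B" using z 2(2) by blast
      have "Y (\<lambda>z. coeff (g m z) 0) z = 0" using Hg[OF m] zB unfolding pencil_integral_def by blast
      then show ?thesis using Y_cong[OF open_ball zB, of "\<lambda>z. coeff (g m z) 0" "w i m"] gc by simp
    qed
    show "fd.same_coordinates ?B2 ?S2 (c i) (w i)"
      unfolding fd.same_coordinates_def
    proof (intro exI[of _ "tk i"] conjI ballI)
      show "tk i q \<in> dring ?B2 ?S2" if "q \<in> I" for q by (rule dring_mono[OF tkd[OF that] sub21]) blast
      show "c i z = (\<Sum>q\<in>I. tk i q z * v q z)" if "z \<in> ?B2" for z by (rule tkv) (use that sub21 in blast)
    qed (simp add: w_def)
  qed
  then obtain p' r' S'' where f: "r' > 0" "ball p' r' \<subseteq> ?B2" "?S2 \<subseteq> S''" "darboux_chain (ball p' r') S0 S''" "c i \<in> dring (ball p' r') S''" by blast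
  have "ball p' r' \<subseteq> ball p r" using f(2) 2(2) Br by blast
  moreover have "S \<subseteq> S''" using f(3) by blast
  ultimately show ?thesis using f(1,4,5) unfolding c_def by blast
qed

text \<open>Start with \<open>F\<close>, a primitive of a form over the data, and adjoin the coefficients in increasing order.\<close>

theorem polynomial_first_integral_darboux:
  assumes P: "pencil_integral B0 N P" and PF: "\<And>z. z \<in> B0 \<Longrightarrow> coeff (P z) 0 = F z" and ne: "B0 \<noteq> {}"
  shows "\<exists>p r S. r > 0 \<and> ball p r \<subseteq> B0 \<and> darboux_chain (ball p r) S0 S \<and> (\<forall>k. (\<lambda>z. coeff (P z) k) \<in> dring (ball p r) S)"
proof -
  have B0: "open B0" "B0 \<subseteq> U" using P unfolding pencil_integral_def by auto
  have "\<exists>p r S. r > 0 \<and> ball p r \<subseteq> B0 \<and> darboux_chain (ball p r) S0 S \<and> (\<forall>k<Suc i. (\<lambda>z. coeff (P z) k) \<in> dring (ball p r) S)" for i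
  proof (induction i)
    case 0
    obtain p r where pr: "r > 0" "ball p r \<subseteq> B0" using B0(1) ne unfolding open_contains_ball by blast
    have hF: "holo (ball p r) F" by (rule holo_subset[OF hF open_ball]) (use pr B0 in blast)
    have "darboux_chain (ball p r) S0 (insert F S0)"
      by (rule darboux_chain.primitive[OF darboux_chain.base hF, where a = "pdx F" and b = "pdy F"]) (auto simp: S0_def intro: dring.gen)
    moreover have "(\<lambda>z. coeff (P z) 0) \<in> dring (ball p r) (insert F S0)"
      by (rule dring.cong[of F]) (use PF pr in \<open>auto intro: dring.gen\<close>)
    ultimately show ?case using pr by (intro exI[of _ p] exI[of _ r] exI[of _ "insert F S0"]) auto
  next
    case (Suc i)
    then obtain p r S where 1: "r > 0" "ball p r \<subseteq> B0" "darboux_chain (ball p r) S0 S"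
       "\<And>k. k < Suc i \<Longrightarrow> (\<lambda>z. coeff (P z) k) \<in> dring (ball p r) S" by blast
    have "\<exists>p' r' S'. r' > 0 \<and> ball p' r' \<subseteq> ball p r \<and> S \<subseteq> S' \<and> darboux_chain (ball p' r') S0 S' \<and>
     (\<lambda>z. coeff (P z) (Suc i)) \<in> dring (ball p' r') S'"
      by (rule adjoin_next_coeff[OF P PF 1(1,2,3,4)]) auto
    then obtain p' r' S' where 2: "r' > 0" "ball p' r' \<subseteq> ball p r" "S \<subseteq> S'" "darboux_chain (ball p' r') S0 S'"
       "(\<lambda>z. coeff (P z) (Suc i)) \<in> dring (ball p' r') S'" by blast
    have "(\<lambda>z. coeff (P z) k) \<in> dring (ball p' r') S'" if "k < Suc (Suc i)" for k
      using that 2(5) dring_mono[OF 1(4) 2(2,3)] by (cases "k = Suc i") auto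
    moreover have "ball p' r' \<subseteq> B0" using 2(2) 1(2) by blast
    ultimately show ?case using 2(1,4) by blast
  qed
  from this[of N] obtain p r S where 1: "r > 0" "ball p r \<subseteq> B0" "darboux_chain (ball p r) S0 S"
     "\<And>k. k < Suc N \<Longrightarrow> (\<lambda>z. coeff (P z) k) \<in> dring (ball p r) S" by blast
  have "(\<lambda>z. coeff (P z) k) \<in> dring (ball p r) S" for k
  proof (cases "k < Suc N")
    case False
    then have "(\<lambda>z. coeff (P z) k) = (\<lambda>z. 0)" by (auto simp: coeff_eq_0 le_less_trans[OF pencil_integral_degree[OF P]])
    then show ?thesis by (simp add: dring.const)
  qed (rule 1(4))
  then show ?thesis using 1 by blast
qed

end

section \<open>Functions constant along the leaves\<close>

text \<open>The factor is the quotient by whichever partial derivative of \<open>F\<close> is nonzero; the two quotients agree.\<close>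

lemma proportional_form:
  assumes F: "holo U F" and dF: "\<And>z. z \<in> U \<Longrightarrow> pdx F z \<noteq> 0 \<or> pdy F z \<noteq> 0"
    and a: "holo U a1" "holo U a2" and pr: "\<And>z. z \<in> U \<Longrightarrow> pdx F z * a2 z = pdy F z * a1 z"
  shows "\<exists>\<kappa>. holo U \<kappa> \<and> (\<forall>z\<in>U. a1 z = \<kappa> z * pdx F z \<and> a2 z = \<kappa> z * pdy F z)"
proof -
  define \<kappa> where "\<kappa> z = (if pdx F z \<noteq> 0 then a1 z / pdx F z else a2 z / pdy F z)" for z
  have U: "open U" using F holo_open by blast
  have hx: "holo U (pdx F)" and hy: "holo U (pdy F)" using F holo_pdx holo_pdy by blast+
  have ky: "\<kappa> z = a2 z / pdy F z" if "z \<in> U" "pdy F z \<noteq> 0" for z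
    using pr[OF that(1)] that(2) by (simp add: \<kappa>_def field_simps)
  have "holo U \<kappa>"
  proof (rule holo_local[OF U])
    fix z assume z: "z \<in> U"
    show "\<exists>W. z \<in> W \<and> holo W \<kappa>"
    proof (cases "pdx F z = 0")
      case False
      let ?W = "{w \<in> U. pdx F w \<noteq> 0}"
      have W: "open ?W" "?W \<subseteq> U" using open_nonzero[OF hx] by auto
      have "holo ?W (\<lambda>w. a1 w / pdx F w)"
        by (intro holo_divide holo_subset[OF a(1) W] holo_subset[OF hx W]) simp
      then have "holo ?W \<kappa>" by (rule holo_cong) (simp add: \<kappa>_def)
      then show ?thesis using z False by (intro exI[of _ ?W]) simp
    next
      case True
      let ?W = "{w \<in> U. pdy F w \<noteq> 0}"
      have W: "open ?W" "?W \<subseteq> U" using open_nonzero[OF hy] by auto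
      have "holo ?W (\<lambda>w. a2 w / pdy F w)"
        by (intro holo_divide holo_subset[OF a(2) W] holo_subset[OF hy W]) simp
      then have "holo ?W \<kappa>" by (rule holo_cong) (simp add: ky)
      then show ?thesis using z True dF[OF z] by (intro exI[of _ ?W]) simp
    qed
  qed
  moreover have "a1 z = \<kappa> z * pdx F z \<and> a2 z = \<kappa> z * pdy F z" if z: "z \<in> U" for z
    using pr[OF z] dF[OF z] by (cases "pdx F z = 0") (auto simp: \<kappa>_def field_simps)
  ultimately show ?thesis by blast
qed

text \<open>The Hamiltonian vector field of \<open>F\<close>, tangent to the leaves \<open>F = const\<close>.\<close>

definition leaf_deriv :: "(C2 \<Rightarrow> complex) \<Rightarrow> (C2 \<Rightarrow> complex) \<Rightarrow> C2 \<Rightarrow> complex" where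
  "leaf_deriv F = vderiv (\<lambda>z. - pdy F z) (pdx F)"

text \<open>If \<open>dq = \<kappa> dF\<close> then \<open>0 = d\<kappa> \<and> dF\<close>.\<close>

lemma leaf_deriv_exact:
  assumes F: "holo U F" and q: "holo U q" and k: "holo U \<kappa>"
    and eq: "\<And>z. z \<in> U \<Longrightarrow> pdx q z = \<kappa> z * pdx F z" "\<And>z. z \<in> U \<Longrightarrow> pdy q z = \<kappa> z * pdy F z" and z: "z \<in> U"
  shows "leaf_deriv F \<kappa> z = 0"
proof -
  have U: "open U" using F holo_open by blast
  have "pdy (pdx q) z = pdy \<kappa> z * pdx F z + \<kappa> z * pdy (pdx F) z"
    using pd_cong(2)[OF U z, of "pdx q" "\<lambda>z. \<kappa> z * pdx F z"] eq(1) pd_mult(2)[OF k holo_pdx[OF F] z] by simp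
  moreover have "pdx (pdy q) z = pdx \<kappa> z * pdy F z + \<kappa> z * pdx (pdy F) z"
    using pd_cong(1)[OF U z, of "pdy q" "\<lambda>z. \<kappa> z * pdy F z"] eq(2) pd_mult(1)[OF k holo_pdy[OF F] z] by simp
  ultimately show ?thesis using pd_commute[OF q z] pd_commute[OF F z] by (simp add: leaf_deriv_def vderiv_def mult.commute)
qed

lemma vderiv_power:
  assumes "holo U h" "z \<in> U"
  shows "vderiv \<alpha> \<beta> (\<lambda>z. h z ^ Suc k) z = of_nat (Suc k) * h z ^ k * vderiv \<alpha> \<beta> h z"
proof (induction k)
  case (Suc k)
  have "vderiv \<alpha> \<beta> (\<lambda>z. h z * h z ^ Suc k) z = vderiv \<alpha> \<beta> h z * h z ^ Suc k + h z * vderiv \<alpha> \<beta> (\<lambda>z. h z ^ Suc k) z"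
    by (rule vderiv_mult[OF assms(1) holo_power[OF assms(1)] assms(2)])
  then show ?case unfolding Suc by (simp add: algebra_simps)
qed simp

text \<open>Differentiating the equation gives \<open>D h\<close> times an equation of smaller degree with constant top coefficient. Where
\<open>D h\<close> is nonzero the latter holds, and the induction hypothesis contradicts \<open>D h \<noteq> 0\<close>.\<close>

lemma algebraic_over_constants:
  assumes h: "holo W h" and W: "open W"
    and a: "\<And>k. k \<le> Suc n \<Longrightarrow> holo W (a k)" and Ta: "\<And>k z. k \<le> Suc n \<Longrightarrow> z \<in> W \<Longrightarrow> vderiv \<alpha> \<beta> (a k) z = 0"
    and top: "\<And>z. a (Suc n) z = c" "c \<noteq> 0"
    and rel: "\<And>z. z \<in> W \<Longrightarrow> (\<Sum>k\<le>Suc n. a k z * h z ^ k) = 0"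
    and ab: "holo W \<alpha>" "holo W \<beta>" and z: "z \<in> W"
  shows "vderiv \<alpha> \<beta> h z = 0"
  using assms
proof (induction n arbitrary: W a c z)
  case (0 W a c z)
  have "0 = vderiv \<alpha> \<beta> (\<lambda>z. a 0 z + c * h z) z"
    using vderiv_zero[OF 0(2) 0(10), of "\<lambda>z. a 0 z + c * h z"] 0(7) 0(5) by simp
  also have "\<dots> = vderiv \<alpha> \<beta> (a 0) z + c * vderiv \<alpha> \<beta> h z"
    using vderiv_add[of W "a 0" "\<lambda>z. c * h z" z] vderiv_cmult[OF 0(1) 0(10)] 0(1,2,3,10)
    by (simp add: holo_mult holo_const)
  finally show ?case using 0(4)[of 0] 0(6,10) by simp
next
  case (Suc n W a c z)
  show ?case
  proof (rule ccontr)
    assume nz: "vderiv \<alpha> \<beta> h z \<noteq> 0"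
    let ?T = "vderiv \<alpha> \<beta>" and ?W = "{w \<in> W. vderiv \<alpha> \<beta> h w \<noteq> 0}"
    have oW: "open ?W" by (rule open_nonzero[OF vderiv_holo[OF Suc.prems(8,9,1)]])
    have sub: "?W \<subseteq> W" by blast
    let ?b = "\<lambda>k z. of_nat (Suc k) * a (Suc k) z"
    have "?T h z = 0"
    proof (rule Suc.IH[of ?W ?b "of_nat (Suc (Suc n)) * c"])
      show "holo ?W h" "holo ?W \<alpha>" "holo ?W \<beta>" using Suc.prems(1,8,9) oW sub holo_subset by blast+
      show "open ?W" by (rule oW)
      show "holo ?W (?b k)" if "k \<le> Suc n" for k
        by (intro holo_mult holo_const oW holo_subset[OF Suc.prems(3) oW sub]) (use that in simp)
      show "?T (?b k) w = 0" if "k \<le> Suc n" "w \<in> ?W" for k w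
        using vderiv_cmult[OF Suc.prems(3)[of "Suc k"], of w \<alpha> \<beta> "of_nat (Suc k)"] Suc.prems(4)[of "Suc k" w] that by simp
      show "?b (Suc n) w = of_nat (Suc (Suc n)) * c" for w using Suc.prems(5)[of w] by simp
      show "of_nat (Suc (Suc n)) * c \<noteq> 0" using Suc.prems(6) by (simp del: of_nat_Suc)
      show "z \<in> ?W" using nz Suc.prems(10) by simp
      fix w assume w: "w \<in> ?W"
      then have wW: "w \<in> W" and Tn: "?T h w \<noteq> 0" by auto
      have m: "holo W (\<lambda>z. a k z * h z ^ k)" if "k \<le> Suc (Suc n)" for k
        using that Suc.prems(1,3) by (intro holo_mult holo_power) auto
      have "0 = ?T (\<lambda>z. \<Sum>k\<le>Suc (Suc n). a k z * h z ^ k) w"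
        using vderiv_zero[OF Suc.prems(2) wW] Suc.prems(7) by simp
      also have "\<dots> = (\<Sum>k\<le>Suc (Suc n). ?T (\<lambda>z. a k z * h z ^ k) w)"
        by (rule vderiv_sum[OF m wW]) simp
      also have "\<dots> = (\<Sum>k\<le>Suc (Suc n). a k w * ?T (\<lambda>z. h z ^ k) w)"
      proof (rule sum.cong[OF refl])
        fix k assume "k \<in> {..Suc (Suc n)}"
        then show "?T (\<lambda>z. a k z * h z ^ k) w = a k w * ?T (\<lambda>z. h z ^ k) w"
          using vderiv_mult[OF Suc.prems(3)[of k] holo_power[OF Suc.prems(1)] wW] Suc.prems(4)[of k w] wW by simp
      qed
      also have "\<dots> = (\<Sum>k\<le>Suc n. a (Suc k) w * ?T (\<lambda>z. h z ^ Suc k) w)"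
        by (subst sum.atMost_Suc_shift) simp
      also have "\<dots> = ?T h w * (\<Sum>k\<le>Suc n. ?b k w * h w ^ k)"
        unfolding vderiv_power[OF Suc.prems(1) wW] sum_distrib_left by (intro sum.cong) (simp_all add: algebra_simps)
      finally show "(\<Sum>k\<le>Suc n. ?b k w * h w ^ k) = 0" using Tn by simp
    qed
    then show False using nz by simp
  qed
qed

lemma deriv_line:
  assumes f: "holo (ball z r) f" and s: "(fst z + t * u, snd z + t * v) \<in> ball z r"
  shows "((\<lambda>t. f (fst z + t * u, snd z + t * v)) has_field_derivative
     (u * pdx f (fst z + t * u, snd z + t * v) + v * pdy f (fst z + t * u, snd z + t * v))) (at t)"
proof -
  have "((\<lambda>t. fst z + t * u) has_field_derivative u) (at t)" "((\<lambda>t. snd z + t * v) has_field_derivative v) (at t)"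
    by (auto intro!: derivative_eq_intros)
  from curve_derivative[where u = "\<lambda>t. fst z + t * u" and v = "\<lambda>t. snd z + t * v", OF f s this]
  show ?thesis by (simp add: mult.commute)
qed

text \<open>The family \<open>Z\<close> consists of functions vanishing at \<open>z\<close> and contains with \<open>q\<close> the factor \<open>\<kappa>\<close> of \<open>dq = \<kappa> dF\<close>. A
product of a holomorphic function with a member of \<open>Z\<close> therefore has a derivative along the line which is a sum of such
products, and all of these vanish at \<open>z\<close>.\<close>

lemma higher_deriv_line_zero:
  assumes F: "holo (ball z r) F" and r: "r > 0"
    and Z: "\<And>q. q \<in> Z \<Longrightarrow> holo (ball z r) q \<and> q z = 0"
    and cl: "\<And>q. q \<in> Z \<Longrightarrow> \<exists>\<kappa>\<in>Z. \<forall>w\<in>ball z r. pdx q w = \<kappa> w * pdx F w \<and> pdy q w = \<kappa> w * pdy F w"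
    and A: "open A" "0 \<in> A" "\<And>t. t \<in> A \<Longrightarrow> (fst z + t * u, snd z + t * v) \<in> ball z r"
  shows "q \<in> Z \<Longrightarrow> holo (ball z r) a \<Longrightarrow>
    (deriv ^^ n) (\<lambda>t. a (fst z + t * u, snd z + t * v) * q (fst z + t * u, snd z + t * v)) 0 = 0"
proof (induction n arbitrary: a q)
  case 0 then show ?case using Z by simp
next
  case (Suc n)
  let ?l = "\<lambda>t. (fst z + t * u, snd z + t * v)"
  obtain \<kappa> where k: "\<kappa> \<in> Z" "\<And>w. w \<in> ball z r \<Longrightarrow> pdx q w = \<kappa> w * pdx F w" "\<And>w. w \<in> ball z r \<Longrightarrow> pdy q w = \<kappa> w * pdy F w"
    using cl[OF Suc.prems(1)] by blast
  have hq: "holo (ball z r) q" and hk: "holo (ball z r) \<kappa>" using Z Suc.prems(1) k(1) by blast+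
  define a1 where "a1 w = u * pdx a w + v * pdy a w" for w
  define a2 where "a2 w = a w * (u * pdx F w + v * pdy F w)" for w
  have ha1: "holo (ball z r) a1" and ha2: "holo (ball z r) a2"
    unfolding a1_def[abs_def] a2_def[abs_def]
    by (intro holo_add holo_mult holo_const open_ball holo_pdx holo_pdy Suc.prems(2) F)+
  let ?g1 = "\<lambda>t. a1 (?l t) * q (?l t)" and ?g2 = "\<lambda>t. a2 (?l t) * \<kappa> (?l t)"
  have d: "deriv (\<lambda>t. a (?l t) * q (?l t)) t = ?g1 t + ?g2 t" if t: "t \<in> A" for t
  proof -
    have "((\<lambda>t. a (?l t) * q (?l t)) has_field_derivative
       ((u * pdx a (?l t) + v * pdy a (?l t)) * q (?l t) + (u * pdx q (?l t) + v * pdy q (?l t)) * a (?l t))) (at t)"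
      by (rule DERIV_mult[OF deriv_line[OF Suc.prems(2) A(3)[OF t]] deriv_line[OF hq A(3)[OF t]]])
    then have "deriv (\<lambda>t. a (?l t) * q (?l t)) t =
       (u * pdx a (?l t) + v * pdy a (?l t)) * q (?l t) + (u * pdx q (?l t) + v * pdy q (?l t)) * a (?l t)"
      by (rule DERIV_imp_deriv)
    then show ?thesis using k(2,3)[OF A(3)[OF t]] by (simp add: a1_def a2_def algebra_simps)
  qed
  have hol: "(\<lambda>t. f (?l t)) holomorphic_on A" if "holo (ball z r) f" for f
    by (rule holo_line[OF that A(3)])
  have g: "?g1 holomorphic_on A" "?g2 holomorphic_on A"
    by (intro holomorphic_intros hol ha1 ha2 hq hk)+
  have "(deriv ^^ Suc n) (\<lambda>t. a (?l t) * q (?l t)) 0 = (deriv ^^ n) (deriv (\<lambda>t. a (?l t) * q (?l t))) 0"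
    by (simp add: funpow_Suc_right del: funpow.simps)
  also have "\<dots> = (deriv ^^ n) (\<lambda>t. ?g1 t + ?g2 t) 0"
    by (rule higher_deriv_cong_ev[OF eventually_mono[OF eventually_nhds_in_open[OF A(1,2)] d] refl])
  also have "\<dots> = (deriv ^^ n) ?g1 0 + (deriv ^^ n) ?g2 0"
    by (rule higher_deriv_add[OF g A(1,2)])
  finally show ?case using Suc.IH[OF Suc.prems(1) ha1] Suc.IH[OF k(1) ha2] by simp
qed

text \<open>If \<open>q\<close> is constant along the leaves, then \<open>dq = \<kappa> dF\<close> and \<open>\<kappa>\<close> is again constant along them. On the slice, where \<open>F\<close>
is the parameter, \<open>\<kappa>\<close> is the derivative of \<open>q\<close> and so vanishes with \<open>q\<close>. Hence \<open>higher_deriv_line_zero\<close> applies: all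
Taylor coefficients of \<open>q\<close> at a point of the slice are zero.\<close>

lemma factor_through:
  assumes F: "holo V F" and con: "connected V" and dF: "\<And>z. z \<in> V \<Longrightarrow> pdx F z \<noteq> 0 \<or> pdy F z \<noteq> 0"
    and q: "holo V q" and Tq: "\<And>z. z \<in> V \<Longrightarrow> leaf_deriv F q z = 0"
    and s: "open T" "t0 \<in> T" "\<And>t. t \<in> T \<Longrightarrow> (s1 t, s2 t) \<in> V" "\<And>t. t \<in> T \<Longrightarrow> F (s1 t, s2 t) = t"
    and sh: "s1 holomorphic_on T" "s2 holomorphic_on T"
    and qs: "\<And>t. t \<in> T \<Longrightarrow> q (s1 t, s2 t) = 0" and z: "z \<in> V"
  shows "q z = 0"
proof -
  have V: "open V" using F holo_open by blast
  define Z where "Z = {q. holo V q \<and> (\<forall>z\<in>V. leaf_deriv F q z = 0) \<and> (\<forall>t\<in>T. q (s1 t, s2 t) = 0)}"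
  define z1 where "z1 = (s1 t0, s2 t0)"
  have z1V: "z1 \<in> V" using s by (simp add: z1_def)
  obtain r where r: "r > 0" "ball z1 r \<subseteq> V" using V z1V open_contains_ball by blast
  have chain: "((\<lambda>t. f (s1 t, s2 t)) has_field_derivative (pdx f (s1 t, s2 t) * deriv s1 t + pdy f (s1 t, s2 t) * deriv s2 t)) (at t)"
    if f: "holo V f" and t: "t \<in> T" for f t
    by (rule curve_derivative[of V f s1 t s2,
          OF f s(3)[OF t] holomorphic_derivI[OF sh(1) s(1) t] holomorphic_derivI[OF sh(2) s(1) t]])
  have cl: "\<exists>\<kappa>\<in>Z. \<forall>w\<in>V. pdx q w = \<kappa> w * pdx F w \<and> pdy q w = \<kappa> w * pdy F w" if qZ: "q \<in> Z" for q
  proof -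
    have hq: "holo V q" and tq: "\<And>z. z \<in> V \<Longrightarrow> leaf_deriv F q z = 0" and q0: "\<And>t. t \<in> T \<Longrightarrow> q (s1 t, s2 t) = 0"
      using qZ by (auto simp: Z_def)
    have "pdx F z * pdy q z = pdy F z * pdx q z" if "z \<in> V" for z
      using tq[OF that] by (simp add: leaf_deriv_def vderiv_def)
    then obtain \<kappa> where k: "holo V \<kappa>" "\<And>w. w \<in> V \<Longrightarrow> pdx q w = \<kappa> w * pdx F w" "\<And>w. w \<in> V \<Longrightarrow> pdy q w = \<kappa> w * pdy F w"
      using proportional_form[OF F dF holo_pdx[OF hq] holo_pdy[OF hq]] by blast
    have "\<kappa> (s1 t, s2 t) = 0" if t: "t \<in> T" for t
    proof -
      let ?w = "(s1 t, s2 t)"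
      have "((\<lambda>t. q (s1 t, s2 t)) has_field_derivative 0) (at t)"
        by (rule has_field_derivative_transform_within_open[OF DERIV_const[of 0] s(1) t]) (simp add: q0)
      then have 1: "pdx q ?w * deriv s1 t + pdy q ?w * deriv s2 t = 0" using DERIV_unique[OF chain[OF hq t]] by blast
      have "((\<lambda>t. F (s1 t, s2 t)) has_field_derivative 1) (at t)"
        by (rule has_field_derivative_transform_within_open[OF DERIV_ident s(1) t]) (simp add: s(4))
      then have 2: "pdx F ?w * deriv s1 t + pdy F ?w * deriv s2 t = 1" using DERIV_unique[OF chain[OF F t]] by blast
      have "\<kappa> ?w = \<kappa> ?w * (pdx F ?w * deriv s1 t + pdy F ?w * deriv s2 t)" using 2 by simp
      also have "\<dots> = pdx q ?w * deriv s1 t + pdy q ?w * deriv s2 t" using k(2,3)[OF s(3)[OF t]] by (simp add: algebra_simps)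
      finally show ?thesis using 1 by simp
    qed
    moreover have "leaf_deriv F \<kappa> z = 0" if "z \<in> V" for z by (rule leaf_deriv_exact[OF F hq k that])
    ultimately have "\<kappa> \<in> Z" using k(1) by (simp add: Z_def)
    then show ?thesis using k by blast
  qed
  have qZ: "q \<in> Z" using q Tq qs by (simp add: Z_def)
  have "q w = 0" if w: "w \<in> ball z1 r" for w
  proof -
    define u where "u = fst w - fst z1"
    define v where "v = snd w - snd z1"
    let ?l = "\<lambda>t. (fst z1 + t * u, snd z1 + t * v)"
    have n: "norm (u, v) = dist z1 w"
      by (simp add: u_def v_def dist_norm norm_minus_commute norm_Pair norm_prod_def)
    have *: "?l t \<in> ball z1 r \<longleftrightarrow> norm t * dist z1 w < r" for t
    proof -
      have "dist z1 (?l t) = norm (t * u, t * v)"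
        by (cases z1) (simp add: dist_Pair_Pair norm_Pair dist_norm)
      also have "\<dots> = norm t * norm (u, v)"
        by (simp add: norm_Pair norm_mult power_mult_distrib real_sqrt_mult flip: distrib_left)
      finally show ?thesis by (simp add: n)
    qed
    show ?thesis
    proof (cases "dist z1 w = 0")
      case True
      then show ?thesis using qs[OF s(2)] by (simp add: z1_def)
    next
      case False
      then have d: "dist z1 w > 0" by simp
      let ?A = "ball (0::complex) (r / dist z1 w)"
      have A: "?l t \<in> ball z1 r" if "t \<in> ?A" for t
        using that d unfolding * by (simp add: pos_less_divide_eq)
      have hF: "holo (ball z1 r) F" and hq: "holo (ball z1 r) q" using F q r holo_subset by blast+
      have "(deriv ^^ n) (\<lambda>t. 1 * q (?l t)) 0 = 0" for n
      proof (rule higher_deriv_line_zero[OF hF r(1) _ _ open_ball _ A qZ holo_const[OF open_ball]])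
        show "holo (ball z1 r) q \<and> q z1 = 0" if "q \<in> Z" for q
          using that r holo_subset s(2) unfolding Z_def z1_def by blast
        show "\<exists>\<kappa>\<in>Z. \<forall>w\<in>ball z1 r. pdx q w = \<kappa> w * pdx F w \<and> pdy q w = \<kappa> w * pdy F w" if "q \<in> Z" for q
          using cl[OF that] r(2) by blast
        show "0 \<in> ?A" using d r(1) by simp
      qed
      then have dz: "(deriv ^^ n) (\<lambda>t. q (?l t)) 0 = 0" for n by simp
      have hol: "(\<lambda>t. q (?l t)) holomorphic_on ?A" by (rule holo_line[OF hq A])
      have one: "1 \<in> ?A" using w d by (simp add: pos_less_divide_eq)
      have "q (?l 1) = 0" by (rule holomorphic_fun_eq_0_on_ball[OF hol one dz])
      then show ?thesis by (simp add: u_def v_def)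
    qed
  qed
  then show ?thesis
    using holo_zero_connected[OF q con open_ball _ r(2) _ z] r(1) by auto
qed

section \<open>Tubes and transversals\<close>

lemma tube_connected:
  assumes "cycle_tube F \<gamma> T U" "connected T"
  shows "connected U"
proof -
  obtain h k where h: "homeomorphism (sphere (0::complex) 1 \<times> {-1<..<1::real} \<times> T) U h k"
    using assms(1) unfolding cycle_tube_def by blast
  have "connected (sphere (0::complex) 1)" by (rule connected_sphere) simp
  then have "connected (sphere (0::complex) 1 \<times> {-1<..<1::real} \<times> T)"
    by (intro connected_Times assms(2) connected_Ioo)
  moreover have "continuous_on (sphere (0::complex) 1 \<times> {-1<..<1::real} \<times> T) h"
    and "h ` (sphere (0::complex) 1 \<times> {-1<..<1::real} \<times> T) = U"
    using h unfolding homeomorphism_def by blast+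
  ultimately show ?thesis using connected_continuous_image by metis
qed

text \<open>The trivialisation turns \<open>F\<close> into the projection to the last factor, so it restricts to the preimage of \<open>T'\<close>.\<close>

lemma tube_restrict:
  assumes tube: "cycle_tube F \<gamma> T U" and F: "holo U F" and T': "T' \<subseteq> T" "open T'"
  shows "cycle_tube F \<gamma> T' {z \<in> U. F z \<in> T'}"
proof -
  have oU: "open U" using tube unfolding cycle_tube_def by blast
  obtain h k where h: "homeomorphism (sphere (0::complex) 1 \<times> {-1<..<1::real} \<times> T) U h k"
    and Fh: "\<forall>e\<in>sphere 0 1. \<forall>u\<in>{-1<..<1}. \<forall>t\<in>T. F (h (e, u, t)) = t"
    and \<gamma>h: "\<forall>t\<in>T. \<forall>s. \<gamma> t s = h (cis (2 * pi * s), 0, t)"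
    using tube unfolding cycle_tube_def by blast
  let ?S = "sphere (0::complex) 1 \<times> {-1<..<1::real} \<times> T" and ?S' = "sphere (0::complex) 1 \<times> {-1<..<1::real} \<times> T'"
  let ?U' = "{z \<in> U. F z \<in> T'}"
  have "open (U \<inter> F -` T')" by (rule continuous_open_preimage[OF holo_continuous_on[OF F] oU T'(2)])
  moreover have "U \<inter> F -` T' = ?U'" by blast
  ultimately have "open ?U'" by simp
  have hS: "h ` ?S = U" using h unfolding homeomorphism_def by blast
  have img: "h ` ?S' = ?U'"
  proof (intro equalityI subsetI)
    fix y assume "y \<in> h ` ?S'"
    then obtain e u t where y: "e \<in> sphere (0::complex) 1" "u \<in> {-1<..<1::real}" "t \<in> T'" "y = h (e, u, t)" by blast
    then have t: "t \<in> T" using T' by blast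
    then have "y \<in> h ` ?S" using y by blast
    then show "y \<in> ?U'" unfolding hS using Fh y t by simp
  next
    fix y assume y: "y \<in> ?U'"
    then have "y \<in> h ` ?S" unfolding hS by blast
    then obtain e u t where *: "e \<in> sphere (0::complex) 1" "u \<in> {-1<..<1::real}" "t \<in> T" "y = h (e, u, t)" by blast
    then have "t \<in> T'" using Fh y by simp
    then show "y \<in> h ` ?S'" using * by blast
  qed
  have "homeomorphism ?S' ?U' h k"
    by (rule homeomorphism_of_subsets[OF h _ _ img, of ?U']) (use T' in auto)
  then show ?thesis
    unfolding cycle_tube_def using \<open>open ?U'\<close> Fh \<gamma>h T'(1) by (intro conjI exI[of _ h] exI[of _ k]) blast+
qed

text \<open>Along the transversal \<open>F\<close> has nonzero derivative, so near \<open>t0\<close> its value can serve as parameter.\<close>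

lemma transversal_slice:
  assumes F: "holo U F" and tr: "transversal F U c S" and t0: "t0 \<in> F ` S"
  shows "connected (F ` S) \<and> (\<exists>\<delta>>0. ball t0 \<delta> \<subseteq> F ` S \<and> (\<exists>s1 s2. s1 holomorphic_on ball t0 \<delta> \<and> s2 holomorphic_on ball t0 \<delta> \<and>
     (\<forall>t\<in>ball t0 \<delta>. (s1 t, s2 t) \<in> U \<and> F (s1 t, s2 t) = t)))"
proof -
  obtain \<sigma> where SU: "S \<subseteq> U" and h1: "(\<lambda>w. fst (\<sigma> w)) holomorphic_on ball 0 1" and h2: "(\<lambda>w. snd (\<sigma> w)) holomorphic_on ball 0 1"
    and im: "\<sigma> ` ball 0 1 = S" and nz: "\<forall>w\<in>ball 0 1. deriv (\<lambda>w. F (\<sigma> w)) w \<noteq> 0"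
    using tr unfolding transversal_def by blast
  let ?f = "\<lambda>w. F (\<sigma> w)"
  have \<sigma>U: "\<sigma> w \<in> U" if "w \<in> ball 0 1" for w using that im SU by blast
  have hol: "?f holomorphic_on ball 0 1"
    using holo_curve[of U F "ball 0 1" "\<lambda>w. fst (\<sigma> w)" "\<lambda>w. snd (\<sigma> w)", OF F open_ball _ h1 h2] \<sigma>U by simp
  have FS: "F ` S = ?f ` ball 0 1" using im by auto
  have con: "connected (F ` S)"
    unfolding FS by (rule connected_continuous_image[OF holomorphic_on_imp_continuous_on[OF hol] connected_ball])
  obtain w0 where w0: "w0 \<in> ball 0 1" "?f w0 = t0" using t0 im by auto
  obtain \<rho> where \<rho>: "\<rho> > 0" "ball w0 \<rho> \<subseteq> ball 0 1" "inj_on ?f (ball w0 \<rho>)"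
    using has_complex_derivative_locally_injective[OF hol w0(1) open_ball] nz w0(1) by blast
  have hol': "?f holomorphic_on ball w0 \<rho>" using hol \<rho>(2) holomorphic_on_subset by blast
  obtain g where g: "g holomorphic_on (?f ` ball w0 \<rho>)" "\<And>z. z \<in> ball w0 \<rho> \<Longrightarrow> g (?f z) = z"
    by (rule holomorphic_has_inverse[OF hol' open_ball \<rho>(3)]) (rule that)
  have op: "open (?f ` ball w0 \<rho>)" by (rule open_mapping_thm3[OF hol' open_ball \<rho>(3)])
  have "t0 \<in> ?f ` ball w0 \<rho>" using w0(2) \<rho>(1) by (intro image_eqI[of _ _ w0]) auto
  then obtain \<delta> where \<delta>: "\<delta> > 0" "ball t0 \<delta> \<subseteq> ?f ` ball w0 \<rho>" using op open_contains_ball by blast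
  have gt: "g t \<in> ball w0 \<rho> \<and> ?f (g t) = t" if "t \<in> ball t0 \<delta>" for t
  proof -
    have "t \<in> ?f ` ball w0 \<rho>" by (rule subsetD[OF \<delta>(2) that])
    then obtain z where "t = ?f z" "z \<in> ball w0 \<rho>" by (rule imageE)
    then show ?thesis using g(2) by simp
  qed
  have hg: "g holomorphic_on ball t0 \<delta>" using g(1) \<delta>(2) holomorphic_on_subset by blast
  have gi: "g ` ball t0 \<delta> \<subseteq> ball 0 1" using gt \<rho>(2) by blast
  have s1: "(\<lambda>t. fst (\<sigma> (g t))) holomorphic_on ball t0 \<delta>"
    using holomorphic_on_compose_gen[OF hg h1 gi] by (simp add: o_def)
  have s2: "(\<lambda>t. snd (\<sigma> (g t))) holomorphic_on ball t0 \<delta>"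
    using holomorphic_on_compose_gen[OF hg h2 gi] by (simp add: o_def)
  have "(fst (\<sigma> (g t)), snd (\<sigma> (g t))) \<in> U \<and> F (fst (\<sigma> (g t)), snd (\<sigma> (g t))) = t" if "t \<in> ball t0 \<delta>" for t
  proof -
    have "g t \<in> ball 0 1" using gi that by blast
    then show ?thesis using gt[OF that] \<sigma>U by simp
  qed
  moreover have "ball t0 \<delta> \<subseteq> F ` S" unfolding FS using \<delta>(2) \<rho>(2) by blast
  ultimately show ?thesis using con \<delta>(1) s1 s2 by blast
qed

section \<open>Univalued integrating factors\<close>

lemma nonconstant_ball:
  assumes F: "holo (ball p r) F" and r: "r > 0" and dF: "d0 F p \<noteq> 0"
  shows "\<exists>q\<in>ball p r. F q \<noteq> F p"
proof (rule ccontr)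
  assume "\<not> ?thesis"
  then have c: "\<And>w. w \<in> ball p r \<Longrightarrow> F w = F p" by blast
  have p: "p \<in> ball p r" using r by simp
  have "pdx F p = 0" "pdy F p = 0" using pd_cong[OF open_ball p c] by simp_all
  then show False using dF by (simp add: d0_def zero_prod_def)
qed

lemma nonzero_near_0:
  assumes "continuous_on UNIV f" "f (0::complex) \<noteq> (0::complex)"
  shows "\<exists>\<delta>>0. \<forall>\<epsilon>\<in>ball 0 \<delta>. f \<epsilon> \<noteq> 0"
proof -
  have "open (f -` (- {0}))" using open_vimage[OF _ assms(1), of "- {0}"] by auto
  then obtain \<delta> where "\<delta> > 0" "ball 0 \<delta> \<subseteq> f -` (- {0})"
    using assms(2) open_contains_ball by (metis ComplI singletonD vimageI2)
  then show ?thesis by blast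
qed

lemma diff_field_gen_const: "(\<lambda>z. c) \<in> diff_field_gen V S"
  unfolding diff_field_gen_def by (rule InterI, drule CollectD, erule conjE) (rule diff_fieldD(2))

lemma restrict_fieldI: "f \<in> K \<Longrightarrow> holo V f \<Longrightarrow> f \<in> restrict_field V K"
  unfolding restrict_field_def
  by (intro CollectI conjI bexI[of _ f] generically_all holo_merom) (auto dest: holo_open)

lemma deform_chain_tower:
  assumes ch: "darboux_chain (ball p r) {pdx F, pdy F, \<lambda>z. fst (\<omega> z), \<lambda>z. snd (\<omega> z)} S" and r: "r > 0"
    and F: "holo U F" and \<omega>: "holo_form U \<omega>" and sub: "ball p r \<subseteq> U"
  shows "\<exists>D. darboux_ext (ball p r) (restrict_field (ball p r) (deform_field U F \<omega>)) D \<and> dring (ball p r) S \<subseteq> D"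
proof -
  let ?S0 = "{pdx F, pdy F, \<lambda>z. fst (\<omega> z), \<lambda>z. snd (\<omega> z)}" and ?B = "ball p r"
  let ?K = "restrict_field ?B (deform_field U F \<omega>)"
  have hw: "holo U (pdx F)" "holo U (pdy F)" "holo U (\<lambda>z. fst (\<omega> z))" "holo U (\<lambda>z. snd (\<omega> z))"
    using holo_pdx[OF F] holo_pdy[OF F] \<omega> unfolding holo_form_def by simp_all
  have hU: "holo U s" if "s \<in> ?S0" for s
    using that hw by (elim insertE emptyE) simp_all
  have hB: "holo ?B s" if "s \<in> ?S0" for s by (rule holo_subset[OF hU[OF that] open_ball sub])
  have sK: "?S0 \<subseteq> deform_field U F \<omega>"
    unfolding deform_field_def diff_field_gen_def by (rule Inter_greatest) simp
  have S0K: "?S0 \<subseteq> ?K"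
  proof
    fix s assume s: "s \<in> ?S0"
    show "s \<in> ?K" by (rule restrict_fieldI[OF subsetD[OF sK s] hB[OF s]])
  qed
  have cK: "(\<lambda>z. c) \<in> ?K" for c
    by (rule restrict_fieldI[OF _ holo_const[OF open_ball]]) (simp add: deform_field_def diff_field_gen_const)
  have ne: "?B \<noteq> {}" using r by simp
  have "\<exists>T. darboux_ext ?B ?K (diff_field_gen ?B T) \<and> S \<subseteq> diff_field_gen ?B T"
    by (rule darboux_chain_tower[OF ch open_ball ne hB S0K cK])
  then obtain T where T: "darboux_ext ?B ?K (diff_field_gen ?B T)" "S \<subseteq> diff_field_gen ?B T" by (elim exE conjE) (rule that)
  have "dring ?B S \<subseteq> diff_field_gen ?B T"
  proof
    fix f assume "f \<in> dring ?B S"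
    then show "f \<in> diff_field_gen ?B T"
      by (rule dring_diff_field_gen[OF _ open_ball T(2)]) (rule darboux_chain_holo[OF ch hB])
  qed
  with T(1) show ?thesis by (intro exI[of _ "diff_field_gen ?B T"] conjI)
qed

lemma wedge_cscale_self: "wedge (cscale c v) v = 0"
  by (simp add: wedge_def cscale_def)

lemma univalued_branch: "branch (\<lambda>c. g (pathfinish c)) c = g"
  by (simp add: branch_def fun_eq_iff)

text \<open>A univalued function, regarded as a function of paths, depends on the endpoint only, and each of its branches is the
function itself. The clauses on paths thus become statements on \<open>M\<close> and \<open>G\<close>.\<close>

lemma univalued_integrating_factor:
  assumes U': "open U'" and p: "p \<in> U'"
    and hM: "\<And>\<epsilon>. \<epsilon> \<in> ball 0 \<delta> \<Longrightarrow> holo U' (M \<epsilon>)" and hG: "\<And>\<epsilon>. \<epsilon> \<in> ball 0 \<delta> \<Longrightarrow> holo U' (G \<epsilon>)"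
    and dG: "\<And>\<epsilon> z. \<epsilon> \<in> ball 0 \<delta> \<Longrightarrow> z \<in> U' \<Longrightarrow> d0 (G \<epsilon>) z = cscale (M \<epsilon> z) (\<eta> \<epsilon> z)"
    and gen: "\<And>\<epsilon>. \<epsilon> \<in> ball 0 \<delta> \<Longrightarrow> generically U' (\<lambda>z. d0 (M \<epsilon>) z = cscale (M \<epsilon> z) (\<theta> \<epsilon> z))"
    and eM: "\<And>z. z \<in> U' \<Longrightarrow> (\<lambda>\<epsilon>. M \<epsilon> z) holomorphic_on ball 0 \<delta>"
    and eG: "\<And>z. z \<in> U' \<Longrightarrow> (\<lambda>\<epsilon>. G \<epsilon> z) holomorphic_on ball 0 \<delta>"
    and \<rho>: "\<rho> > 0" "ball p \<rho> \<subseteq> U'" and q: "q \<in> ball p \<rho>"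
    and nc: "\<And>\<epsilon>. \<epsilon> \<in> ball 0 \<delta> \<Longrightarrow> G \<epsilon> q \<noteq> G \<epsilon> p"
    and L: "liouville_ext (ball p \<rho>) K L" and D: "darboux_ext (ball p \<rho>) L D"
    and inL: "\<And>\<epsilon>. \<epsilon> \<in> ball 0 \<delta> \<Longrightarrow> M \<epsilon> \<in> L" and GD: "\<And>\<epsilon>. \<epsilon> \<in> ball 0 \<delta> \<Longrightarrow> G \<epsilon> \<in> D"
    and Kdef: "K = restrict_field (ball p \<rho>) K0"
  shows "\<exists>p\<in>U'. \<exists>f Ft :: complex \<Rightarrow> (real \<Rightarrow> C2) \<Rightarrow> complex.
                (\<forall>\<epsilon>\<in>ball 0 \<delta>.
                   mv_holo U' p (f \<epsilon>) \<and>
                   mv_first_integral U' p (\<eta> \<epsilon>) (Ft \<epsilon>) \<and>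
                   (\<forall>c\<in>paths_from U' p.
                      mv_d (Ft \<epsilon>) c = cscale (f \<epsilon> c) (\<eta> \<epsilon> (pathfinish c))) \<and>
                   generically U' (\<lambda>z. \<forall>c\<in>paths_from U' p. pathfinish c = z \<longrightarrow>
                      mv_d (f \<epsilon>) c = cscale (f \<epsilon> c) (\<theta> \<epsilon> z))) \<and>
                (\<forall>c\<in>paths_from U' p. (\<lambda>\<epsilon>. f \<epsilon> c) holomorphic_on ball 0 \<delta> \<and>
                   (\<lambda>\<epsilon>. Ft \<epsilon> c) holomorphic_on ball 0 \<delta>) \<and>
                (\<exists>\<rho>>0. ball p \<rho> \<subseteq> U' \<and>
                  (\<exists>L D. liouville_ext (ball p \<rho>) (restrict_field (ball p \<rho>) K0) L \<and>
                         darboux_ext (ball p \<rho>) L D \<and>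
                         (\<forall>\<epsilon>\<in>ball 0 \<delta>. (\<lambda>z. f \<epsilon> (linepath p z)) \<in> L \<and>
                                        (\<lambda>z. Ft \<epsilon> (linepath p z)) \<in> D)))"
proof -
  define f where "f \<epsilon> c = M \<epsilon> (pathfinish c)" for \<epsilon> and c :: "real \<Rightarrow> C2"
  define Ft where "Ft \<epsilon> c = G \<epsilon> (pathfinish c)" for \<epsilon> and c :: "real \<Rightarrow> C2"
  have fin: "pathfinish c \<in> U'" if "c \<in> paths_from U' p" for c
  proof -
    have "path_image c \<subseteq> U'" using that by (simp add: paths_from_def)
    then show ?thesis by (rule subsetD) (rule pathfinish_in_path_image)
  qed
  have mv: "mv_holo U' p (\<lambda>c. g (pathfinish c))" if g: "holo U' g" for g
    unfolding mv_holo_def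
  proof (intro conjI allI impI ballI)
    fix c c' assume "pathstart c = p \<and> homotopic_paths U' c c'"
    then have "pathfinish c = pathfinish c'" by (intro homotopic_paths_imp_pathfinish[of U']) (rule conjunct2)
    then show "g (pathfinish c) = g (pathfinish c')" by simp
  next
    fix c assume c: "c \<in> paths_from U' p"
    obtain r where r: "r > 0" "ball (pathfinish c) r \<subseteq> U'"
      by (rule openE[OF U' fin[OF c]]) (rule that)
    have "holo (ball (pathfinish c) r) (branch (\<lambda>c. g (pathfinish c)) c)"
      unfolding univalued_branch by (rule holo_subset[OF g open_ball r(2)])
    then show "\<exists>\<rho>>0. ball (pathfinish c) \<rho> \<subseteq> U' \<and> holo (ball (pathfinish c) \<rho>) (branch (\<lambda>c. g (pathfinish c)) c)"
      by (intro exI[of _ r] conjI r)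
  qed
  have df: "mv_d (f \<epsilon>) c = d0 (M \<epsilon>) (pathfinish c)" and dFt: "mv_d (Ft \<epsilon>) c = d0 (G \<epsilon>) (pathfinish c)" for \<epsilon> c
    unfolding mv_d_def f_def[abs_def] Ft_def[abs_def] univalued_branch by simp_all
  have line: "linepath p z \<in> paths_from U' p" if "z \<in> ball p \<rho>" for z
  proof -
    have "p \<in> ball p \<rho>" using \<rho>(1) by simp
    then have "closed_segment p z \<subseteq> ball p \<rho>"
      by (rule closed_segment_subset[OF _ that convex_ball])
    then have "path_image (linepath p z) \<subseteq> U'" unfolding path_image_linepath by (rule subset_trans[OF _ \<rho>(2)])
    then show ?thesis by (simp add: paths_from_def)
  qed
  have A: "mv_holo U' p (f \<epsilon>) \<and> mv_first_integral U' p (\<eta> \<epsilon>) (Ft \<epsilon>) \<and>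
       (\<forall>c\<in>paths_from U' p. mv_d (Ft \<epsilon>) c = cscale (f \<epsilon> c) (\<eta> \<epsilon> (pathfinish c))) \<and>
       generically U' (\<lambda>z. \<forall>c\<in>paths_from U' p. pathfinish c = z \<longrightarrow> mv_d (f \<epsilon>) c = cscale (f \<epsilon> c) (\<theta> \<epsilon> z))"
    if e: "\<epsilon> \<in> ball 0 \<delta>" for \<epsilon>
  proof (intro conjI)
    show "mv_holo U' p (f \<epsilon>)" unfolding f_def[abs_def] by (rule mv[OF hM[OF e]])
    show d: "\<forall>c\<in>paths_from U' p. mv_d (Ft \<epsilon>) c = cscale (f \<epsilon> c) (\<eta> \<epsilon> (pathfinish c))"
      using dG[OF e fin] by (simp add: dFt f_def)
    show "mv_first_integral U' p (\<eta> \<epsilon>) (Ft \<epsilon>)"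
      unfolding mv_first_integral_def
    proof (intro conjI)
      show "mv_holo U' p (Ft \<epsilon>)" unfolding Ft_def[abs_def] by (rule mv[OF hG[OF e]])
      show "\<forall>c\<in>paths_from U' p. wedge (mv_d (Ft \<epsilon>) c) (\<eta> \<epsilon> (pathfinish c)) = 0"
        using d by (simp add: wedge_cscale_self)
      show "\<not> Ft \<epsilon> constant_on paths_from U' p"
      proof
        assume "Ft \<epsilon> constant_on paths_from U' p"
        then obtain y where y: "\<forall>x\<in>paths_from U' p. Ft \<epsilon> x = y" unfolding constant_on_def by (rule exE)
        have p0: "p \<in> ball p \<rho>" using \<rho>(1) by simp
        have "G \<epsilon> q = G \<epsilon> p"
          using bspec[OF y line[OF q]] bspec[OF y line[OF p0]] by (simp add: Ft_def)
        then show False using nc[OF e] by (rule notE[rotated])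
      qed
    qed
    obtain W where W: "open W" "W \<subseteq> U'" "U' \<subseteq> closure W" "\<forall>z\<in>W. d0 (M \<epsilon>) z = cscale (M \<epsilon> z) (\<theta> \<epsilon> z)"
      using gen[OF e] unfolding generically_def by (elim exE conjE) (rule that)
    show "generically U' (\<lambda>z. \<forall>c\<in>paths_from U' p. pathfinish c = z \<longrightarrow> mv_d (f \<epsilon>) c = cscale (f \<epsilon> c) (\<theta> \<epsilon> z))"
      unfolding generically_def df f_def by (intro exI[of _ W] conjI W(1-3) ballI impI) (simp add: bspec[OF W(4)])
  qed
  have B: "(\<lambda>\<epsilon>. f \<epsilon> c) holomorphic_on ball 0 \<delta> \<and> (\<lambda>\<epsilon>. Ft \<epsilon> c) holomorphic_on ball 0 \<delta>" if "c \<in> paths_from U' p" for c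
    unfolding f_def Ft_def by (rule conjI[OF eM[OF fin[OF that]] eG[OF fin[OF that]]])
  have fl: "(\<lambda>z. f \<epsilon> (linepath p z)) = M \<epsilon>" "(\<lambda>z. Ft \<epsilon> (linepath p z)) = G \<epsilon>" for \<epsilon>
    by (simp_all add: f_def Ft_def)
  have C: "\<exists>L D. liouville_ext (ball p \<rho>) (restrict_field (ball p \<rho>) K0) L \<and> darboux_ext (ball p \<rho>) L D \<and>
      (\<forall>\<epsilon>\<in>ball 0 \<delta>. (\<lambda>z. f \<epsilon> (linepath p z)) \<in> L \<and> (\<lambda>z. Ft \<epsilon> (linepath p z)) \<in> D)"
    unfolding fl by (intro exI[of _ L] exI[of _ D] conjI ballI inL GD L[unfolded Kdef] D)
  show ?thesis
    by (rule bexI[OF _ p], rule exI[of _ f], rule exI[of _ Ft], rule conjI, rule ballI, erule A,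
        rule conjI, rule ballI, erule B, rule exI[of _ \<rho>], rule conjI, rule \<rho>(1), rule conjI, rule \<rho>(2), rule C)
qed

section \<open>The deformed first integral of a Francoise sequence\<close>

text \<open>The telescoping sum behind the first integral; \<open>a\<close> and \<open>b\<close> stand for a coefficient of \<open>dF\<close> and of \<open>\<omega>\<close>.\<close>

lemma deformed_francoise_sum:
  fixes a b :: complex and G :: "nat \<Rightarrow> complex"
  assumes "G 0 = 1"
  shows "a + (\<Sum>i\<le>n. \<epsilon> ^ Suc i * ((-1) ^ i * (G i * b - G (Suc i) * a))) =
    (\<Sum>i\<le>n. (- \<epsilon>) ^ i * G i) * (a + \<epsilon> * b) + (- \<epsilon>) ^ Suc n * G (Suc n) * a"
proof (induction n)
  case 0
  then show ?case using assms by (simp add: algebra_simps)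
next
  case (Suc n)
  have e: "\<epsilon> ^ Suc (Suc n) * ((-1) ^ Suc n * y) = \<epsilon> * ((- \<epsilon>) ^ Suc n * y)" for y
    by (simp add: power_minus[of \<epsilon>])
  show ?case unfolding sum.atMost_Suc add.assoc[symmetric] Suc e by (simp add: algebra_simps)
qed

definition deformed_integral_coeff :: "(C2 \<Rightarrow> complex) \<Rightarrow> (nat \<Rightarrow> C2 \<Rightarrow> complex) \<Rightarrow> nat \<Rightarrow> C2 \<Rightarrow> complex" where
  "deformed_integral_coeff F r k = (case k of 0 \<Rightarrow> F | Suc i \<Rightarrow> (\<lambda>z. (-1) ^ i * r (Suc i) z))"

definition deformed_integral :: "(C2 \<Rightarrow> complex) \<Rightarrow> (nat \<Rightarrow> C2 \<Rightarrow> complex) \<Rightarrow> nat \<Rightarrow> complex \<Rightarrow> C2 \<Rightarrow> complex" where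
  "deformed_integral F r m \<epsilon> z = (\<Sum>i\<le>m. \<epsilon> ^ i * deformed_integral_coeff F r i z)"

definition integrating_factor :: "(nat \<Rightarrow> C2 \<Rightarrow> complex) \<Rightarrow> nat \<Rightarrow> complex \<Rightarrow> C2 \<Rightarrow> complex" where
  "integrating_factor g l \<epsilon> z = (\<Sum>i\<le>l. (- \<epsilon>) ^ i * g i z)"

lemma francoise_holo:
  assumes "francoise_seq U F \<omega> g r" "open U"
  shows "holo U (g i)"
proof (cases i)
  case 0
  have "holo U (\<lambda>z. 1)" by (rule holo_const[OF assms(2)])
  then show ?thesis unfolding 0 by (rule holo_cong) (use assms(1) in \<open>simp add: francoise_seq_def\<close>)
qed (use assms(1) in \<open>simp add: francoise_seq_def\<close>)

lemma francoise_step: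
  assumes "francoise_seq U F \<omega> g r"
  shows "holo U (r (Suc i))" "z \<in> U \<Longrightarrow> pdx (r (Suc i)) z = g i z * fst (\<omega> z) - g (Suc i) z * pdx F z"
    "z \<in> U \<Longrightarrow> pdy (r (Suc i)) z = g i z * snd (\<omega> z) - g (Suc i) z * pdy F z"
proof -
  have *: "holo U (r (Suc i)) \<and> (\<forall>z\<in>U. cscale (g i z) (\<omega> z) = cscale (g (Suc i) z) (d0 F z) + d0 (r (Suc i)) z)"
    using assms unfolding francoise_seq_def by (elim conjE allE[of _ "Suc i"]) simp
  then show "holo U (r (Suc i))" by (rule conjunct1)
  assume "z \<in> U"
  then have "cscale (g i z) (\<omega> z) = cscale (g (Suc i) z) (d0 F z) + d0 (r (Suc i)) z" using conjunct2[OF *] by simp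
  then show "pdx (r (Suc i)) z = g i z * fst (\<omega> z) - g (Suc i) z * pdx F z"
    and "pdy (r (Suc i)) z = g i z * snd (\<omega> z) - g (Suc i) z * pdy F z"
    by (simp_all add: cscale_def d0_def plus_prod_def)
qed

lemma pd_cmult:
  assumes "holo U f" "z \<in> U"
  shows "pdx (\<lambda>z. c * f z) z = c * pdx f z" "pdy (\<lambda>z. c * f z) z = c * pdy f z"
  using pd_mult[OF holo_const[OF holo_open[OF assms(1)]] assms, of c] by simp_all

lemma deformed_integral_coeff_holo: "holo U F \<Longrightarrow> francoise_seq U F \<omega> g r \<Longrightarrow> holo U (deformed_integral_coeff F r k)"
  using holo_mult[OF holo_const[OF holo_open] francoise_step(1)]
  by (cases k) (simp_all add: deformed_integral_coeff_def)

lemma deformed_integral_coeff_pd: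
  assumes "francoise_seq U F \<omega> g r" "z \<in> U"
  shows "pdx (deformed_integral_coeff F r (Suc i)) z = (-1) ^ i * (g i z * fst (\<omega> z) - g (Suc i) z * pdx F z)"
    "pdy (deformed_integral_coeff F r (Suc i)) z = (-1) ^ i * (g i z * snd (\<omega> z) - g (Suc i) z * pdy F z)"
  unfolding deformed_integral_coeff_def nat.case pd_cmult[OF francoise_step(1)[OF assms(1)] assms(2)] francoise_step(2,3)[OF assms]
  by (rule refl)+

lemma deformed_integral_holo: "holo U F \<Longrightarrow> francoise_seq U F \<omega> g r \<Longrightarrow> holo U (deformed_integral F r m \<epsilon>)"
  unfolding deformed_integral_def[abs_def] by (intro holo_sum holo_mult holo_const deformed_integral_coeff_holo) (auto dest: holo_open)

lemma integrating_factor_holo: "open U \<Longrightarrow> francoise_seq U F \<omega> g r \<Longrightarrow> holo U (integrating_factor g l \<epsilon>)"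
  unfolding integrating_factor_def[abs_def] by (intro holo_sum holo_mult holo_const francoise_holo) auto

lemma deformed_integral_integrating_factor:
  assumes F: "holo U F" and fs: "francoise_seq U F \<omega> g r" and len: "\<And>z. z \<in> U \<Longrightarrow> g (Suc l) z = 0" and z: "z \<in> U"
  shows "d0 (deformed_integral F r (Suc l) \<epsilon>) z = cscale (integrating_factor g l \<epsilon> z) (deform F \<omega> \<epsilon> z)"
proof -
  have U: "open U" by (rule holo_open[OF F])
  have h: "holo U (\<lambda>z. \<epsilon> ^ i * deformed_integral_coeff F r i z)" for i
    by (intro holo_mult holo_const[OF U] deformed_integral_coeff_holo[OF F fs])
  have g0: "g 0 z = 1" using fs z unfolding francoise_seq_def by simp
  note xy = deformed_integral_coeff_pd[OF fs z]
  have f0: "deformed_integral_coeff F r 0 = F" by (simp add: deformed_integral_coeff_def)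
  have "pdx (deformed_integral F r (Suc l) \<epsilon>) z = (\<Sum>i\<le>Suc l. \<epsilon> ^ i * pdx (deformed_integral_coeff F r i) z)"
    unfolding deformed_integral_def[abs_def] pd_sum(1)[OF h z] by (simp only: pd_cmult(1)[OF deformed_integral_coeff_holo[OF F fs] z])
  also have "\<dots> = pdx F z + (\<Sum>i\<le>l. \<epsilon> ^ Suc i * ((-1) ^ i * (g i z * fst (\<omega> z) - g (Suc i) z * pdx F z)))"
    unfolding sum.atMost_Suc_shift xy f0 by simp
  also have "\<dots> = integrating_factor g l \<epsilon> z * (pdx F z + \<epsilon> * fst (\<omega> z))"
    using deformed_francoise_sum[of "\<lambda>i. g i z", OF g0, of "pdx F z" \<epsilon> "fst (\<omega> z)" l] len[OF z] by (simp add: integrating_factor_def)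
  finally have X: "pdx (deformed_integral F r (Suc l) \<epsilon>) z = integrating_factor g l \<epsilon> z * (pdx F z + \<epsilon> * fst (\<omega> z))" .
  have "pdy (deformed_integral F r (Suc l) \<epsilon>) z = (\<Sum>i\<le>Suc l. \<epsilon> ^ i * pdy (deformed_integral_coeff F r i) z)"
    unfolding deformed_integral_def[abs_def] pd_sum(2)[OF h z] by (simp only: pd_cmult(2)[OF deformed_integral_coeff_holo[OF F fs] z])
  also have "\<dots> = pdy F z + (\<Sum>i\<le>l. \<epsilon> ^ Suc i * ((-1) ^ i * (g i z * snd (\<omega> z) - g (Suc i) z * pdy F z)))"
    unfolding sum.atMost_Suc_shift xy f0 by simp
  also have "\<dots> = integrating_factor g l \<epsilon> z * (pdy F z + \<epsilon> * snd (\<omega> z))"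
    using deformed_francoise_sum[of "\<lambda>i. g i z", OF g0, of "pdy F z" \<epsilon> "snd (\<omega> z)" l] len[OF z] by (simp add: integrating_factor_def)
  finally show ?thesis using X by (simp add: d0_def deform_def cscale_def)
qed

lemma deform_comp: "deform F \<omega> \<epsilon> z = (pdx F z + \<epsilon> * fst (\<omega> z), pdy F z + \<epsilon> * snd (\<omega> z))"
  by (simp add: deform_def d0_def cscale_def)

text \<open>The form \<open>\<theta>\<close> is the logarithmic differential of \<open>M\<close>, hence closed where \<open>M \<noteq> 0\<close>; and \<open>d(M \<eta>) = d(dG) = 0\<close> is the
other equation.\<close>

lemma integrating_factor_godbillon_vey:
  assumes con: "connected U" and M: "holo U M" and z0: "z0 \<in> U" "M z0 \<noteq> 0" and G: "holo U G" and \<eta>: "holo_form U \<eta>"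
    and dG: "\<And>z. z \<in> U \<Longrightarrow> d0 G z = cscale (M z) (\<eta> z)"
  defines "\<theta> \<equiv> \<lambda>z. cscale (inverse (M z)) (d0 M z)"
  shows "merom_form U \<theta>" "godbillon_vey2 U \<eta> \<theta>"
    "\<And>V. open V \<Longrightarrow> V \<subseteq> U \<Longrightarrow> generically V (\<lambda>z. d0 M z = cscale (M z) (\<theta> z))"
proof -
  have U: "open U" by (rule holo_open[OF M])
  have h\<eta>: "holo U (\<lambda>z. fst (\<eta> z))" "holo U (\<lambda>z. snd (\<eta> z))" using \<eta> unfolding holo_form_def by simp_all
  note gn = generically_nonzero[OF M con z0]
  have m: "merom U (\<lambda>z. inverse (M z) * a z)" if a: "holo U a" for a
    unfolding merom_def
  proof
    fix p assume p: "p \<in> U"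
    show "\<exists>W a' b. p \<in> W \<and> W \<subseteq> U \<and> holo W a' \<and> holo W b \<and> generically W (\<lambda>z. b z \<noteq> 0) \<and>
       (\<forall>z\<in>W. b z \<noteq> 0 \<longrightarrow> inverse (M z) * a z = a' z / b z)"
      by (intro exI[of _ U] exI[of _ a] exI[of _ M] conjI p subset_refl a M gn[OF U subset_refl] ballI impI)
        (simp_all add: field_simps)
  qed
  show "merom_form U \<theta>"
    unfolding merom_form_def \<theta>_def cscale_def d0_def fst_conv snd_conv
    by (intro conjI m holo_pdx[OF M] holo_pdy[OF M])
  show "generically V (\<lambda>z. d0 M z = cscale (M z) (\<theta> z))" if "open V" "V \<subseteq> U" for V
    by (rule gn[OF that]) (simp add: \<theta>_def cscale_def d0_def)
  let ?W = "{z \<in> U. M z \<noteq> 0}"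
  have W: "open ?W" "?W \<subseteq> U" using open_nonzero[OF M] by auto
  have "d1 \<eta> z = wedge (\<eta> z) (\<theta> z) \<and> d1 \<theta> z = 0" if z: "z \<in> U" "M z \<noteq> 0" for z
  proof
    have gx: "pdx G w = M w * fst (\<eta> w)" and gy: "pdy G w = M w * snd (\<eta> w)" if "w \<in> U" for w
      using dG[OF that] by (simp_all add: d0_def cscale_def)
    have "pdy (pdx G) z = pdy M z * fst (\<eta> z) + M z * pdy (\<lambda>w. fst (\<eta> w)) z"
      using pd_cong(2)[OF U z(1), of "pdx G", OF gx] pd_mult(2)[OF M h\<eta>(1) z(1)] by simp
    moreover have "pdx (pdy G) z = pdx M z * snd (\<eta> z) + M z * pdx (\<lambda>w. snd (\<eta> w)) z"
      using pd_cong(1)[OF U z(1), of "pdy G", OF gy] pd_mult(1)[OF M h\<eta>(2) z(1)] by simp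
    ultimately have "M z * (pdx (\<lambda>w. snd (\<eta> w)) z - pdy (\<lambda>w. fst (\<eta> w)) z) = pdy M z * fst (\<eta> z) - pdx M z * snd (\<eta> z)"
      using pd_commute[OF G z(1)] by (simp add: algebra_simps)
    then show "d1 \<eta> z = wedge (\<eta> z) (\<theta> z)"
      using z(2) by (simp add: d1_def wedge_def \<theta>_def cscale_def d0_def field_simps)
    have zW: "z \<in> ?W" using z by simp
    have hI: "holo ?W (\<lambda>w. inverse (M w))" by (rule holo_inverse[OF holo_subset[OF M W]]) simp
    have hx: "holo ?W (\<lambda>w. fst (\<theta> w))" and hy: "holo ?W (\<lambda>w. snd (\<theta> w))"
      unfolding \<theta>_def cscale_def d0_def fst_conv snd_conv
      by (intro holo_mult hI holo_subset[OF holo_pdx[OF M] W] holo_subset[OF holo_pdy[OF M] W])+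
    have tx: "pdx M w = M w * fst (\<theta> w)" and ty: "pdy M w = M w * snd (\<theta> w)" if "w \<in> ?W" for w
      using that by (simp_all add: \<theta>_def cscale_def d0_def)
    have "pdy (pdx M) z = pdy M z * fst (\<theta> z) + M z * pdy (\<lambda>w. fst (\<theta> w)) z"
      using pd_cong(2)[OF W(1) zW, of "pdx M", OF tx] pd_mult(2)[OF holo_subset[OF M W] hx zW] by simp
    moreover have "pdx (pdy M) z = pdx M z * snd (\<theta> z) + M z * pdx (\<lambda>w. snd (\<theta> w)) z"
      using pd_cong(1)[OF W(1) zW, of "pdy M", OF ty] pd_mult(1)[OF holo_subset[OF M W] hy zW] by simp
    ultimately have "M z * d1 \<theta> z = 0"
      using pd_commute[OF M z(1)] tx[OF zW] ty[OF zW] by (simp add: d1_def algebra_simps)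
    then show "d1 \<theta> z = 0" using z(2) by simp
  qed
  then show "godbillon_vey2 U \<eta> \<theta>"
    unfolding godbillon_vey2_def by (intro conjI gn[OF U subset_refl]) blast+
qed

text \<open>In the frame dual to \<open>dF\<close>, \<open>\<omega>\<close> the Francoise relations become \<open>X F\<^sub>k = (-1)\<^sup>k g\<^sub>k\<close> and \<open>Y F\<^sub>k\<^sub>+\<^sub>1 = (-1)\<^sup>k g\<^sub>k\<close>, so the \<open>F\<^sub>k\<close>
are the coefficients of a polynomial first integral; its degree is finite because \<open>g\<^sub>l\<^sub>+\<^sub>1 = 0\<close>.\<close>

lemma deformed_integral_darboux:
  assumes F: "holo U F" and \<omega>: "holo_form U \<omega>" and fs: "francoise_seq U F \<omega> g r"
    and len: "\<And>z. z \<in> U \<Longrightarrow> g (Suc l) z = 0"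
    and V: "open V" "V \<noteq> {}" "V \<subseteq> U" and nd: "\<And>z. z \<in> V \<Longrightarrow> wedge (d0 F z) (\<omega> z) \<noteq> 0"
  shows "\<exists>p \<rho> S. \<rho> > 0 \<and> ball p \<rho> \<subseteq> V \<and> darboux_chain (ball p \<rho>) {pdx F, pdy F, \<lambda>z. fst (\<omega> z), \<lambda>z. snd (\<omega> z)} S \<and>
    (\<forall>k\<le>Suc l. deformed_integral_coeff F r k \<in> dring (ball p \<rho>) S) \<and> (\<forall>k\<le>l. g k \<in> dring (ball p \<rho>) S)"
proof -
  let ?w1 = "\<lambda>z. fst (\<omega> z)" and ?w2 = "\<lambda>z. snd (\<omega> z)"
  have w: "holo U ?w1" "holo U ?w2" using \<omega> unfolding holo_form_def by simp_all
  interpret pencil V F ?w1 ?w2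
  proof
    show "holo V F" "holo V ?w1" "holo V ?w2" by (rule holo_subset[OF _ V(1,3)], fact)+
    show "pdx F z * snd (\<omega> z) - pdy F z * fst (\<omega> z) \<noteq> 0" if "z \<in> V" for z
      using nd[OF that] by (simp add: wedge_def d0_def)
  qed
  have XY: "X f z = \<alpha> \<and> Y f z = \<beta>"
    if "z \<in> V" "pdx f z = \<alpha> * pdx F z + \<beta> * fst (\<omega> z)" "pdy f z = \<alpha> * pdy F z + \<beta> * snd (\<omega> z)" for f z \<alpha> \<beta>
  proof -
    have D: "pdx F z * snd (\<omega> z) - pdy F z * fst (\<omega> z) \<noteq> 0" by (rule nondeg[OF that(1)])
    show ?thesis
      unfolding X_def Y_def vderiv_def aX_def bX_def aY_def bY_def Delta_def that(2,3)
      using D by (simp add: divide_simps) (simp add: algebra_simps)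
  qed
  have h: "holo V (deformed_integral_coeff F r k)" for k by (rule holo_subset[OF deformed_integral_coeff_holo[OF F fs] V(1,3)])
  have g0: "g 0 z = 1" if "z \<in> V" for z using fs V(3) that unfolding francoise_seq_def by auto
  have S: "X (deformed_integral_coeff F r (Suc k)) z = (-1) ^ Suc k * g (Suc k) z \<and> Y (deformed_integral_coeff F r (Suc k)) z = (-1) ^ k * g k z"
    if z: "z \<in> V" for k z
  proof (rule XY[OF z])
    have zU: "z \<in> U" using z V(3) by (rule subsetD[rotated])
    show "pdx (deformed_integral_coeff F r (Suc k)) z = (-1) ^ Suc k * g (Suc k) z * pdx F z + (-1) ^ k * g k z * fst (\<omega> z)"
      unfolding deformed_integral_coeff_pd[OF fs zU] by (simp add: algebra_simps)
    show "pdy (deformed_integral_coeff F r (Suc k)) z = (-1) ^ Suc k * g (Suc k) z * pdy F z + (-1) ^ k * g k z * snd (\<omega> z)"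
      unfolding deformed_integral_coeff_pd[OF fs zU] by (simp add: algebra_simps)
  qed
  have X: "X (deformed_integral_coeff F r k) z = (-1) ^ k * g k z" if "z \<in> V" for k z
    using S[OF that] XF[OF that] g0[OF that] by (cases k) (simp_all add: deformed_integral_coeff_def)
  define P where "P z = (\<Sum>k\<le>Suc l. monom (deformed_integral_coeff F r k z) k)" for z
  have cP: "coeff (P z) k = (if k \<le> Suc l then deformed_integral_coeff F r k z else 0)" for z k
    unfolding P_def coeff_sum coeff_monom by (simp add: sum.delta)
  have cPf: "(\<lambda>z. coeff (P z) k) = (if k \<le> Suc l then deformed_integral_coeff F r k else (\<lambda>z. 0))" for k
    by (simp add: cP fun_eq_iff)
  have HP: "pencil_integral V (Suc l) P"
    unfolding pencil_integral_def
  proof (intro conjI allI ballI V(1) subset_refl)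
    show "degree (P z) \<le> Suc l" for z by (rule degree_le) (simp add: cP)
    show "holo V (\<lambda>z. coeff (P z) k)" for k using h holo_const[OF V(1)] by (simp add: cPf)
    show "Y (\<lambda>z. coeff (P z) 0) z = 0" if "z \<in> V" for z using YF[OF that] by (simp add: cPf deformed_integral_coeff_def)
    show "Y (\<lambda>z. coeff (P z) (Suc k)) z = X (\<lambda>z. coeff (P z) k) z" if z: "z \<in> V" for z k
    proof -
      have "X (deformed_integral_coeff F r (Suc l)) z = 0" using X[OF z] len[of z] V(3) z by auto
      moreover have "X (\<lambda>z. 0) z = 0" "Y (\<lambda>z. 0) z = 0" by (simp_all add: X_def Y_def)
      ultimately show ?thesis using S[OF z] X[OF z] by (cases "k \<le> l"; cases "k = Suc l") (simp_all add: cPf)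
    qed
  qed
  have P0: "coeff (P z) 0 = F z" for z by (simp add: cP deformed_integral_coeff_def)
  obtain p \<rho> S where *: "\<rho> > 0" "ball p \<rho> \<subseteq> V" "darboux_chain (ball p \<rho>) S0 S" "\<forall>k. (\<lambda>z. coeff (P z) k) \<in> dring (ball p \<rho>) S"
    using polynomial_first_integral_darboux[OF HP P0 V(2)] by (elim exE conjE) (rule that)
  have Fk: "deformed_integral_coeff F r k \<in> dring (ball p \<rho>) S" if "k \<le> Suc l" for k
    using spec[OF *(4), of k] that by (simp add: cPf)
  have "g k \<in> dring (ball p \<rho>) S" if k: "k \<le> l" for k
  proof (rule dring.cong)
    show "(\<lambda>z. (-1) ^ k * X (deformed_integral_coeff F r k) z) \<in> dring (ball p \<rho>) S"
      by (intro dring.mult dring.const XY_dring(1) *(2) darboux_chain_sub[OF *(3)] Fk) (use k in simp)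
    show "g k z = (-1) ^ k * X (deformed_integral_coeff F r k) z" if "z \<in> ball p \<rho>" for z
      using X[OF subsetD[OF *(2) that]] by (simp flip: power_mult_distrib mult.assoc)
  qed
  then show ?thesis using *(1,2,3) Fk unfolding S0_def
    by (intro exI[of _ p] exI[of _ \<rho>] exI[of _ S] conjI allI impI)
qed

text \<open>With \<open>\<omega> = h dF\<close> the relations read \<open>dr\<^sub>i\<^sub>+\<^sub>1 = (h g\<^sub>i - g\<^sub>i\<^sub>+\<^sub>1) dF\<close>, so \<open>g\<^sub>i\<^sub>+\<^sub>1 = h g\<^sub>i + b\<^sub>i\<^sub>+\<^sub>1\<close> with \<open>b\<^sub>i\<^sub>+\<^sub>1\<close> constant along the
leaves. Iteration writes \<open>g\<^sub>l\<^sub>+\<^sub>1 = 0\<close> as a monic equation for \<open>h\<close> over such functions.\<close>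

lemma degenerate_transverse_factor:
  assumes F: "holo U F" and dF: "\<And>z. z \<in> U \<Longrightarrow> d0 F z \<noteq> 0" and \<omega>: "holo_form U \<omega>" and fs: "francoise_seq U F \<omega> g r"
    and len: "\<And>z. z \<in> U \<Longrightarrow> g (Suc l) z = 0"
    and dg: "\<And>z. z \<in> U \<Longrightarrow> wedge (d0 F z) (\<omega> z) = 0"
  shows "\<exists>h. holo U h \<and> (\<forall>z\<in>U. \<omega> z = cscale (h z) (d0 F z)) \<and> (\<forall>z\<in>U. leaf_deriv F h z = 0)"
proof -
  have U: "open U" by (rule holo_open[OF F])
  have w: "holo U (\<lambda>z. fst (\<omega> z))" "holo U (\<lambda>z. snd (\<omega> z))" using \<omega> unfolding holo_form_def by simp_all
  have dF': "pdx F z \<noteq> 0 \<or> pdy F z \<noteq> 0" if "z \<in> U" for z using dF[OF that] by (simp add: d0_def zero_prod_def)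
  have pr: "pdx F z * snd (\<omega> z) = pdy F z * fst (\<omega> z)" if "z \<in> U" for z
    using dg[OF that] by (simp add: wedge_def d0_def)
  have "\<exists>h. holo U h \<and> (\<forall>z\<in>U. fst (\<omega> z) = h z * pdx F z \<and> snd (\<omega> z) = h z * pdy F z)"
    by (rule proportional_form[OF F dF' w pr])
  then obtain h where h: "holo U h" "\<forall>z\<in>U. fst (\<omega> z) = h z * pdx F z \<and> snd (\<omega> z) = h z * pdy F z"
    by (elim exE conjE) (rule that)
  define b where "b j z = (case j of 0 \<Rightarrow> 1 | Suc i \<Rightarrow> g (Suc i) z - h z * g i z)" for j z
  have hb: "holo U (b j)" for j
    by (cases j) (simp_all add: b_def[abs_def] holo_const[OF U] holo_diff holo_mult h(1) francoise_holo[OF fs U])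
  have Tb: "leaf_deriv F (b j) z = 0" if z: "z \<in> U" for j z
  proof (cases j)
    case 0
    then show ?thesis by (simp add: b_def[abs_def] leaf_deriv_def)
  next
    case (Suc i)
    let ?q = "\<lambda>z. 0 - r (Suc i) z"
    have hq: "holo U ?q" by (intro holo_diff holo_const[OF U] francoise_step(1)[OF fs])
    show ?thesis
    proof (rule leaf_deriv_exact[OF F hq hb _ _ z])
      fix z assume z: "z \<in> U"
      show "pdx ?q z = b j z * pdx F z"
        unfolding pd_diff(1)[OF holo_const[OF U] francoise_step(1)[OF fs] z] francoise_step(2)[OF fs z]
        using bspec[OF h(2) z] by (simp add: Suc b_def algebra_simps)
      show "pdy ?q z = b j z * pdy F z"
        unfolding pd_diff(2)[OF holo_const[OF U] francoise_step(1)[OF fs] z] francoise_step(3)[OF fs z]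
        using bspec[OF h(2) z] by (simp add: Suc b_def algebra_simps)
    qed
  qed
  have gb: "g i z = (\<Sum>k\<le>i. b (i - k) z * h z ^ k)" if z: "z \<in> U" for i z
  proof (induction i)
    case 0
    then show ?case using fs z by (simp add: b_def francoise_seq_def)
  next
    case (Suc i)
    have "(\<Sum>k\<le>Suc i. b (Suc i - k) z * h z ^ k) = b (Suc i) z + h z * (\<Sum>k\<le>i. b (i - k) z * h z ^ k)"
      unfolding sum.atMost_Suc_shift by (simp add: sum_distrib_left mult_ac)
    then show ?case unfolding Suc[symmetric] by (simp add: b_def)
  qed
  have "leaf_deriv F h z = 0" if z: "z \<in> U" for z
    unfolding leaf_deriv_def
  proof (rule algebraic_over_constants[where n = l and a = "\<lambda>k. b (Suc l - k)" and c = 1, OF h(1) U])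
    show "vderiv (\<lambda>z. - pdy F z) (pdx F) (b (Suc l - k)) z = 0" if "z \<in> U" for k z
      using Tb[OF that] by (simp add: leaf_deriv_def)
    show "(\<Sum>k\<le>Suc l. b (Suc l - k) z * h z ^ k) = 0" if "z \<in> U" for z
      using gb[OF that, of "Suc l"] len[OF that] by simp
    have "holo U (\<lambda>z. 0 - pdy F z)" by (intro holo_diff holo_const[OF U] holo_pdy[OF F])
    then show "holo U (\<lambda>z. - pdy F z)" by simp
  qed (use hb z holo_pdx[OF F] in \<open>simp_all add: b_def\<close>)
  moreover have "\<omega> z = cscale (h z) (d0 F z)" if "z \<in> U" for z
    using bspec[OF h(2) that] by (simp add: cscale_def d0_def prod_eq_iff)
  ultimately show ?thesis using h(1) by (intro exI[of _ h] conjI ballI)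
qed

section \<open>The two cases of the theorem\<close>

lemma darboux_ext_refl: "darboux_ext V L L"
  unfolding darboux_ext_def by (rule ext_tower.base)

lemma deform_holo_form:
  assumes "holo U F" "holo_form U \<omega>"
  shows "holo_form U (deform F \<omega> \<epsilon>)"
  using assms holo_open[OF assms(1)] unfolding holo_form_def deform_comp fst_conv snd_conv
  by (intro conjI holo_add holo_mult holo_const holo_pdx holo_pdy) simp_all

lemma continuous_poly_sum: "continuous_on UNIV (\<lambda>\<epsilon>::complex. \<Sum>i\<le>(m::nat). \<epsilon> ^ i * c i)"
  by (intro continuous_intros)

lemma int_factor_0: "integrating_factor g l 0 z = g 0 z"
  unfolding integrating_factor_def by (simp add: power_0_left if_distrib[of "\<lambda>x. x * _"] sum.delta cong: if_cong)

lemma fi_0: "deformed_integral F r m 0 z = F z"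
  unfolding deformed_integral_def deformed_integral_coeff_def by (simp add: power_0_left if_distrib[of "\<lambda>x. x * _"] sum.delta cong: if_cong)

lemma first_integral_intro:
  assumes "holo U G" "\<And>z. z \<in> U \<Longrightarrow> d0 G z = cscale (M z) (\<eta> z)" "p \<in> U" "q \<in> U" "G q \<noteq> G p"
  shows "first_integral U \<eta> G"
  unfolding first_integral_def
proof (intro conjI ballI assms(1))
  show "wedge (d0 G z) (\<eta> z) = 0" if "z \<in> U" for z unfolding assms(2)[OF that] by (rule wedge_cscale_self)
  show "\<not> G constant_on U"
  proof
    assume "G constant_on U"
    then obtain y where "\<forall>x\<in>U. G x = y" unfolding constant_on_def by (rule exE)
    then show False using assms(3-5) by simp
  qed
qed

definition darboux_conclusion :: "C2 set \<Rightarrow> (C2 \<Rightarrow> complex) \<Rightarrow> (C2 \<Rightarrow> C2) \<Rightarrow> bool" where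
  "darboux_conclusion U F \<omega> \<longleftrightarrow>
       (\<exists>m Fs. (\<forall>i\<le>m. holo U (Fs i)) \<and>
            (\<exists>\<delta>>0. \<forall>\<epsilon>\<in>ball 0 \<delta>.
               first_integral U (deform F \<omega> \<epsilon>) (\<lambda>z. \<Sum>i\<le>m. \<epsilon> ^ i * Fs i z)) \<and>
            darboux_family U (deform_field U F \<omega>) m Fs)"

definition godbillon_vey_conclusion ::
  "C2 set \<Rightarrow> (C2 \<Rightarrow> complex) \<Rightarrow> (C2 \<Rightarrow> C2) \<Rightarrow> (complex \<Rightarrow> real \<Rightarrow> C2) \<Rightarrow> complex \<Rightarrow> bool" where
  "godbillon_vey_conclusion U F \<omega> \<gamma> t0 \<longleftrightarrow>
       (\<exists>\<delta>>0. \<exists>\<theta>::complex \<Rightarrow> C2 \<Rightarrow> C2.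
            (\<forall>\<epsilon>\<in>ball 0 \<delta>. merom_form U (\<theta> \<epsilon>) \<and> godbillon_vey2 U (deform F \<omega> \<epsilon>) (\<theta> \<epsilon>)) \<and>
            (\<exists>\<delta>'>0. \<exists>U'\<subseteq>U. cycle_tube F \<gamma> (ball t0 \<delta>') U' \<and>
              (\<exists>p\<in>U'. \<exists>f Ft :: complex \<Rightarrow> (real \<Rightarrow> C2) \<Rightarrow> complex.
                (\<forall>\<epsilon>\<in>ball 0 \<delta>.
                   mv_holo U' p (f \<epsilon>) \<and>
                   mv_first_integral U' p (deform F \<omega> \<epsilon>) (Ft \<epsilon>) \<and>
                   (\<forall>c\<in>paths_from U' p.
                      mv_d (Ft \<epsilon>) c = cscale (f \<epsilon> c) (deform F \<omega> \<epsilon> (pathfinish c))) \<and>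
                   generically U' (\<lambda>z. \<forall>c\<in>paths_from U' p. pathfinish c = z \<longrightarrow>
                      mv_d (f \<epsilon>) c = cscale (f \<epsilon> c) (\<theta> \<epsilon> z))) \<and>
                (\<forall>c\<in>paths_from U' p. (\<lambda>\<epsilon>. f \<epsilon> c) holomorphic_on ball 0 \<delta> \<and>
                   (\<lambda>\<epsilon>. Ft \<epsilon> c) holomorphic_on ball 0 \<delta>) \<and>
                (\<exists>\<rho>>0. ball p \<rho> \<subseteq> U' \<and>
                  (\<exists>L D. liouville_ext (ball p \<rho>) (restrict_field (ball p \<rho>) (deform_field U F \<omega>)) L \<and>
                         darboux_ext (ball p \<rho>) L D \<and>
                         (\<forall>\<epsilon>\<in>ball 0 \<delta>. (\<lambda>z. f \<epsilon> (linepath p z)) \<in> L \<and>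
                                        (\<lambda>z. Ft \<epsilon> (linepath p z)) \<in> D))))))"

text \<open>All objects are univalued: \<open>f = M\<^sub>\<epsilon>\<close> and \<open>Ft = F\<^sub>\<epsilon>\<close>. The tower of \<open>deformed_integral_darboux\<close> contains both, so it serves as the
Liouville extension, and no further step is made for \<open>Ft\<close>. Since the tower exists only near points with
\<open>dF \<and> \<omega> \<noteq> 0\<close>, the base point is chosen there; \<open>\<delta>\<close> is such that \<open>F\<^sub>\<epsilon>\<close> takes different values at two points near it and \<open>M\<^sub>\<epsilon>\<close> is
nonzero at it.\<close>

lemma nondegenerate_conclusions:
  assumes F: "holo U F" and dF: "\<And>z. z \<in> U \<Longrightarrow> d0 F z \<noteq> 0" and \<omega>: "holo_form U \<omega>" and fs: "francoise_seq U F \<omega> g r"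
    and len: "\<And>z. z \<in> U \<Longrightarrow> g (Suc l) z = 0" and con: "connected U"
    and nd: "z1 \<in> U" "wedge (d0 F z1) (\<omega> z1) \<noteq> 0"
    and U': "open U'" "U' \<noteq> {}" "U' \<subseteq> U" and tube: "\<delta>' > 0" "cycle_tube F \<gamma> (ball t0 \<delta>') U'"
  shows "darboux_conclusion U F \<omega>" (is ?I) "godbillon_vey_conclusion U F \<omega> \<gamma> t0" (is ?II)
proof -
  have U: "open U" by (rule holo_open[OF F])
  have w: "holo U (\<lambda>z. fst (\<omega> z))" "holo U (\<lambda>z. snd (\<omega> z))" using \<omega> unfolding holo_form_def by simp_all
  let ?\<Delta> = "\<lambda>z. wedge (d0 F z) (\<omega> z)"
  have h\<Delta>: "holo U ?\<Delta>"
    unfolding wedge_def d0_def fst_conv snd_conv by (intro holo_diff holo_mult holo_pdx[OF F] holo_pdy[OF F] w)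
  let ?V = "{z \<in> U'. ?\<Delta> z \<noteq> 0}"
  have V: "open ?V" "?V \<subseteq> U" using open_nonzero[OF holo_subset[OF h\<Delta> U'(1,3)]] U'(3) by auto
  obtain z2 where "z2 \<in> U'" "?\<Delta> z2 \<noteq> 0" by (rule holo_nonzero_dense[OF h\<Delta> con nd U'])
  then have "z2 \<in> ?V" by simp
  then have V0: "?V \<noteq> {}" by (metis empty_iff)
  have "\<exists>p \<rho> S. \<rho> > 0 \<and> ball p \<rho> \<subseteq> ?V \<and> darboux_chain (ball p \<rho>) {pdx F, pdy F, \<lambda>z. fst (\<omega> z), \<lambda>z. snd (\<omega> z)} S \<and>
    (\<forall>k\<le>Suc l. deformed_integral_coeff F r k \<in> dring (ball p \<rho>) S) \<and> (\<forall>k\<le>l. g k \<in> dring (ball p \<rho>) S)"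
    by (rule deformed_integral_darboux[OF F \<omega> fs len V(1) V0 V(2)]) (assumption, drule CollectD, erule conjunct2)
  then obtain p \<rho> S where S: "\<rho> > 0" "ball p \<rho> \<subseteq> ?V" "darboux_chain (ball p \<rho>) {pdx F, pdy F, \<lambda>z. fst (\<omega> z), \<lambda>z. snd (\<omega> z)} S"
    "\<forall>k\<le>Suc l. deformed_integral_coeff F r k \<in> dring (ball p \<rho>) S" "\<forall>k\<le>l. g k \<in> dring (ball p \<rho>) S"
    by (elim exE conjE) (rule that)
  have BU': "ball p \<rho> \<subseteq> U'" using S(2) by auto
  have BU: "ball p \<rho> \<subseteq> U" using BU' U'(3) by (rule subset_trans)
  have pB: "p \<in> ball p \<rho>" using S(1) by simp
  have p: "p \<in> U'" "p \<in> U" by (rule subsetD[OF BU' pB], rule subsetD[OF BU pB])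
  let ?K = "restrict_field (ball p \<rho>) (deform_field U F \<omega>)"
  obtain D where D: "darboux_ext (ball p \<rho>) ?K D" "dring (ball p \<rho>) S \<subseteq> D"
    using deform_chain_tower[OF S(3,1) F \<omega> BU] by (elim exE conjE) (rule that)
  obtain q where q: "q \<in> ball p \<rho>" "F q \<noteq> F p"
    using nonconstant_ball[OF holo_subset[OF F open_ball BU] S(1) dF[OF p(2)]] by (elim bexE) (rule that)
  have qU: "q \<in> U" by (rule subsetD[OF BU q(1)])
  have g0: "g 0 p = 1" using fs p(2) unfolding francoise_seq_def by simp
  let ?G = "deformed_integral F r (Suc l)" and ?M = "integrating_factor g l"
  have "\<exists>\<delta>>0. \<forall>\<epsilon>\<in>ball 0 \<delta>. ?G \<epsilon> q - ?G \<epsilon> p \<noteq> 0"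
  proof (rule nonzero_near_0)
    show "continuous_on UNIV (\<lambda>\<epsilon>. ?G \<epsilon> q - ?G \<epsilon> p)"
      unfolding deformed_integral_def by (intro continuous_on_diff continuous_poly_sum)
    show "?G 0 q - ?G 0 p \<noteq> 0" using q(2) by (simp add: fi_0)
  qed
  then obtain d1 where d1: "d1 > 0" "\<forall>\<epsilon>\<in>ball 0 d1. ?G \<epsilon> q - ?G \<epsilon> p \<noteq> 0" by (elim exE conjE) (rule that)
  have "\<exists>\<delta>>0. \<forall>\<epsilon>\<in>ball 0 \<delta>. ?M \<epsilon> p \<noteq> 0"
  proof (rule nonzero_near_0)
    show "continuous_on UNIV (\<lambda>\<epsilon>. ?M \<epsilon> p)" unfolding integrating_factor_def by (intro continuous_intros)
    show "?M 0 p \<noteq> 0" using g0 by (simp add: int_factor_0)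
  qed
  then obtain d2 where d2: "d2 > 0" "\<forall>\<epsilon>\<in>ball 0 d2. ?M \<epsilon> p \<noteq> 0" by (elim exE conjE) (rule that)
  define \<delta> where "\<delta> = min d1 d2"
  have \<delta>: "\<delta> > 0" using d1(1) d2(1) by (simp add: \<delta>_def)
  have nc: "?G \<epsilon> q \<noteq> ?G \<epsilon> p" and nM: "?M \<epsilon> p \<noteq> 0" if "\<epsilon> \<in> ball 0 \<delta>" for \<epsilon>
    using bspec[OF d1(2), of \<epsilon>] bspec[OF d2(2), of \<epsilon>] that by (simp_all add: \<delta>_def)
  have hG: "holo U (?G \<epsilon>)" and hM: "holo U (?M \<epsilon>)" for \<epsilon>
    by (rule deformed_integral_holo[OF F fs], rule integrating_factor_holo[OF U fs])
  have dG: "d0 (?G \<epsilon>) z = cscale (?M \<epsilon> z) (deform F \<omega> \<epsilon> z)" if "z \<in> U" for \<epsilon> z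
    by (rule deformed_integral_integrating_factor[OF F fs len that])
  have FD: "deformed_integral_coeff F r k \<in> D" if "k \<le> Suc l" for k
    by (rule subsetD[OF D(2)]) (use S(4) that in simp)
  show ?I
    unfolding darboux_conclusion_def
  proof (rule exI[of _ "Suc l"], rule exI[of _ "deformed_integral_coeff F r"], intro conjI allI impI)
    show "holo U (deformed_integral_coeff F r k)" for k by (rule deformed_integral_coeff_holo[OF F fs])
    show "\<exists>\<delta>>0. \<forall>\<epsilon>\<in>ball 0 \<delta>. first_integral U (deform F \<omega> \<epsilon>) (\<lambda>z. \<Sum>i\<le>Suc l. \<epsilon> ^ i * deformed_integral_coeff F r i z)"
      unfolding deformed_integral_def[symmetric]
      by (intro exI[of _ \<delta>] conjI \<delta> ballI, rule first_integral_intro[OF hG dG p(2) qU nc])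
    show "darboux_family U (deform_field U F \<omega>) (Suc l) (deformed_integral_coeff F r)"
      unfolding darboux_family_def
      by (intro exI[of _ p] exI[of _ \<rho>] exI[of _ D] conjI S(1) BU D(1) allI impI FD)
  qed
  define \<theta> where "\<theta> \<epsilon> z = cscale (inverse (?M \<epsilon> z)) (d0 (?M \<epsilon>) z)" for \<epsilon> z
  have h\<eta>: "holo_form U (deform F \<omega> \<epsilon>)" for \<epsilon> by (rule deform_holo_form[OF F \<omega>])
  have gv: "merom_form U (\<theta> \<epsilon>)" "godbillon_vey2 U (deform F \<omega> \<epsilon>) (\<theta> \<epsilon>)"
    "generically U' (\<lambda>z. d0 (?M \<epsilon>) z = cscale (?M \<epsilon> z) (\<theta> \<epsilon> z))" if "\<epsilon> \<in> ball 0 \<delta>" for \<epsilon>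
    unfolding \<theta>_def[abs_def]
    using integrating_factor_godbillon_vey[OF con hM p(2) nM[OF that] hG h\<eta> dG] U'(1,3) by simp_all
  have GD: "?G \<epsilon> \<in> D" for \<epsilon>
    unfolding deformed_integral_def[abs_def]
    by (rule subsetD[OF D(2)]) (intro dring_sum dring.mult dring.const, use S(4) in simp)
  have MD: "?M \<epsilon> \<in> D" for \<epsilon>
    unfolding integrating_factor_def[abs_def]
    by (rule subsetD[OF D(2)]) (intro dring_sum dring.mult dring.const, use S(5) in simp)
  have eG: "(\<lambda>\<epsilon>. ?G \<epsilon> z) holomorphic_on ball 0 \<delta>" and eM: "(\<lambda>\<epsilon>. ?M \<epsilon> z) holomorphic_on ball 0 \<delta>" for z
    unfolding deformed_integral_def integrating_factor_def by (intro holomorphic_intros)+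
  have cK: "(\<lambda>z. c) \<in> ?K" for c
    by (rule restrict_fieldI[OF _ holo_const[OF open_ball]]) (simp add: deform_field_def diff_field_gen_const)
  have L: "liouville_ext (ball p \<rho>) ?K D" by (rule darboux_liouville[OF D(1) cK])
  show ?II
    unfolding godbillon_vey_conclusion_def
    by (rule exI[of _ \<delta>], rule conjI, rule \<delta>, rule exI[of _ \<theta>], rule conjI, rule ballI, rule conjI, erule gv(1), erule gv(2),
      rule exI[of _ \<delta>'], rule conjI, rule tube(1), rule exI[of _ U'], rule conjI, rule U'(3), rule conjI, rule tube(2),
      rule univalued_integrating_factor[where M = ?M and G = ?G and L = D and D = D and q = q, OF U'(1) p(1)
            holo_subset[OF hM U'(1,3)] holo_subset[OF hG U'(1,3)] dG[OF subsetD[OF U'(3)]] gv(3) eM eG S(1) BU' q(1) nc L darboux_ext_refl MD GD refl])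
qed

text \<open>Here \<open>\<omega> = h dF\<close> with \<open>h\<close> constant along the leaves, so \<open>dF + \<epsilon> \<omega>\<close> is closed and \<open>\<theta> = 0\<close>, \<open>f = 1\<close>. A primitive of \<open>\<omega>\<close>
exists on the tube over a disc, where \<open>h = H \<circ> F\<close>, in the form \<open>J \<circ> F\<close> with \<open>J' = H\<close>.\<close>

lemma degenerate_conclusions:
  assumes F: "holo U F" and dF: "\<And>z. z \<in> U \<Longrightarrow> d0 F z \<noteq> 0" and \<omega>: "holo_form U \<omega>" and fs: "francoise_seq U F \<omega> g r"
    and len: "\<And>z. z \<in> U \<Longrightarrow> g (Suc l) z = 0" and con: "connected U"
    and dg: "\<And>z. z \<in> U \<Longrightarrow> wedge (d0 F z) (\<omega> z) = 0"
    and U': "U' = {z \<in> U. F z \<in> ball t0 \<delta>'}" "connected U'" and tube: "\<delta>' > 0" "cycle_tube F \<gamma> (ball t0 \<delta>') U'"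
    and s: "s1 holomorphic_on ball t0 \<delta>'" "s2 holomorphic_on ball t0 \<delta>'"
      "\<And>t. t \<in> ball t0 \<delta>' \<Longrightarrow> (s1 t, s2 t) \<in> U" "\<And>t. t \<in> ball t0 \<delta>' \<Longrightarrow> F (s1 t, s2 t) = t"
  shows "darboux_conclusion U F \<omega>" (is ?I) "godbillon_vey_conclusion U F \<omega> \<gamma> t0" (is ?II)
proof -
  have U: "open U" by (rule holo_open[OF F])
  let ?T = "ball t0 \<delta>'"
  have oU': "open U'" using tube(2) unfolding cycle_tube_def by (rule conjunct1)
  have U'U: "U' \<subseteq> U" unfolding U' by (rule Collect_restrict)
  have FT: "F z \<in> ?T" if "z \<in> U'" for z using that unfolding U' by simp
  have F': "holo U' F" by (rule holo_subset[OF F oU' U'U])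
  have dF': "pdx F z \<noteq> 0 \<or> pdy F z \<noteq> 0" if "z \<in> U'" for z
    using dF[OF subsetD[OF U'U that]] by (simp add: d0_def zero_prod_def)
  have "\<exists>h. holo U h \<and> (\<forall>z\<in>U. \<omega> z = cscale (h z) (d0 F z)) \<and> (\<forall>z\<in>U. leaf_deriv F h z = 0)"
    by (rule degenerate_transverse_factor[OF F dF \<omega> fs len dg])
  then obtain h where h: "holo U h" "\<forall>z\<in>U. \<omega> z = cscale (h z) (d0 F z)" "\<forall>z\<in>U. leaf_deriv F h z = 0"
    by (elim exE conjE) (rule that)
  have \<omega>h: "fst (\<omega> z) = h z * pdx F z" "snd (\<omega> z) = h z * pdy F z" if "z \<in> U" for z
    using bspec[OF h(2) that] by (simp_all add: cscale_def d0_def)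
  define H where "H t = h (s1 t, s2 t)" for t
  have hH: "H holomorphic_on ?T"
    unfolding H_def[abs_def] by (rule holo_curve[OF h(1) open_ball s(3,1,2)])
  obtain J where J': "\<And>x. x \<in> ?T \<Longrightarrow> (J has_field_derivative H x) (at x within ?T)"
    by (rule holomorphic_convex_primitive'[OF convex_ball open_ball hH]) (rule that)
  have J: "(J has_field_derivative H x) (at x)" if "x \<in> ?T" for x
    using J'[OF that] unfolding at_within_open[OF that open_ball] .
  have hHF: "hasd (\<lambda>z. H (F z)) (deriv H (F z) * pdx F z) (deriv H (F z) * pdy F z) z" if "z \<in> U'" for z
    by (rule hasd_comp[OF holo_hasd[OF F' that] holomorphic_derivI[OF hH open_ball FT[OF that]]])
  have HF: "holo U' (\<lambda>z. H (F z))" by (rule hasd_holo[OF oU']) (intro exI, erule hHF)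
  have hF: "h z = H (F z)" if z: "z \<in> U'" for z
  proof -
    let ?q = "\<lambda>z. h z - H (F z)"
    have h': "holo U' h" by (rule holo_subset[OF h(1) oU' U'U])
    have "?q z = 0"
    proof (rule factor_through[OF F' U'(2) dF' _ _ open_ball _ _ s(4) s(1,2) _ z])
      show "holo U' ?q" by (rule holo_diff[OF h' HF])
      show "leaf_deriv F ?q z = 0" if z: "z \<in> U'" for z
      proof -
        have "leaf_deriv F ?q z = leaf_deriv F h z - leaf_deriv F (\<lambda>z. H (F z)) z"
          unfolding leaf_deriv_def by (rule vderiv_diff[OF h' HF z])
        also have "leaf_deriv F (\<lambda>z. H (F z)) z = 0"
          unfolding leaf_deriv_def vderiv_def hasd_pdx[OF hHF[OF z]] hasd_pdy[OF hHF[OF z]] by simp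
        finally show ?thesis using bspec[OF h(3) subsetD[OF U'U z]] by simp
      qed
      show "t0 \<in> ?T" using tube(1) by simp
      show "(s1 t, s2 t) \<in> U'" if "t \<in> ?T" for t unfolding U' using s(3,4)[OF that] that by simp
      show "?q (s1 t, s2 t) = 0" if "t \<in> ?T" for t using s(4)[OF that] by (simp add: H_def)
    qed
    then show ?thesis by simp
  qed
  have hJF: "hasd (\<lambda>z. J (F z)) (H (F z) * pdx F z) (H (F z) * pdy F z) z" if "z \<in> U'" for z
    by (rule hasd_comp[OF holo_hasd[OF F' that] J[OF FT[OF that]]])
  have JF: "holo U' (\<lambda>z. J (F z))" by (rule hasd_holo[OF oU']) (intro exI, erule hJF)
  have dJ: "pdx (\<lambda>z. J (F z)) z = fst (\<omega> z)" "pdy (\<lambda>z. J (F z)) z = snd (\<omega> z)" if "z \<in> U'" for z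
    unfolding \<omega>h[OF subsetD[OF U'U that]] hF[OF that] hasd_pdx[OF hJF[OF that]] hasd_pdy[OF hJF[OF that]] by (rule refl)+
  define G where "G \<epsilon> z = F z + \<epsilon> * J (F z)" for \<epsilon> z
  have hG: "holo U' (G \<epsilon>)" for \<epsilon>
    unfolding G_def[abs_def] by (intro holo_add F' holo_mult holo_const[OF oU'] JF)
  have dG: "d0 (G \<epsilon>) z = cscale 1 (deform F \<omega> \<epsilon> z)" if z: "z \<in> U'" for \<epsilon> z
  proof -
    have hc: "holo U' (\<lambda>z. \<epsilon> * J (F z))" by (intro holo_mult holo_const[OF oU'] JF)
    show ?thesis
      unfolding G_def[abs_def] d0_def pd_add[OF F' hc z] pd_cmult[OF JF z] dJ[OF z] deform_comp
      by (simp add: cscale_def)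
  qed
  define p where "p = (s1 t0, s2 t0)"
  have t0: "t0 \<in> ?T" using tube(1) by simp
  have p: "p \<in> U'" unfolding p_def U' using s(3,4)[OF t0] t0 by simp
  obtain \<rho> where \<rho>: "\<rho> > 0" "ball p \<rho> \<subseteq> U'" by (rule openE[OF oU' p]) (rule that)
  have BU: "ball p \<rho> \<subseteq> U" by (rule subset_trans[OF \<rho>(2) U'U])
  have pU: "p \<in> U" by (rule subsetD[OF U'U p])
  obtain q where q: "q \<in> ball p \<rho>" "F q \<noteq> F p"
    using nonconstant_ball[OF holo_subset[OF F open_ball BU] \<rho>(1) dF[OF pU]] by (elim bexE) (rule that)
  have "\<exists>\<delta>>0. \<forall>\<epsilon>\<in>ball 0 \<delta>. G \<epsilon> q - G \<epsilon> p \<noteq> 0"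
  proof (rule nonzero_near_0)
    show "continuous_on UNIV (\<lambda>\<epsilon>. G \<epsilon> q - G \<epsilon> p)" unfolding G_def by (intro continuous_intros)
    show "G 0 q - G 0 p \<noteq> 0" using q(2) by (simp add: G_def)
  qed
  then obtain \<delta> where \<delta>: "\<delta> > 0" "\<forall>\<epsilon>\<in>ball 0 \<delta>. G \<epsilon> q - G \<epsilon> p \<noteq> 0" by (elim exE conjE) (rule that)
  have nc: "G \<epsilon> q \<noteq> G \<epsilon> p" if "\<epsilon> \<in> ball 0 \<delta>" for \<epsilon> using bspec[OF \<delta>(2) that] by simp
  let ?S0 = "{pdx F, pdy F, \<lambda>z. fst (\<omega> z), \<lambda>z. snd (\<omega> z)}" and ?B = "ball p \<rho>"
  let ?K = "restrict_field ?B (deform_field U F \<omega>)"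
  have c1: "darboux_chain ?B ?S0 (insert F ?S0)"
    by (rule darboux_chain.primitive[OF darboux_chain.base holo_subset[OF F open_ball BU], where a = "pdx F" and b = "pdy F"]) (simp_all add: dring.gen)
  have c2: "darboux_chain ?B ?S0 (insert (\<lambda>z. J (F z)) (insert F ?S0))"
    by (rule darboux_chain.primitive[OF c1 holo_subset[OF JF open_ball \<rho>(2)], where a = "\<lambda>z. fst (\<omega> z)" and b = "\<lambda>z. snd (\<omega> z)"])
      (simp_all add: dring.gen dJ subsetD[OF \<rho>(2)])
  obtain D where D: "darboux_ext ?B ?K D" "dring ?B (insert (\<lambda>z. J (F z)) (insert F ?S0)) \<subseteq> D"
    using deform_chain_tower[OF c2 \<rho>(1) F \<omega> BU] by (elim exE conjE) (rule that)
  show ?I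
    unfolding darboux_conclusion_def
  proof (rule exI[of _ 0], rule exI[of _ "\<lambda>_. F"], intro conjI allI impI)
    show "\<exists>\<delta>>0. \<forall>\<epsilon>\<in>ball 0 \<delta>. first_integral U (deform F \<omega> \<epsilon>) (\<lambda>z. \<Sum>i\<le>0. \<epsilon> ^ i * F z)"
    proof (intro exI[of _ 1] conjI ballI)
      fix \<epsilon> :: complex
      have "first_integral U (deform F \<omega> \<epsilon>) F"
        unfolding first_integral_def
      proof (intro conjI ballI F)
        show "wedge (d0 F z) (deform F \<omega> \<epsilon> z) = 0" if "z \<in> U" for z
          using dg[OF that] by (simp add: deform_comp wedge_def d0_def algebra_simps flip: distrib_left)
        show "\<not> F constant_on U"
        proof
          assume "F constant_on U"
          then obtain y where "\<forall>x\<in>U. F x = y" unfolding constant_on_def by (rule exE)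
          then show False using pU subsetD[OF BU q(1)] q(2) by simp
        qed
      qed
      then show "first_integral U (deform F \<omega> \<epsilon>) (\<lambda>z. \<Sum>i\<le>0. \<epsilon> ^ i * F z)" by simp
    qed simp
    have "F \<in> D" by (rule subsetD[OF D(2)]) (simp add: dring.gen)
    then show "darboux_family U (deform_field U F \<omega>) 0 (\<lambda>_. F)"
      unfolding darboux_family_def
      by (intro exI[of _ p] exI[of _ \<rho>] exI[of _ D] conjI \<rho>(1) BU D(1) allI impI)
  qed (rule F)
  have GD: "G \<epsilon> \<in> D" for \<epsilon>
    unfolding G_def[abs_def]
    by (rule subsetD[OF D(2)]) (intro dring.add dring.mult dring.const, simp_all add: dring.gen)
  have 1: "(\<lambda>z. 1) \<in> ?K"
    by (rule restrict_fieldI[OF _ holo_const[OF open_ball]]) (simp add: deform_field_def diff_field_gen_const)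
  have L: "liouville_ext ?B ?K ?K" unfolding liouville_ext_def by (rule ext_tower.base)
  have eG: "(\<lambda>\<epsilon>. G \<epsilon> z) holomorphic_on ball 0 \<delta>" and e1: "(\<lambda>\<epsilon>. 1) holomorphic_on ball 0 \<delta>" for z
    unfolding G_def by (intro holomorphic_intros)+
  let ?\<theta> = "\<lambda>_ _. 0 :: C2"
  have mf: "merom_form U (?\<theta> \<epsilon>)" for \<epsilon> :: complex
    unfolding merom_form_def by (simp add: holo_merom[OF holo_const[OF U]])
  have "d1 (deform F \<omega> \<epsilon>) z = 0" if z: "z \<in> U" for \<epsilon> z
  proof -
    have hh: "holo U (\<lambda>z. 1 + \<epsilon> * h z)" by (intro holo_add holo_mult holo_const[OF U] h(1))
    have he: "holo U (\<lambda>z. \<epsilon> * h z)" by (intro holo_mult holo_const[OF U] h(1))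
    have x: "pdx (\<lambda>z. 1 + \<epsilon> * h z) z = \<epsilon> * pdx h z" and y: "pdy (\<lambda>z. 1 + \<epsilon> * h z) z = \<epsilon> * pdy h z"
      unfolding pd_add[OF holo_const[OF U] he z] pd_cmult[OF h(1) z] by simp_all
    have "pdx (\<lambda>w. snd (deform F \<omega> \<epsilon> w)) z = pdx (\<lambda>w. (1 + \<epsilon> * h w) * pdy F w) z"
      by (rule pd_cong(1)[OF U z]) (simp add: deform_comp \<omega>h algebra_simps)
    moreover have "pdy (\<lambda>w. fst (deform F \<omega> \<epsilon> w)) z = pdy (\<lambda>w. (1 + \<epsilon> * h w) * pdx F w) z"
      by (rule pd_cong(2)[OF U z]) (simp add: deform_comp \<omega>h algebra_simps)
    ultimately have "d1 (deform F \<omega> \<epsilon>) z = - \<epsilon> * leaf_deriv F h z"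
      unfolding d1_def pd_mult[OF hh holo_pdy[OF F] z] pd_mult[OF hh holo_pdx[OF F] z] x y
      by (simp add: pd_commute[OF F z] leaf_deriv_def vderiv_def algebra_simps)
    then show ?thesis using bspec[OF h(3) z] by simp
  qed
  then have gv: "godbillon_vey2 U (deform F \<omega> \<epsilon>) (?\<theta> \<epsilon>)" for \<epsilon>
    unfolding godbillon_vey2_def by (intro conjI generically_all[OF U]) (simp_all add: wedge_def d1_def)
  have gen: "generically U' (\<lambda>z. d0 (\<lambda>z. 1) z = cscale 1 (?\<theta> \<epsilon> z))" for \<epsilon> :: complex
    by (rule generically_all[OF oU']) (simp add: d0_def cscale_def)
  show ?II
    unfolding godbillon_vey_conclusion_def
    by (rule exI[of _ \<delta>], rule conjI, rule \<delta>, rule exI[of _ ?\<theta>], rule conjI, rule ballI, rule conjI, rule mf, rule gv,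
      rule exI[of _ \<delta>'], rule conjI, rule tube(1), rule exI[of _ U'], rule conjI, rule U'U, rule conjI, rule tube(2),
      rule univalued_integrating_factor[where M = "\<lambda>_ _. 1" and G = G and L = ?K and D = D and q = q, OF oU' p
            holo_const[OF oU'] hG dG gen e1 eG \<rho> q(1) nc L D(1) 1 GD refl])
qed

theorem theorem2p2:
  fixes F :: "C2 \<Rightarrow> complex" and \<omega> :: "C2 \<Rightarrow> C2" and U S :: "C2 set"
    and \<gamma> :: "complex \<Rightarrow> real \<Rightarrow> C2" and t0 :: complex
    and g r :: "nat \<Rightarrow> C2 \<Rightarrow> complex" and l :: nat
  assumes "cycle_family F U S \<gamma> t0"
    and "holo_form U \<omega>"
    and "francoise_seq U F \<omega> g r"
    and "francoise_length U g l"
  shows "(\<exists>m Fs. (\<forall>i\<le>m. holo U (Fs i)) \<and>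
            (\<exists>\<delta>>0. \<forall>\<epsilon>\<in>ball 0 \<delta>.
               first_integral U (deform F \<omega> \<epsilon>) (\<lambda>z. \<Sum>i\<le>m. \<epsilon> ^ i * Fs i z)) \<and>
            darboux_family U (deform_field U F \<omega>) m Fs)
       \<and> (\<exists>\<delta>>0. \<exists>\<theta>::complex \<Rightarrow> C2 \<Rightarrow> C2.
            (\<forall>\<epsilon>\<in>ball 0 \<delta>. merom_form U (\<theta> \<epsilon>) \<and> godbillon_vey2 U (deform F \<omega> \<epsilon>) (\<theta> \<epsilon>)) \<and>
            (\<exists>\<delta>'>0. \<exists>U'\<subseteq>U. cycle_tube F \<gamma> (ball t0 \<delta>') U' \<and>
              (\<exists>p\<in>U'. \<exists>f Ft :: complex \<Rightarrow> (real \<Rightarrow> C2) \<Rightarrow> complex.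
                (\<forall>\<epsilon>\<in>ball 0 \<delta>.
                   mv_holo U' p (f \<epsilon>) \<and>
                   mv_first_integral U' p (deform F \<omega> \<epsilon>) (Ft \<epsilon>) \<and>
                   (\<forall>c\<in>paths_from U' p.
                      mv_d (Ft \<epsilon>) c = cscale (f \<epsilon> c) (deform F \<omega> \<epsilon> (pathfinish c))) \<and>
                   generically U' (\<lambda>z. \<forall>c\<in>paths_from U' p. pathfinish c = z \<longrightarrow>
                      mv_d (f \<epsilon>) c = cscale (f \<epsilon> c) (\<theta> \<epsilon> z))) \<and>
                (\<forall>c\<in>paths_from U' p. (\<lambda>\<epsilon>. f \<epsilon> c) holomorphic_on ball 0 \<delta> \<and>
                   (\<lambda>\<epsilon>. Ft \<epsilon> c) holomorphic_on ball 0 \<delta>) \<and>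
                (\<exists>\<rho>>0. ball p \<rho> \<subseteq> U' \<and>
                  (\<exists>L D. liouville_ext (ball p \<rho>) (restrict_field (ball p \<rho>) (deform_field U F \<omega>)) L \<and>
                         darboux_ext (ball p \<rho>) L D \<and>
                         (\<forall>\<epsilon>\<in>ball 0 \<delta>. (\<lambda>z. f \<epsilon> (linepath p z)) \<in> L \<and>
                                        (\<lambda>z. Ft \<epsilon> (linepath p z)) \<in> D))))))"
proof -
  have F: "holo U F" and dF: "\<And>z. z \<in> U \<Longrightarrow> d0 F z \<noteq> 0" and tr: "transversal F U (\<gamma> t0) S"
    and t0: "t0 \<in> F ` S" and tube: "cycle_tube F \<gamma> (F ` S) U"
    using assms(1) unfolding cycle_family_def by simp_all
  have len: "g (Suc l) z = 0" if "z \<in> U" for z using assms(4) that unfolding francoise_length_def by simp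
  have conT: "connected (F ` S)" by (rule conjunct1[OF transversal_slice[OF F tr t0]])
  obtain \<delta>' s1 s2 where \<delta>': "\<delta>' > 0" "ball t0 \<delta>' \<subseteq> F ` S" and s: "s1 holomorphic_on ball t0 \<delta>'" "s2 holomorphic_on ball t0 \<delta>'"
      "\<forall>t\<in>ball t0 \<delta>'. (s1 t, s2 t) \<in> U \<and> F (s1 t, s2 t) = t"
    using conjunct2[OF transversal_slice[OF F tr t0]] by (elim exE conjE) (rule that)
  have con: "connected U" by (rule tube_connected[OF tube conT])
  define U' where "U' = {z \<in> U. F z \<in> ball t0 \<delta>'}"
  have tube': "cycle_tube F \<gamma> (ball t0 \<delta>') U'" unfolding U'_def by (rule tube_restrict[OF tube F \<delta>'(2) open_ball])
  have con': "connected U'" by (rule tube_connected[OF tube' connected_ball])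
  have "(s1 t0, s2 t0) \<in> U'" using bspec[OF s(3), of t0] \<delta>'(1) unfolding U'_def by simp
  then have U': "open U'" "U' \<noteq> {}" "U' \<subseteq> U"
    using tube' unfolding cycle_tube_def U'_def by auto
  have "darboux_conclusion U F \<omega> \<and> godbillon_vey_conclusion U F \<omega> \<gamma> t0"
  proof (cases "\<forall>z\<in>U. wedge (d0 F z) (\<omega> z) = 0")
    case True
    show ?thesis
      by (intro conjI; rule degenerate_conclusions[OF F dF assms(2,3) len con _ U'_def con' \<delta>'(1) tube' s(1,2)])
        (use True s(3) in simp_all)
  next
    case False
    then obtain z1 where z1: "z1 \<in> U" "wedge (d0 F z1) (\<omega> z1) \<noteq> 0" by (auto simp del: split_paired_All)
    show ?thesis
      by (intro conjI; rule nondegenerate_conclusions[OF F dF assms(2,3) len con z1 U' \<delta>'(1) tube'])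
  qed
  then show ?thesis unfolding darboux_conclusion_def godbillon_vey_conclusion_def .
qed

end
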